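(* There is an algorithm which, given two node-labeled ordered rooted trees $T_1,T_2$, each with at most $n$ nodes, and a parameter $k$ such that $\mathsf{ed}(T_1,T_2)\le k$, computes $\mathsf{ed}(T_1,T_2)$ exactly in $O(nk^2\log n)$ time.
   Context: An ordered rooted tree is a rooted tree in which the children of every node are linearly ordered; a forest is a linearly ordered sequence of disjoint ordered rooted trees. Nodes carry labels from an alphabet $\Sigma$. Removing a node $v$ from a forest means deleting $v$ and putting its children, in their order, in the place of $v$ in the child list of its parent (or in the sequence of trees, if $v$ is a root). The (unweighted) tree edit distance $\mathsf{ed}(F_1,F_2)$ between two labeled forests is the minimum number of operations, each being either the relabeling of a single node (changing its label to another symbol of $\Sigma$) or the removal of a single node, that must be applied to $F_1$ and to $F_2$ (operations on both sides are counted) so that the two resulting labeled ordered forests are identical. *)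

theory Defs
  imports Complex_Main
begin

section \<open>Ordered labeled forests and the tree edit distance\<close>

datatype 'a tree = Node 'a "'a tree list"

type_synonym 'a forest = "'a tree list"

text \<open>The number of nodes; the generated \<open>size\<close> also counts list constructors.\<close>

fun nodes :: "'a tree \<Rightarrow> nat" where
  "nodes (Node a ts) = 1 + sum_list (map nodes ts)"

inductive edit :: "'a set \<Rightarrow> 'a forest \<Rightarrow> 'a forest \<Rightarrow> bool" for \<Sigma> where
  relabel: "b \<in> \<Sigma> \<Longrightarrow> b \<noteq> a \<Longrightarrow> edit \<Sigma> (us @ Node a ts # vs) (us @ Node b ts # vs)"
| remove: "edit \<Sigma> (us @ Node a ts # vs) (us @ ts @ vs)"
| below: "edit \<Sigma> ts ts' \<Longrightarrow> edit \<Sigma> (us @ Node a ts # vs) (us @ Node a ts' # vs)"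

definition ed :: "'a set \<Rightarrow> 'a forest \<Rightarrow> 'a forest \<Rightarrow> nat" where
  "ed \<Sigma> F1 F2 =
     (LEAST d. \<exists>i j F. d = i + j \<and> (edit \<Sigma> ^^ i) F1 F \<and> (edit \<Sigma> ^^ j) F2 F)"

text \<open>The minimum is over a nonempty set, since both forests can be emptied.\<close>

lemma edit_to_empty: "(edit \<Sigma> ^^ sum_list (map nodes F)) F []"
proof (induction "sum_list (map nodes F)" arbitrary: F)
  case 0
  have "F = []"
  proof (cases F)
    case (Cons T vs)
    then show ?thesis using 0 by (cases T) simp
  qed simp
  then show ?case by simp
next
  case (Suc m)
  from Suc.hyps(2) obtain T vs where "F = T # vs" by (cases F) auto
  then obtain a ts where F: "F = Node a ts # vs" by (cases T) blast
  then have m: "m = sum_list (map nodes (ts @ vs))"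
    using Suc.hyps(2) by simp
  have "edit \<Sigma> F (ts @ vs)"
    using edit.remove[of \<Sigma> "[]" a ts vs] F by simp
  moreover have "(edit \<Sigma> ^^ m) (ts @ vs) []"
    using Suc.hyps(1)[OF m] m by simp
  ultimately have "(edit \<Sigma> ^^ Suc m) F []" by (rule relpowp_Suc_I2)
  then show ?case using Suc.hyps(2) by simp
qed

lemma ed_attained:
  "\<exists>i j F. ed \<Sigma> F1 F2 = i + j \<and> (edit \<Sigma> ^^ i) F1 F \<and> (edit \<Sigma> ^^ j) F2 F"
  unfolding ed_def
proof (rule LeastI_ex)
  show "\<exists>d i j F. d = i + j \<and> (edit \<Sigma> ^^ i) F1 F \<and> (edit \<Sigma> ^^ j) F2 F"
    by (intro exI conjI, rule refl, rule edit_to_empty, rule edit_to_empty)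
qed

lemma ed_le: "(edit \<Sigma> ^^ i) F1 F \<Longrightarrow> (edit \<Sigma> ^^ j) F2 F \<Longrightarrow> ed \<Sigma> F1 F2 \<le> i + j"
  unfolding ed_def by (rule Least_le) (intro exI conjI; (assumption | rule refl))


section \<open>A word RAM\<close>

text \<open>
  Machine words are the natural numbers below \<open>2 ^ w\<close>, where the word size \<open>w\<close> is a parameter
  of the semantics on which programs cannot depend. A program uses finitely many registers
  and a memory indexed by words. Every evaluated node of an expression
  (constant, register access, memory read, arithmetic operation) and every executed
  assignment, store and branch takes one unit of time.
\<close>

type_synonym reg = string

type_synonym state = "(reg \<Rightarrow> nat) \<times> (nat \<Rightarrow> nat)"

datatype binop = Add | Sub | Mul | Div | Mod | Less | Eq

datatype exp = Const nat | Reg reg | Load exp | Bin binop exp exp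

datatype com =
    Skip
  | Assign reg exp
  | Store exp exp
  | Seq com com
  | If exp com com
  | While exp com

text \<open>Subtraction wraps around, and its arguments are words; division by zero yields zero.\<close>

fun binop_val :: "nat \<Rightarrow> binop \<Rightarrow> nat \<Rightarrow> nat \<Rightarrow> nat" where
  "binop_val w Add a b = (a + b) mod 2 ^ w"
| "binop_val w Sub a b = (a + 2 ^ w - b) mod 2 ^ w"
| "binop_val w Mul a b = (a * b) mod 2 ^ w"
| "binop_val w Div a b = (a div b) mod 2 ^ w"
| "binop_val w Mod a b = (a mod b) mod 2 ^ w"
| "binop_val w Less a b = of_bool (a < b) mod 2 ^ w"
| "binop_val w Eq a b = of_bool (a = b) mod 2 ^ w"

fun exp_val :: "nat \<Rightarrow> exp \<Rightarrow> state \<Rightarrow> nat" where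
  "exp_val w (Const v) s = v mod 2 ^ w"
| "exp_val w (Reg x) s = fst s x"
| "exp_val w (Load e) s = snd s (exp_val w e s)"
| "exp_val w (Bin f e1 e2) s = binop_val w f (exp_val w e1 s) (exp_val w e2 s)"

fun exp_time :: "exp \<Rightarrow> nat" where
  "exp_time (Const v) = 1"
| "exp_time (Reg x) = 1"
| "exp_time (Load e) = 1 + exp_time e"
| "exp_time (Bin f e1 e2) = 1 + exp_time e1 + exp_time e2"

text \<open>\<open>exec w c s t s'\<close>: started in \<open>s\<close>, the program \<open>c\<close> halts in \<open>s'\<close> after \<open>t\<close> time units.\<close>

inductive exec :: "nat \<Rightarrow> com \<Rightarrow> state \<Rightarrow> nat \<Rightarrow> state \<Rightarrow> bool" for w where
  Skip: "exec w Skip s 1 s"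
| Assign: "exec w (Assign x e) s (1 + exp_time e) ((fst s)(x := exp_val w e s), snd s)"
| Store: "exec w (Store e1 e2) s (1 + exp_time e1 + exp_time e2)
            (fst s, (snd s)(exp_val w e1 s := exp_val w e2 s))"
| Seq: "exec w c1 s1 t1 s2 \<Longrightarrow> exec w c2 s2 t2 s3 \<Longrightarrow> exec w (Seq c1 c2) s1 (t1 + t2) s3"
| IfTrue: "exp_val w e s \<noteq> 0 \<Longrightarrow> exec w c1 s t s' \<Longrightarrow>
            exec w (If e c1 c2) s (1 + exp_time e + t) s'"
| IfFalse: "exp_val w e s = 0 \<Longrightarrow> exec w c2 s t s' \<Longrightarrow>
            exec w (If e c1 c2) s (1 + exp_time e + t) s'"
| WhileFalse: "exp_val w e s = 0 \<Longrightarrow> exec w (While e c) s (1 + exp_time e) s"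
| WhileTrue: "exp_val w e s1 \<noteq> 0 \<Longrightarrow> exec w c s1 t1 s2 \<Longrightarrow> exec w (While e c) s2 t2 s3 \<Longrightarrow>
            exec w (While e c) s1 (1 + exp_time e + t1 + t2) s3"

inductive_cases exec_SkipE: "exec w Skip s t s'"
inductive_cases exec_AssignE: "exec w (Assign x e) s t s'"
inductive_cases exec_StoreE: "exec w (Store e1 e2) s t s'"
inductive_cases exec_SeqE: "exec w (Seq c1 c2) s t s'"
inductive_cases exec_IfE: "exec w (If e c1 c2) s t s'"
inductive_cases exec_WhileE: "exec w (While e c) s t s'"

text \<open>Programs are deterministic, so the existence of an execution is termination.\<close>

lemma exec_deterministic:
  "exec w c s t s' \<Longrightarrow> exec w c s u s'' \<Longrightarrow> u = t \<and> s'' = s'"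
proof (induction arbitrary: u s'' rule: exec.induct)
  case (Skip s)
  then show ?case by (auto elim: exec_SkipE)
next
  case (Assign x e s)
  then show ?case by (auto elim: exec_AssignE)
next
  case (Store e1 e2 s)
  then show ?case by (auto elim: exec_StoreE)
next
  case (Seq c1 s1 t1 s2 c2 t2 s3)
  from Seq.prems obtain u1 u2 r where "u = u1 + u2" "exec w c1 s1 u1 r" "exec w c2 r u2 s''"
    by (rule exec_SeqE)
  with Seq.IH(1)[of u1 r] Seq.IH(2)[of u2 s''] show ?case by simp
next
  case (IfTrue e s c1 t s' c2)
  from IfTrue.prems show ?case
    by (rule exec_IfE) (use IfTrue.hyps in \<open>auto dest: IfTrue.IH\<close>)
next
  case (IfFalse e s c2 t s' c1)
  from IfFalse.prems show ?case
    by (rule exec_IfE) (use IfFalse.hyps in \<open>auto dest: IfFalse.IH\<close>)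
next
  case (WhileFalse e s c)
  from WhileFalse.prems show ?case
    by (rule exec_WhileE) (use WhileFalse.hyps in auto)
next
  case (WhileTrue e s1 c t1 s2 t2 s3)
  from WhileTrue.prems obtain u1 r u2 where
    "u = 1 + exp_time e + u1 + u2" "exec w c s1 u1 r" "exec w (While e c) r u2 s''"
    by (rule exec_WhileE) (use WhileTrue.hyps(1) in auto)
  with WhileTrue.IH(1)[of u1 r] WhileTrue.IH(2)[of u2 s''] show ?case by simp
qed


section \<open>Input and output\<close>

text \<open>
  Labels are symbols represented by machine words. A tree is given by its nodes in preorder,
  each with its label and its number of children.
\<close>

fun preorder :: "nat tree \<Rightarrow> nat list" where
  "preorder (Node a ts) = a # length ts # concat (map preorder ts)"

definition input :: "nat \<Rightarrow> nat tree \<Rightarrow> nat tree \<Rightarrow> nat list" where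
  "input k T1 T2 = k # nodes T1 # nodes T2 # preorder T1 @ preorder T2"

definition start :: "nat list \<Rightarrow> state" where
  "start xs = (\<lambda>_. 0, \<lambda>i. if i < length xs then xs ! i else 0)"

definition result :: "state \<Rightarrow> nat" where
  "result s = fst s ''out''"

end

theory Submission
  imports Defs
begin

text \<open>
  Write each tree as a string of brackets, so that subforests become intervals of positions. The
  distance of two intervals satisfies a recurrence that strips brackets or a whole tree
  from the left or from the right end; the second interval decides from which end. Counting
  one for every skipped bracket, an alignment of cost \<open>c\<close> shifts positions by at most \<open>c\<close> in total, and
  this remains true in both halves when a pair of nodes is matched. Hence for each interval of the
  second string only \<open>O(k\<^sup>2)\<close> intervals of the first string, with both ends within \<open>O(k)\<close>, matter.

  It remains to keep the number of intervals of the second string down to \<open>O(n log n)\<close>. Instead of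
  Klein's heavy paths, the nodes are classified by the number most divisible by two that their
  bracket pair surrounds. For each such centre \<open>p\<close>, divisible by exactly \<open>2 ^ i\<close>, one sequence of
  intervals growing from \<open>p\<close> inside \<open>{p - 2 ^ i..<p + 2 ^ i}\<close> is closed under the recurrence, up to
  interiors of nodes with less divisible centres, which were treated before.
\<close>

section \<open>The forest edit distance by left recursion\<close>

text \<open>The table is filled only in a band, so correctness is split in two. Every entry,
  computed or not, overestimates (\<open>sound\<close>); an entry is guaranteed to be right only if
  the displacement of its ends plus its cost stays within a budget \<open>K\<close>
  (\<open>exact\<close>). A minimum over overestimates is right as soon as one optimal branch lies
  within the budget, so entries outside the band may be read without a test. Memory starts at zero
  and zero encodes infinity, so the table of order \<open>M ^ 4\<close> is sound before anything is
  written to it. The direction of growth is a function of the second interval alone, because one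
  sequence of second intervals must serve all first intervals in the band. Dyadic centres are
  enumerated by loop counters, and the windows of one phase are disjoint: \<open>O(N)\<close> growth
  steps per phase, \<open>O(log N)\<close> phases, \<open>O(K\<^sup>2)\<close> cells per
  step.\<close>

fun sz :: "'a forest \<Rightarrow> nat" where
  "sz [] = 0"
| "sz (Node a ts # F) = Suc (sz ts + sz F)"

lemma sz_append [simp]: "sz (F @ G) = sz F + sz G"
  by (induction F rule: sz.induct) auto

lemma sum_list_nodes: "sum_list (map nodes F) = sz F"
  by (induction F rule: sz.induct) auto

lemma nodes_eq_sz: "nodes T = sz [T]"
  using sum_list_nodes[of "[T]"] by simp

function dl :: "'a forest \<Rightarrow> 'a forest \<Rightarrow> nat" where
  "dl [] G = sz G"
| "dl (Node a ts # F) [] = Suc (sz ts + sz F)"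
| "dl (Node a ts # F) (Node b us # G) =
     min (Suc (dl (ts @ F) (Node b us # G)))
       (min (Suc (dl (Node a ts # F) (us @ G))) (of_bool (a \<noteq> b) + dl ts us + dl F G))"
  by pat_completeness auto
termination by (relation "measure (\<lambda>(F, G). sz F + sz G)") auto

lemma dl_Nil2 [simp]: "dl F [] = sz F"
  by (cases "(F, [] :: 'a forest)" rule: dl.cases) auto

lemma dl_delete: "dl (Node a ts # F) G \<le> Suc (dl (ts @ F) G)"
  by (cases "(Node a ts # F, G)" rule: dl.cases) auto

lemma dl_commute: "dl F G = dl G F"
proof (induction F G rule: dl.induct)
  case (3 a ts F b us G)
  then show ?case by (simp add: min.left_commute min.commute add.commute eq_commute)
qed auto

lemma dl_refl [simp]: "dl F F = 0"
  by (induction F rule: sz.induct) auto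

lemma sz_le_dl: "sz F \<le> sz G + dl F G"
  by (induction F G rule: dl.induct) auto

lemma edit_sz: "edit \<Sigma> F F' \<Longrightarrow> sz F \<le> Suc (sz F')"
  by (induction rule: edit.induct) auto

lemma edit_Nil:
  assumes "edit \<Sigma> F []" obtains a where "F = [Node a []]"
  using assms by (cases rule: edit.cases) auto

lemma edit_append_left: "edit \<Sigma> F F' \<Longrightarrow> edit \<Sigma> (G @ F) (G @ F')"
proof (induction rule: edit.induct)
  case (relabel b a us ts vs)
  then show ?case using edit.relabel[of b \<Sigma> a "G @ us"] by simp
next
  case (remove us a ts vs)
  then show ?case using edit.remove[of \<Sigma> "G @ us"] by simp
next
  case (below ts ts' us a vs)
  then show ?case using edit.below[of \<Sigma> ts ts' "G @ us"] by simp
qed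

lemma edit_append_right: "edit \<Sigma> F F' \<Longrightarrow> edit \<Sigma> (F @ G) (F' @ G)"
proof (induction rule: edit.induct)
  case (relabel b a us ts vs)
  then show ?case using edit.relabel[of b \<Sigma> a us ts "vs @ G"] by simp
next
  case (remove us a ts vs)
  then show ?case using edit.remove[of \<Sigma> us a ts "vs @ G"] by simp
next
  case (below ts ts' us a vs)
  then show ?case using edit.below[of \<Sigma> ts ts' us a "vs @ G"] by simp
qed

text \<open>Reads an edit backwards, by its place relative to the first tree of the result. A
  removal at the front is kept as an equation, since the removed node may have had any number of
  children there.\<close>

lemma edit_Cons:
  assumes "edit \<Sigma> F (Node x ts # R)"
  obtains (relabel) y where "F = Node y ts # R"
  | (remove) y ys R' where "F = Node y ys # R'" "ys @ R' = Node x ts # R"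
  | (below) ts0 where "F = Node x ts0 # R" "edit \<Sigma> ts0 ts"
  | (tail) R0 where "F = Node x ts # R0" "edit \<Sigma> R0 R"
  using assms
proof (cases rule: edit.cases)
  case (relabel b a us ts' vs)
  show thesis
  proof (cases us)
    case Nil
    then show thesis using relabel that(1) by auto
  next
    case (Cons z zs)
    then show thesis using relabel that(4)[of "zs @ Node a ts' # vs"] edit.relabel[of b \<Sigma> a zs ts' vs] by auto
  qed
next
  case (remove us a ts' vs)
  show thesis
  proof (cases us)
    case Nil
    then show thesis using remove that(2) by auto
  next
    case (Cons z zs)
    then show thesis using remove that(4)[of "zs @ Node a ts' # vs"] edit.remove[of \<Sigma> zs a ts' vs] by auto
  qed
next
  case (below ts0 ts' us a vs)
  show thesis
  proof (cases us)
    case Nil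
    then show thesis using below that(3) by auto
  next
    case (Cons z zs)
    then show thesis using below that(4)[of "zs @ Node a ts0 # vs"] edit.below[of \<Sigma> ts0 ts' zs a vs] by auto
  qed
qed

text \<open>One edit lowers \<open>dl\<close> by at most one. A removal at the front is itself a
  branch of the recursion; any other edit is carried along into those branches for \<open>F'\<close>
  that still contain the edited node, and relabelling the first node changes only the mismatch
  term.\<close>

lemma edit_dl: "edit \<Sigma> F F' \<Longrightarrow> dl F G \<le> Suc (dl F' G)"
proof (induction F' G arbitrary: F rule: dl.induct)
  case (1 G)
  then show ?case using dl_delete[of _ "[]" "[]" G] by (auto elim!: edit_Nil)
next
  case (2 a ts F)
  then show ?case using edit_sz by fastforce
next
  case (3 x ts R y us G)
  from 3(5) show ?case
  proof (cases rule: edit_Cons)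
    case (relabel z)
    moreover have "dl F (us @ G) \<le> Suc (dl (Node x ts # R) (us @ G))"
      using 3(2,5) by blast
    ultimately show ?thesis by auto
  next
    case (remove z zs R')
    then show ?thesis using dl_delete[of z zs R' "Node y us # G"] by metis
  next
    case (below ts0)
    have "dl (ts0 @ R) (Node y us # G) \<le> Suc (dl (ts @ R) (Node y us # G))"
      using 3(1) below edit_append_right by blast
    moreover have "dl F (us @ G) \<le> Suc (dl (Node x ts # R) (us @ G))"
      using 3(2,5) by blast
    moreover have "dl ts0 us \<le> Suc (dl ts us)" using 3(3) below by blast
    ultimately show ?thesis using below by auto
  next
    case (tail R0)
    have "dl (ts @ R0) (Node y us # G) \<le> Suc (dl (ts @ R) (Node y us # G))"
      using 3(1) tail edit_append_left by blast
    moreover have "dl F (us @ G) \<le> Suc (dl (Node x ts # R) (us @ G))"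
      using 3(2,5) by blast
    moreover have "dl R0 G \<le> Suc (dl R G)" using 3(4) tail by blast
    ultimately show ?thesis using tail by auto
  qed
qed

lemma edits_dl: "(edit \<Sigma> ^^ i) F F' \<Longrightarrow> dl F G \<le> i + dl F' G"
proof (induction i arbitrary: F)
  case (Suc i)
  then obtain F1 where "edit \<Sigma> F F1" "(edit \<Sigma> ^^ i) F1 F'" by (metis relpowp_Suc_D2)
  then show ?case using edit_dl[of \<Sigma> F F1 G] Suc.IH[of F1] by linarith
qed auto

lemma edits_context:
  assumes "\<And>F F'. edit \<Sigma> F F' \<Longrightarrow> edit \<Sigma> (f F) (f F')"
  shows "(edit \<Sigma> ^^ i) F F' \<Longrightarrow> (edit \<Sigma> ^^ i) (f F) (f F')"
  by (induction i arbitrary: F') (use assms in \<open>auto intro: relcomppI\<close>)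

lemma edits_Cons:
  assumes "(edit \<Sigma> ^^ i) ts ts'" "(edit \<Sigma> ^^ j) F F'"
  shows "(edit \<Sigma> ^^ (i + j)) (Node a ts # F) (Node a ts' # F')"
proof -
  have "(edit \<Sigma> ^^ i) (Node a ts # F) (Node a ts' # F)"
    using edits_context[of \<Sigma> "\<lambda>ts. Node a ts # F", OF _ assms(1)] edit.below[of \<Sigma> _ _ "[]" a F] by simp
  moreover have "(edit \<Sigma> ^^ j) (Node a ts' # F) (Node a ts' # F')"
    using edits_context[of \<Sigma> "\<lambda>F. Node a ts' # F", OF _ assms(2)] edit_append_left[of \<Sigma> _ _ "[Node a ts']"] by simp
  ultimately show ?thesis unfolding relpowp_add by blast
qed

text \<open>The alphabet condition is on \<open>G\<close> because a mismatched pair is always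
  relabelled on the side of \<open>F\<close>, to the label that occurs in \<open>G\<close>.\<close>

lemma dl_edits:
  assumes "\<Union> (set_tree ` set G) \<subseteq> \<Sigma>"
  shows "\<exists>i j H. dl F G = i + j \<and> (edit \<Sigma> ^^ i) F H \<and> (edit \<Sigma> ^^ j) G H"
  using assms
proof (induction F G rule: dl.induct)
  case (1 G)
  have "(edit \<Sigma> ^^ 0) [] []" "(edit \<Sigma> ^^ sz G) G []" using edit_to_empty[where F = G] by (auto simp: sum_list_nodes)
  then show ?case by (intro exI[of _ 0] exI[of _ "sz G"] exI[of _ "[]"] conjI) auto
next
  case (2 a ts F)
  have "(edit \<Sigma> ^^ 0) [] []" "(edit \<Sigma> ^^ sz (Node a ts # F)) (Node a ts # F) []"
    using edit_to_empty[where F = "Node a ts # F"] by (simp_all only: sum_list_nodes) simp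
  then show ?case by (intro exI[of _ "sz (Node a ts # F)"] exI[of _ 0] exI[of _ "[]"] conjI) auto
next
  case (3 a ts F b us G)
  consider "dl (Node a ts # F) (Node b us # G) = Suc (dl (ts @ F) (Node b us # G))"
    | "dl (Node a ts # F) (Node b us # G) = Suc (dl (Node a ts # F) (us @ G))"
    | "dl (Node a ts # F) (Node b us # G) = of_bool (a \<noteq> b) + dl ts us + dl F G"
    unfolding dl.simps(3) by linarith
  then show ?case
  proof cases
    case 1
    from 3 obtain i j H where "dl (ts @ F) (Node b us # G) = i + j" "(edit \<Sigma> ^^ i) (ts @ F) H"
      "(edit \<Sigma> ^^ j) (Node b us # G) H" by meson
    moreover then have "(edit \<Sigma> ^^ Suc i) (Node a ts # F) H"
      using edit.remove[of \<Sigma> "[]" a ts F, simplified] by (meson relpowp_Suc_I2)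
    ultimately show ?thesis using 1 by (metis add_Suc)
  next
    case 2
    from 3 obtain i j H where "dl (Node a ts # F) (us @ G) = i + j" "(edit \<Sigma> ^^ i) (Node a ts # F) H"
      "(edit \<Sigma> ^^ j) (us @ G) H" by (auto simp: image_Un)
    moreover then have "(edit \<Sigma> ^^ Suc j) (Node b us # G) H"
      using edit.remove[of \<Sigma> "[]" b us G, simplified] by (meson relpowp_Suc_I2)
    ultimately show ?thesis using 2 by (metis add_Suc_right)
  next
    case c3: 3
    from 3 obtain i j H where 1: "dl ts us = i + j" "(edit \<Sigma> ^^ i) ts H" "(edit \<Sigma> ^^ j) us H"
      by auto
    from 3 obtain i' j' H' where 2: "dl F G = i' + j'" "(edit \<Sigma> ^^ i') F H'" "(edit \<Sigma> ^^ j') G H'"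
      by auto
    have b: "b \<in> \<Sigma>" using 3 by auto
    have "(edit \<Sigma> ^^ (of_bool (a \<noteq> b) + (i + i'))) (Node a ts # F) (Node b H # H')"
    proof (cases "a = b")
      case True
      then show ?thesis using edits_Cons[OF 1(2) 2(2)] by simp
    next
      case False
      then have "edit \<Sigma> (Node a ts # F) (Node b ts # F)" using edit.relabel[of b \<Sigma> a "[]"] b by simp
      then have "(edit \<Sigma> ^^ Suc (i + i')) (Node a ts # F) (Node b H # H')"
        using edits_Cons[OF 1(2) 2(2)] by (rule relpowp_Suc_I2)
      then show ?thesis using False by simp
    qed
    moreover have "(edit \<Sigma> ^^ (j + j')) (Node b us # G) (Node b H # H')"
      using edits_Cons[OF 1(3) 2(3)] .
    moreover have "dl (Node a ts # F) (Node b us # G) = (of_bool (a \<noteq> b) + (i + i')) + (j + j')"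
      using c3 1 2 by simp
    ultimately show ?thesis by blast
  qed
qed

text \<open>Lower bound: both edit sequences end in the same \<open>H\<close>, each edit lowers
  \<open>dl\<close> by at most one, and \<open>dl H H = 0\<close>.\<close>

lemma ed_eq_dl:
  assumes "\<Union> (set_tree ` set G) \<subseteq> \<Sigma>"
  shows "ed \<Sigma> F G = dl F G"
proof (rule antisym)
  show "ed \<Sigma> F G \<le> dl F G" using dl_edits[OF assms, of F] ed_le by metis
  obtain i j H where "ed \<Sigma> F G = i + j" "(edit \<Sigma> ^^ i) F H" "(edit \<Sigma> ^^ j) G H"
    using ed_attained by blast
  then show "dl F G \<le> ed \<Sigma> F G"
    using edits_dl[of i \<Sigma> F H G] edits_dl[of j \<Sigma> G H H] by (simp add: dl_commute[of G H])
qed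

section \<open>Mirror images and the recursion from the right end\<close>

fun mir :: "'a forest \<Rightarrow> 'a forest" where
  "mir [] = []"
| "mir (Node a ts # F) = mir F @ [Node a (mir ts)]"

lemma mir_append [simp]: "mir (F @ G) = mir G @ mir F"
  by (induction F rule: mir.induct) auto

lemma mir_mir [simp]: "mir (mir F) = F"
  by (induction F rule: mir.induct) auto

lemma edit_mir: "edit \<Sigma> F F' \<Longrightarrow> edit \<Sigma> (mir F) (mir F')"
proof (induction rule: edit.induct)
  case (relabel b a us ts vs)
  then show ?case using edit.relabel[of b \<Sigma> a "mir vs" "mir ts" "mir us"] by simp
next
  case (remove us a ts vs)
  then show ?case using edit.remove[of \<Sigma> "mir vs" a "mir ts" "mir us"] by simp
next
  case (below ts ts' us a vs)
  then show ?case using edit.below[of \<Sigma> "mir ts" "mir ts'" "mir vs" a "mir us"] by simp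
qed

text \<open>The left recursion is not visibly symmetric, but the edit distance is: a mirrored edit
  is an edit. The alphabet \<open>UNIV\<close> makes \<open>ed_eq_dl\<close> available for all
  forests.\<close>

lemma dl_mir: "dl (mir F) (mir G) = dl F G"
proof -
  have le: "dl (mir F) (mir G) \<le> dl F G" for F G :: "'a forest"
  proof -
    obtain i j H where "ed UNIV F G = i + j" "(edit UNIV ^^ i) F H" "(edit UNIV ^^ j) G H"
      using ed_attained by blast
    moreover then have "(edit UNIV ^^ i) (mir F) (mir H)" "(edit UNIV ^^ j) (mir G) (mir H)"
      using edits_context[of UNIV mir] edit_mir by blast+
    ultimately show ?thesis using ed_le[of i UNIV "mir F" "mir H" j "mir G"] by (simp add: ed_eq_dl)
  qed
  show ?thesis using le[of F G] le[of "mir F" "mir G"] by simp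
qed

lemma dl_delete_right: "dl (F @ [Node a ts]) G \<le> Suc (dl (F @ ts) G)"
  using dl_delete[of a "mir ts" "mir F" "mir G"] dl_mir[of "F @ [Node a ts]" G] dl_mir[of "F @ ts" G] by simp

lemma dl_snoc:
  "dl (F @ [Node a ts]) (G @ [Node b us]) =
     min (Suc (dl (F @ ts) (G @ [Node b us])))
       (min (Suc (dl (F @ [Node a ts]) (G @ us))) (of_bool (a \<noteq> b) + dl ts us + dl F G))"
proof -
  have "dl (F @ [Node a ts]) (G @ [Node b us])
      = dl (Node a (mir ts) # mir F) (Node b (mir us) # mir G)"
    using dl_mir[of "F @ [Node a ts]" "G @ [Node b us]"] by simp
  moreover have "dl (mir ts @ mir F) (Node b (mir us) # mir G) = dl (F @ ts) (G @ [Node b us])"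
    using dl_mir[of "F @ ts" "G @ [Node b us]"] by simp
  moreover have "dl (Node a (mir ts) # mir F) (mir us @ mir G) = dl (F @ [Node a ts]) (G @ us)"
    using dl_mir[of "F @ [Node a ts]" "G @ us"] by simp
  ultimately show ?thesis by (simp add: dl_mir)
qed

section \<open>Intervals of Euler tours\<close>

text \<open>
  A forest is written as a string of brackets, one pair per node; \<open>m i\<close> is the partner of the bracket
  at position \<open>i\<close>. An interval \<open>{a..<b}\<close> denotes the forest of the nodes with both brackets inside.
\<close>

definition wfm :: "nat \<Rightarrow> nat \<Rightarrow> (nat \<Rightarrow> nat) \<Rightarrow> bool" where
  "wfm lo hi m \<longleftrightarrow> (\<forall>i. lo \<le> i \<and> i < hi \<longrightarrow> lo \<le> m i \<and> m i < hi \<and> m (m i) = i \<and> m i \<noteq> i \<and>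
     (\<forall>j. i < j \<and> j < m i \<longrightarrow> i < m j \<and> m j < m i))"

function fo :: "(nat \<Rightarrow> nat) \<Rightarrow> (nat \<Rightarrow> 'a) \<Rightarrow> nat \<Rightarrow> nat \<Rightarrow> 'a forest" where
  "fo m lab a b = (if b \<le> a then []
     else if a < m a \<and> m a < b then Node (lab a) (fo m lab (Suc a) (m a)) # fo m lab (Suc (m a)) b
     else fo m lab (Suc a) b)"
  by pat_completeness auto
termination by (relation "measure (\<lambda>(m, lab, a, b). b - a)") auto

declare fo.simps [simp del]

lemma fo_empty [simp]: "b \<le> a \<Longrightarrow> fo m lab a b = []"
  by (simp add: fo.simps)

lemma fo_skip: "\<not> (a < m a \<and> m a < b) \<Longrightarrow> fo m lab a b = fo m lab (Suc a) b"
  by (subst fo.simps) auto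

lemma fo_open:
  "a < m a \<Longrightarrow> m a < b \<Longrightarrow>
   fo m lab a b = Node (lab a) (fo m lab (Suc a) (m a)) # fo m lab (Suc (m a)) b"
  by (subst fo.simps) auto

text \<open>No pair straddles the cut inside the interval; pairs that leave the interval on the
  right are unmatched on both sides of the equation.\<close>

lemma fo_split:
  assumes "a \<le> x" "x \<le> b" "\<And>i. a \<le> i \<Longrightarrow> i < x \<Longrightarrow> m i < x \<or> b \<le> m i"
  shows "fo m lab a b = fo m lab a x @ fo m lab x b"
  using assms
proof (induction m lab a b rule: fo.induct)
  case (1 m lab a b)
  show ?case
  proof (cases "a = x")
    case False
    then have ax: "a < x" using 1 by simp
    show ?thesis
    proof (cases "a < m a \<and> m a < b")
      case True
      then have "m a < x" using 1(6)[of a] ax by auto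
      moreover have "fo m lab (Suc (m a)) b = fo m lab (Suc (m a)) x @ fo m lab x b"
        using 1(2) True ax 1(5,6) \<open>m a < x\<close> by simp
      ultimately show ?thesis using True fo_open[of a m x lab] by (simp add: fo_open)
    next
      case False
      then have "fo m lab (Suc a) b = fo m lab (Suc a) x @ fo m lab x b"
        using 1(3) ax 1(5,6) by simp
      moreover have "\<not> (a < m a \<and> m a < x)" using False 1(5) by auto
      ultimately show ?thesis using False by (simp add: fo_skip)
    qed
  qed simp
qed

lemma sz_fo: "2 * sz (fo m lab a b) \<le> b - a"
proof (induction m lab a b rule: fo.induct)
  case (1 m lab a b)
  show ?case
  proof (cases "b \<le> a")
    case False
    then show ?thesis using 1 by (cases "a < m a \<and> m a < b") (auto simp: fo_open fo_skip)
  qed simp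
qed

lemma wfmD:
  assumes "wfm lo hi m" "lo \<le> i" "i < hi"
  shows "lo \<le> m i" "m i < hi" "m (m i) = i" "m i \<noteq> i"
    and "\<And>j. i < j \<Longrightarrow> j < m i \<Longrightarrow> i < m j \<and> m j < m i"
  using assms unfolding wfm_def by auto

locale bracketing =
  fixes m :: "nat \<Rightarrow> nat" and lab :: "nat \<Rightarrow> 'a" and N :: nat
  assumes wf: "wfm 0 N m" and lab: "\<And>i. i < N \<Longrightarrow> lab (m i) = lab i"
begin

lemma m_less: "i < N \<Longrightarrow> m i < N"
  and m_m: "i < N \<Longrightarrow> m (m i) = i"
  and nest: "i < j \<Longrightarrow> j < m i \<Longrightarrow> i < N \<Longrightarrow> i < m j \<and> m j < m i"
  using wfmD[OF wf, of i] by auto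

text \<open>Stripping the opening bracket \<open>a\<close> orphans its partner, which is then
  skipped. What is left are the children followed by the siblings, as after removing the
  node.\<close>

lemma fo_children:
  assumes "a < m a" "m a < b" "b \<le> N"
  shows "fo m lab (Suc a) b = fo m lab (Suc a) (m a) @ fo m lab (Suc (m a)) b"
proof -
  have "fo m lab (Suc a) b = fo m lab (Suc a) (m a) @ fo m lab (m a) b"
    using assms nest[of a] by (intro fo_split) auto
  moreover have "fo m lab (m a) b = fo m lab (Suc (m a)) b"
    using assms m_m[of a] by (intro fo_skip) auto
  ultimately show ?thesis by simp
qed

lemma fo_skip_right:
  assumes "\<not> (a \<le> m b \<and> m b < b)" "b < N"
  shows "fo m lab a (Suc b) = fo m lab a b"
proof (cases "a \<le> b")
  case True
  have *: "m i < b \<or> Suc b \<le> m i" if "a \<le> i" "i < b" for i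
    using assms that m_m[of i] by (metis Suc_leI le_neq_implies_less less_trans not_less)
  have "fo m lab a (Suc b) = fo m lab a b @ fo m lab b (Suc b)"
    using True * by (intro fo_split) auto
  moreover have "fo m lab b (Suc b) = []" by (subst fo_skip) auto
  ultimately show ?thesis by simp
qed simp

text \<open>Counterpart at the right end: by nesting, no pair straddles \<open>m b\<close> within
  the interval, and stripping the closing bracket \<open>b\<close> again amounts to removing its
  node.\<close>

lemma fo_close:
  assumes "a \<le> m b" "m b < b" "b < N"
  shows "fo m lab a (Suc b) = fo m lab a (m b) @ [Node (lab b) (fo m lab (Suc (m b)) b)]"
    and "fo m lab a b = fo m lab a (m b) @ fo m lab (Suc (m b)) b"
proof -
  have u: "m b < N" "m (m b) = b" using assms m_less m_m by auto
  have *: "m i < m b \<or> b < m i" if "i < m b" for i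
  proof -
    have "m i \<noteq> m b" using that m_m[of i] m_m[of b] assms u by auto
    moreover have "\<not> (m b < m i \<and> m i < b)"
      using nest[of "m b" "m i"] u that m_m[of i] by auto
    moreover have "m i \<noteq> b" using that u m_m[of i] by auto
    ultimately show ?thesis by linarith
  qed
  have "fo m lab a (Suc b) = fo m lab a (m b) @ fo m lab (m b) (Suc b)"
    using assms * by (intro fo_split) (auto simp: Suc_le_eq)
  moreover have "fo m lab (m b) (Suc b) = [Node (lab b) (fo m lab (Suc (m b)) b)]"
    using u assms lab[of b] fo_open[of "m b" m "Suc b" lab] by simp
  ultimately show "fo m lab a (Suc b) = fo m lab a (m b) @ [Node (lab b) (fo m lab (Suc (m b)) b)]"
    by simp
  have "fo m lab a b = fo m lab a (m b) @ fo m lab (m b) b"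
    using assms * by (intro fo_split) (auto intro: less_imp_le)
  moreover have "fo m lab (m b) b = fo m lab (Suc (m b)) b"
    using u by (intro fo_skip) auto
  ultimately show "fo m lab a b = fo m lab a (m b) @ fo m lab (Suc (m b)) b" by simp
qed

end

section \<open>The interval distance and its recurrences\<close>

text \<open>The passage from \<open>dl\<close> to \<open>lam\<close>: doubling and adding the
  unmatched brackets commutes with the minimum if all branches have the same offset
  \<open>C + D\<close>.\<close>

lemma min3_shift:
  fixes C D :: int
  assumes "int x = 2 * int p + C + D" "int y = 2 * int q + C + D" "int z = 2 * int s + C + D"
    "int v = 2 * int (min p (min q s)) + C + D"
  shows "v = min x (min y z)"
  using assms by (auto simp: min_def split: if_splits)

locale two_bracketings = X: bracketing m1 lab1 N1 + Y: bracketing m2 lab2 N2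
  for m1 :: "nat \<Rightarrow> nat" and lab1 :: "nat \<Rightarrow> 'a" and N1
  and m2 :: "nat \<Rightarrow> nat" and lab2 :: "nat \<Rightarrow> 'a" and N2
begin

text \<open>
  Twice the forest distance, plus one for every unmatched bracket. Now skipping any bracket costs
  one, so the cost of an alignment bounds the total shift of positions it causes.
\<close>

definition lam :: "nat \<Rightarrow> nat \<Rightarrow> nat \<Rightarrow> nat \<Rightarrow> nat" where
  "lam a b l r = 2 * dl (fo m1 lab1 a b) (fo m2 lab2 l r)
     + (b - a - 2 * sz (fo m1 lab1 a b)) + (r - l - 2 * sz (fo m2 lab2 l r))"

text \<open>Integer form without truncated subtraction; by \<open>sz_fo\<close> both differences are
  nonnegative.\<close>

lemma lam_eq:
  assumes "a \<le> b" "l \<le> r"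
  shows "int (lam a b l r) = 2 * int (dl (fo m1 lab1 a b) (fo m2 lab2 l r))
     + (int b - int a - 2 * int (sz (fo m1 lab1 a b))) + (int r - int l - 2 * int (sz (fo m2 lab2 l r)))"
  using assms sz_fo[of m1 lab1 a b] sz_fo[of m2 lab2 l r] unfolding lam_def by linarith

text \<open>A length is twice the number of nodes plus the number of unmatched brackets, and the
  numbers of nodes differ by at most \<open>dl\<close>.\<close>

lemma lam_len:
  assumes "a \<le> b" "l \<le> r"
  shows "b - a \<le> r - l + lam a b l r" "r - l \<le> b - a + lam a b l r"
  using lam_eq[OF assms] sz_fo[of m1 lab1 a b] sz_fo[of m2 lab2 l r] assms
    sz_le_dl[of "fo m1 lab1 a b" "fo m2 lab2 l r"] sz_le_dl[of "fo m2 lab2 l r" "fo m1 lab1 a b"]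
    dl_commute[of "fo m1 lab1 a b" "fo m2 lab2 l r"]
  by linarith+

lemma lam_empty1 [simp]: "lam a a l r = r - l"
  using sz_fo[of m2 lab2 l r] unfolding lam_def by simp

lemma lam_empty2 [simp]: "lam a b l l = b - a"
  using sz_fo[of m1 lab1 a b] unfolding lam_def by simp

text \<open>Removing a node costs two, but its orphaned partner is already charged one in the
  shorter interval; an unmatched bracket costs one outright. Either way the price is one.\<close>

lemma lam_skip1:
  assumes "a < b" "b \<le> N1" "l \<le> r"
  shows "lam a b l r \<le> Suc (lam (Suc a) b l r)"
proof (cases "a < m1 a \<and> m1 a < b")
  case True
  then show ?thesis
    using lam_eq[of a b l r] lam_eq[of "Suc a" b l r] assms fo_open[of a m1 b lab1]
      X.fo_children[of a b] dl_delete[of "lab1 a" "fo m1 lab1 (Suc a) (m1 a)" "fo m1 lab1 (Suc (m1 a)) b" "fo m2 lab2 l r"]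
    by simp
next
  case False
  then show ?thesis
    using lam_eq[of a b l r] lam_eq[of "Suc a" b l r] assms by (simp add: fo_skip)
qed

lemma lam_skip2:
  assumes "a \<le> b" "l < r" "r \<le> N2"
  shows "lam a b l r \<le> Suc (lam a b (Suc l) r)"
proof (cases "l < m2 l \<and> m2 l < r")
  case True
  then show ?thesis
    using lam_eq[of a b l r] lam_eq[of a b "Suc l" r] assms fo_open[of l m2 r lab2]
      Y.fo_children[of l r] dl_delete[of "lab2 l" "fo m2 lab2 (Suc l) (m2 l)" "fo m2 lab2 (Suc (m2 l)) r" "fo m1 lab1 a b"]
    by (simp add: dl_commute[of "fo m1 lab1 a b"])
next
  case False
  then show ?thesis
    using lam_eq[of a b l r] lam_eq[of a b "Suc l" r] assms by (simp add: fo_skip)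
qed

lemma lam_skip1_right:
  assumes "a \<le> b" "b < N1" "l \<le> r"
  shows "lam a (Suc b) l r \<le> Suc (lam a b l r)"
proof (cases "a \<le> m1 b \<and> m1 b < b")
  case True
  then show ?thesis
    using lam_eq[of a b l r] lam_eq[of a "Suc b" l r] assms X.fo_close[of a b]
      dl_delete_right[of "fo m1 lab1 a (m1 b)" "lab1 b" "fo m1 lab1 (Suc (m1 b)) b" "fo m2 lab2 l r"]
    by simp
next
  case False
  then show ?thesis
    using lam_eq[of a b l r] lam_eq[of a "Suc b" l r] assms X.fo_skip_right[of a b] by simp
qed

lemma lam_skip2_right:
  assumes "a \<le> b" "l \<le> r" "r < N2"
  shows "lam a b l (Suc r) \<le> Suc (lam a b l r)"
proof (cases "l \<le> m2 r \<and> m2 r < r")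
  case True
  then show ?thesis
    using lam_eq[of a b l r] lam_eq[of a b l "Suc r"] assms Y.fo_close[of l r]
      dl_delete_right[of "fo m2 lab2 l (m2 r)" "lab2 r" "fo m2 lab2 (Suc (m2 r)) r" "fo m1 lab1 a b"]
    by (simp add: dl_commute[of "fo m1 lab1 a b"])
next
  case False
  then show ?thesis
    using lam_eq[of a b l r] lam_eq[of a b l "Suc r"] assms Y.fo_skip_right[of l r] by simp
qed

text \<open>In the two skipping branches the orphaned partner and the \<open>Suc\<close> together
  supply the two units charged for the removal. So all branches have the same offset and
  \<open>min3_shift\<close> applies.\<close>

lemma lam_left_aux:
  assumes ab: "a < b" "b \<le> N1" "l < r" "r \<le> N2" and c: "a < m1 a" "m1 a < b" "l < m2 l" "m2 l < r"
  shows "lam a b l r = min (Suc (lam (Suc a) b l r)) (min (Suc (lam a b (Suc l) r))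
      (2 * of_bool (lab1 a \<noteq> lab2 l) + lam (Suc a) (m1 a) (Suc l) (m2 l)
        + lam (Suc (m1 a)) b (Suc (m2 l)) r))"
proof -
  note fo = fo_open[of a m1 b lab1] X.fo_children[of a b] fo_open[of l m2 r lab2] Y.fo_children[of l r]
  let ?A = "fo m1 lab1 (Suc a) (m1 a)" and ?B = "fo m1 lab1 (Suc (m1 a)) b"
  let ?C = "fo m2 lab2 (Suc l) (m2 l)" and ?D = "fo m2 lab2 (Suc (m2 l)) r"
  have "int (Suc (lam (Suc a) b l r)) = 2 * int (Suc (dl (?A @ ?B) (Node (lab2 l) ?C # ?D)))
     + (int b - int a - 2 * int (sz ?A) - 2 * int (sz ?B) - 2) + (int r - int l - 2 * int (sz ?C) - 2 * int (sz ?D) - 2)"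
    using ab c lam_eq[of "Suc a" b l r] fo by simp
  moreover have "int (Suc (lam a b (Suc l) r)) = 2 * int (Suc (dl (Node (lab1 a) ?A # ?B) (?C @ ?D)))
     + (int b - int a - 2 * int (sz ?A) - 2 * int (sz ?B) - 2) + (int r - int l - 2 * int (sz ?C) - 2 * int (sz ?D) - 2)"
    using ab c lam_eq[of a b "Suc l" r] fo by simp
  moreover have "int (2 * of_bool (lab1 a \<noteq> lab2 l) + lam (Suc a) (m1 a) (Suc l) (m2 l) + lam (Suc (m1 a)) b (Suc (m2 l)) r)
      = 2 * int (of_bool (lab1 a \<noteq> lab2 l) + dl ?A ?C + dl ?B ?D)
     + (int b - int a - 2 * int (sz ?A) - 2 * int (sz ?B) - 2) + (int r - int l - 2 * int (sz ?C) - 2 * int (sz ?D) - 2)"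
    using ab c lam_eq[of "Suc a" "m1 a" "Suc l" "m2 l"] lam_eq[of "Suc (m1 a)" b "Suc (m2 l)" r] by simp
  moreover have "int (lam a b l r) = 2 * int (dl (Node (lab1 a) ?A # ?B) (Node (lab2 l) ?C # ?D))
     + (int b - int a - 2 * int (sz ?A) - 2 * int (sz ?B) - 2) + (int r - int l - 2 * int (sz ?C) - 2 * int (sz ?D) - 2)"
    using ab c lam_eq[of a b l r] fo by simp
  ultimately show ?thesis unfolding dl.simps(3) by (rule min3_shift)
qed

lemma lam_right_aux:
  assumes ab: "a \<le> b" "b < N1" "l \<le> r" "r < N2" and c: "a \<le> m1 b" "m1 b < b" "l \<le> m2 r" "m2 r < r"
  shows "lam a (Suc b) l (Suc r) = min (Suc (lam a b l (Suc r))) (min (Suc (lam a (Suc b) l r))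
      (2 * of_bool (lab1 b \<noteq> lab2 r) + lam (Suc (m1 b)) b (Suc (m2 r)) r + lam a (m1 b) l (m2 r)))"
proof -
  note fo = X.fo_close[of a b] Y.fo_close[of l r]
  let ?A = "fo m1 lab1 (Suc (m1 b)) b" and ?B = "fo m1 lab1 a (m1 b)"
  let ?C = "fo m2 lab2 (Suc (m2 r)) r" and ?D = "fo m2 lab2 l (m2 r)"
  have "int (Suc (lam a b l (Suc r))) = 2 * int (Suc (dl (?B @ ?A) (?D @ [Node (lab2 r) ?C])))
     + (int b - int a - 2 * int (sz ?A) - 2 * int (sz ?B) - 1) + (int r - int l - 2 * int (sz ?C) - 2 * int (sz ?D) - 1)"
    using ab c lam_eq[of a b l "Suc r"] fo by simp
  moreover have "int (Suc (lam a (Suc b) l r)) = 2 * int (Suc (dl (?B @ [Node (lab1 b) ?A]) (?D @ ?C)))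
     + (int b - int a - 2 * int (sz ?A) - 2 * int (sz ?B) - 1) + (int r - int l - 2 * int (sz ?C) - 2 * int (sz ?D) - 1)"
    using ab c lam_eq[of a "Suc b" l r] fo by simp
  moreover have "int (2 * of_bool (lab1 b \<noteq> lab2 r) + lam (Suc (m1 b)) b (Suc (m2 r)) r + lam a (m1 b) l (m2 r))
      = 2 * int (of_bool (lab1 b \<noteq> lab2 r) + dl ?A ?C + dl ?B ?D)
     + (int b - int a - 2 * int (sz ?A) - 2 * int (sz ?B) - 1) + (int r - int l - 2 * int (sz ?C) - 2 * int (sz ?D) - 1)"
    using ab c lam_eq[of "Suc (m1 b)" b "Suc (m2 r)" r] lam_eq[of a "m1 b" l "m2 r"] by simp
  moreover have "int (lam a (Suc b) l (Suc r)) = 2 * int (dl (?B @ [Node (lab1 b) ?A]) (?D @ [Node (lab2 r) ?C]))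
     + (int b - int a - 2 * int (sz ?A) - 2 * int (sz ?B) - 1) + (int r - int l - 2 * int (sz ?C) - 2 * int (sz ?D) - 1)"
    using ab c lam_eq[of a "Suc b" l "Suc r"] fo by simp
  ultimately show ?thesis unfolding dl_snoc by (rule min3_shift)
qed

text \<open>Some branch attains the value. If \<open>a\<close> or \<open>l\<close> is unmatched in
  its interval, skipping it is optimal, so the third branch is left to pairs of complete
  nodes.\<close>

lemma lam_left:
  assumes "a < b" "b \<le> N1" "l < r" "r \<le> N2"
  shows "lam a b l r = Suc (lam (Suc a) b l r) \<or> lam a b l r = Suc (lam a b (Suc l) r) \<or>
    a < m1 a \<and> m1 a < b \<and> l < m2 l \<and> m2 l < r \<and>
    lam a b l r = 2 * of_bool (lab1 a \<noteq> lab2 l) + lam (Suc a) (m1 a) (Suc l) (m2 l)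
        + lam (Suc (m1 a)) b (Suc (m2 l)) r"
proof (cases "a < m1 a \<and> m1 a < b")
  case 1: True
  show ?thesis
  proof (cases "l < m2 l \<and> m2 l < r")
    case True
    then show ?thesis using 1 lam_left_aux[OF assms] unfolding min_def by presburger
  next
    case False
    then show ?thesis using lam_eq[of a b l r] lam_eq[of a b "Suc l" r] assms by (simp add: fo_skip)
  qed
next
  case False
  then show ?thesis using lam_eq[of a b l r] lam_eq[of "Suc a" b l r] assms by (simp add: fo_skip)
qed

lemma lam_right:
  assumes "a \<le> b" "b < N1" "l \<le> r" "r < N2"
  shows "lam a (Suc b) l (Suc r) = Suc (lam a b l (Suc r)) \<or> lam a (Suc b) l (Suc r) = Suc (lam a (Suc b) l r) \<or>
    a \<le> m1 b \<and> m1 b < b \<and> l \<le> m2 r \<and> m2 r < r \<and>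
    lam a (Suc b) l (Suc r) = 2 * of_bool (lab1 b \<noteq> lab2 r) + lam (Suc (m1 b)) b (Suc (m2 r)) r
        + lam a (m1 b) l (m2 r)"
proof (cases "a \<le> m1 b \<and> m1 b < b")
  case 1: True
  show ?thesis
  proof (cases "l \<le> m2 r \<and> m2 r < r")
    case True
    then show ?thesis using 1 lam_right_aux[OF assms] unfolding min_def by presburger
  next
    case False
    then show ?thesis using lam_eq[of a "Suc b" l "Suc r"] lam_eq[of a "Suc b" l r] assms
      Y.fo_skip_right[of l r] by simp
  qed
next
  case False
  then show ?thesis using lam_eq[of a "Suc b" l "Suc r"] lam_eq[of a b l "Suc r"] assms
      X.fo_skip_right[of a b] by simp
qed

end

section \<open>One table entry\<close>

text \<open>Table entries encode \<open>\<infinity>\<close> as \<open>0\<close> and a number \<open>d\<close> as \<open>Suc d\<close>.\<close>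

definition minc :: "nat \<Rightarrow> nat \<Rightarrow> nat" where
  "minc v z = (if z \<noteq> 0 \<and> (v = 0 \<or> z < v) then z else v)"

definition inc :: "nat \<Rightarrow> nat" where
  "inc x = (if x = 0 then 0 else Suc x)"

text \<open>Both arguments carry the successor of the encoding, and one of the two is subtracted. A
  relabelling counts \<open>2 * e\<close> because \<open>lam\<close> doubles the distance.\<close>

definition comb :: "nat \<Rightarrow> nat \<Rightarrow> nat \<Rightarrow> nat" where
  "comb e x y = (if x = 0 \<or> y = 0 then 0 else x + y - 1 + 2 * e)"

definition above :: "nat \<Rightarrow> nat \<Rightarrow> bool" where
  "above d v \<longleftrightarrow> v = 0 \<or> d < v"

lemma above_minc: "above d v \<Longrightarrow> above d z \<Longrightarrow> above d (minc v z)"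
  by (auto simp: above_def minc_def)

lemma minc3_exact:
  assumes "above d v" "above d z" "above d y" "v = Suc d \<or> z = Suc d \<or> y = Suc d"
  shows "minc (minc v z) y = Suc d"
  using assms by (auto simp: above_def minc_def)

lemma above_inc: "above d v \<Longrightarrow> d' \<le> Suc d \<Longrightarrow> above d' (inc v)"
  by (auto simp: above_def inc_def)

lemma above_comb: "above d v \<Longrightarrow> above d' v' \<Longrightarrow> x \<le> 2 * e + d + d' \<Longrightarrow> above x (comb e v v')"
  by (auto simp: above_def comb_def)

lemma above_0 [simp]: "above d 0"
  by (simp add: above_def)

section \<open>Displacement of interval ends, and the cell recurrences within a budget\<close>

definition shift :: "nat \<Rightarrow> nat \<Rightarrow> nat \<Rightarrow> nat \<Rightarrow> nat" where
  "shift a b l r = (a - l) + (l - a) + (b - r) + (r - b)"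

lemma int_shift: "int (shift a b l r) = \<bar>int a - int l\<bar> + \<bar>int b - int r\<bar>"
  unfolding shift_def by (auto simp: abs_if)

text \<open>For a match, \<open>z\<close> is the cost of aligning the parts cut off on the right;
  \<open>lam_len\<close> then supplies the hypotheses on lengths.\<close>

lemma shift_inner:
  assumes "b' \<le> b" "r' \<le> r" "b - b' \<le> r - r' + z" "r - r' \<le> b - b' + z"
  shows "shift a b' l r' \<le> shift a b l r + z"
proof -
  have "\<bar>int b' - int r'\<bar> \<le> \<bar>int b - int r\<bar> + int z" using assms by linarith
  then show ?thesis using int_shift[of a b' l r'] int_shift[of a b l r] by linarith
qed

lemma shift_outer:
  assumes "a \<le> a'" "l \<le> l'" "a' - a \<le> l' - l + z" "l' - l \<le> a' - a + z"
  shows "shift a' b l' r \<le> shift a b l r + z"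
proof -
  have "\<bar>int a' - int l'\<bar> \<le> \<bar>int a - int l\<bar> + int z" using assms by linarith
  then show ?thesis using int_shift[of a' b l' r] int_shift[of a b l r] by linarith
qed

lemma shift_Suc_left: "shift (Suc a) b (Suc l) r = shift a b l r"
  and shift_Suc_right: "shift a (Suc b) l (Suc r) = shift a b l r"
  by (simp_all add: shift_def)

type_synonym table = "nat \<Rightarrow> nat \<Rightarrow> nat \<Rightarrow> nat \<Rightarrow> nat"

context two_bracketings
begin

text \<open>An entry \<open>0\<close> means infinity, so intervals not yet treated satisfy this as
  well.\<close>

definition sound :: "table \<Rightarrow> bool" where
  "sound E \<longleftrightarrow> (\<forall>a b l r. a \<le> b \<and> b \<le> N1 \<and> l \<le> r \<and> r \<le> N2 \<longrightarrow> above (lam a b l r) (E a b l r))"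

definition exact :: "nat \<Rightarrow> table \<Rightarrow> nat \<Rightarrow> nat \<Rightarrow> nat \<Rightarrow> nat \<Rightarrow> bool" where
  "exact K E a b l r \<longleftrightarrow> (shift a b l r + lam a b l r \<le> K \<longrightarrow> E a b l r = Suc (lam a b l r))"

text \<open>Outside the budget \<open>exact\<close> is vacuous, so for a given second interval only
  the first intervals with both ends within \<open>K\<close> of it matter.\<close>

definition good :: "nat \<Rightarrow> table \<Rightarrow> nat \<Rightarrow> nat \<Rightarrow> bool" where
  "good K E l r \<longleftrightarrow> (\<forall>a b. a \<le> b \<and> b \<le> N1 \<longrightarrow> exact K E a b l r)"

definition match_left :: "nat \<Rightarrow> nat \<Rightarrow> nat \<Rightarrow> nat \<Rightarrow> bool" where
  "match_left a b l r \<longleftrightarrow> a < m1 a \<and> m1 a < b \<and> l < m2 l \<and> m2 l < r"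

definition match_right :: "nat \<Rightarrow> nat \<Rightarrow> nat \<Rightarrow> nat \<Rightarrow> bool" where
  "match_right a b l r \<longleftrightarrow> a \<le> m1 b \<and> m1 b < b \<and> l \<le> m2 r \<and> m2 r < r"

definition cell_left :: "table \<Rightarrow> nat \<Rightarrow> nat \<Rightarrow> nat \<Rightarrow> nat \<Rightarrow> nat" where
  "cell_left E a b l r = minc (minc (inc (E (Suc a) b l r)) (inc (E a b (Suc l) r)))
     (if match_left a b l r
      then comb (of_bool (lab1 a \<noteq> lab2 l)) (E (Suc a) (m1 a) (Suc l) (m2 l)) (E (Suc (m1 a)) b (Suc (m2 l)) r)
      else 0)"

definition cell_right :: "table \<Rightarrow> nat \<Rightarrow> nat \<Rightarrow> nat \<Rightarrow> nat \<Rightarrow> nat" where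
  "cell_right E a b l r = minc (minc (inc (E a b l (Suc r))) (inc (E a (Suc b) l r)))
     (if match_right a b l r
      then comb (of_bool (lab1 b \<noteq> lab2 r)) (E (Suc (m1 b)) b (Suc (m2 r)) r) (E a (m1 b) l (m2 r))
      else 0)"

lemma soundD: "sound E \<Longrightarrow> a \<le> b \<Longrightarrow> b \<le> N1 \<Longrightarrow> l \<le> r \<Longrightarrow> r \<le> N2 \<Longrightarrow> above (lam a b l r) (E a b l r)"
  by (simp add: sound_def)

lemma lam_match_left:
  assumes "a < b" "b \<le> N1" "l < r" "r \<le> N2" "match_left a b l r"
  shows "lam a b l r \<le> 2 * of_bool (lab1 a \<noteq> lab2 l) + lam (Suc a) (m1 a) (Suc l) (m2 l)
        + lam (Suc (m1 a)) b (Suc (m2 l)) r"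
  using lam_left_aux[OF assms(1-4)] assms(5) unfolding match_left_def by simp

lemma lam_match_right:
  assumes "a \<le> b" "b < N1" "l \<le> r" "r < N2" "match_right a b l r"
  shows "lam a (Suc b) l (Suc r) \<le> 2 * of_bool (lab1 b \<noteq> lab2 r) + lam (Suc (m1 b)) b (Suc (m2 r)) r
        + lam a (m1 b) l (m2 r)"
  using lam_right_aux[OF assms(1-4)] assms(5) unfolding match_right_def by simp

lemma cell_left_above_aux:
  assumes "sound E" "a < b" "b \<le> N1" "l < r" "r \<le> N2"
  shows "above (lam a b l r) (inc (E (Suc a) b l r))" "above (lam a b l r) (inc (E a b (Suc l) r))"
    and "match_left a b l r \<Longrightarrow> above (lam a b l r) (comb (of_bool (lab1 a \<noteq> lab2 l))
      (E (Suc a) (m1 a) (Suc l) (m2 l)) (E (Suc (m1 a)) b (Suc (m2 l)) r))"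
proof -
  show "above (lam a b l r) (inc (E (Suc a) b l r))"
    using assms by (intro above_inc[OF soundD lam_skip1]) auto
  show "above (lam a b l r) (inc (E a b (Suc l) r))"
    using assms by (intro above_inc[OF soundD lam_skip2]) auto
  assume m: "match_left a b l r"
  show "above (lam a b l r) (comb (of_bool (lab1 a \<noteq> lab2 l))
      (E (Suc a) (m1 a) (Suc l) (m2 l)) (E (Suc (m1 a)) b (Suc (m2 l)) r))"
    using assms m by (intro above_comb[OF soundD soundD lam_match_left]) (auto simp: match_left_def)
qed

lemma cell_left_above:
  assumes "sound E" "a < b" "b \<le> N1" "l < r" "r \<le> N2"
  shows "above (lam a b l r) (cell_left E a b l r)"
  unfolding cell_left_def using cell_left_above_aux[OF assms] by (auto intro!: above_minc)

lemma cell_right_above_aux: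
  assumes "sound E" "a \<le> b" "b < N1" "l \<le> r" "r < N2"
  shows "above (lam a (Suc b) l (Suc r)) (inc (E a b l (Suc r)))"
    "above (lam a (Suc b) l (Suc r)) (inc (E a (Suc b) l r))"
    and "match_right a b l r \<Longrightarrow> above (lam a (Suc b) l (Suc r)) (comb (of_bool (lab1 b \<noteq> lab2 r))
      (E (Suc (m1 b)) b (Suc (m2 r)) r) (E a (m1 b) l (m2 r)))"
proof -
  show "above (lam a (Suc b) l (Suc r)) (inc (E a b l (Suc r)))"
    using assms by (intro above_inc[OF soundD lam_skip1_right]) auto
  show "above (lam a (Suc b) l (Suc r)) (inc (E a (Suc b) l r))"
    using assms by (intro above_inc[OF soundD lam_skip2_right]) auto
  assume m: "match_right a b l r"
  show "above (lam a (Suc b) l (Suc r)) (comb (of_bool (lab1 b \<noteq> lab2 r))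
      (E (Suc (m1 b)) b (Suc (m2 r)) r) (E a (m1 b) l (m2 r)))"
    using assms m by (intro above_comb[OF soundD soundD lam_match_right]) (auto simp: match_right_def)
qed

lemma cell_right_above:
  assumes "sound E" "a \<le> b" "b < N1" "l \<le> r" "r < N2"
  shows "above (lam a (Suc b) l (Suc r)) (cell_right E a b l r)"
  unfolding cell_right_def using cell_right_above_aux[OF assms] by (auto intro!: above_minc)

lemma exactD: "exact K E a b l r \<Longrightarrow> shift a b l r + lam a b l r \<le> K \<Longrightarrow> E a b l r = Suc (lam a b l r)"
  by (simp add: exact_def)

text \<open>
  The two halves of a match pay for each other's shift: by \<open>lam_len\<close> the lengths of the two parts
  skipped over differ by at most the cost of aligning them.
\<close>

lemma cell_left_exact:
  assumes ab: "a < b" "b \<le> N1" "l < r" "r \<le> N2" and snd: "sound E"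
    and 1: "exact K E (Suc a) b l r" and 2: "good K E (Suc l) r"
    and 3: "l < m2 l \<Longrightarrow> m2 l < r \<Longrightarrow> good K E (Suc l) (m2 l) \<and> good K E (Suc (m2 l)) r"
    and le: "shift a b l r + lam a b l r \<le> K"
  shows "cell_left E a b l r = Suc (lam a b l r)"
proof -
  note above = cell_left_above_aux[OF snd ab]
  let ?c = "comb (of_bool (lab1 a \<noteq> lab2 l)) (E (Suc a) (m1 a) (Suc l) (m2 l)) (E (Suc (m1 a)) b (Suc (m2 l)) r)"
  have "inc (E (Suc a) b l r) = Suc (lam a b l r) \<or> inc (E a b (Suc l) r) = Suc (lam a b l r) \<or>
    match_left a b l r \<and> ?c = Suc (lam a b l r)"
  proof -
    consider "lam a b l r = Suc (lam (Suc a) b l r)" | "lam a b l r = Suc (lam a b (Suc l) r)"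
      | "match_left a b l r"
        "lam a b l r = 2 * of_bool (lab1 a \<noteq> lab2 l) + lam (Suc a) (m1 a) (Suc l) (m2 l)
        + lam (Suc (m1 a)) b (Suc (m2 l)) r"
      using lam_left[OF ab] unfolding match_left_def by blast
    then show ?thesis
    proof cases
      case 1: 1
      \<comment> \<open>Dropping one bracket moves one end by one while the cost falls by one, so
        the sum does not grow.\<close>
      then have "shift (Suc a) b l r + lam (Suc a) b l r \<le> K" using le by (auto simp: shift_def)
      then show ?thesis using exactD[OF assms(6)] 1 by (simp add: inc_def)
    next
      case 2: 2
      then have "shift a b (Suc l) r + lam a b (Suc l) r \<le> K" using le by (auto simp: shift_def)
      then show ?thesis using assms(7) ab 2 by (simp add: inc_def good_def exact_def)
    next
      case 3: 3
      have m: "a < m1 a" "m1 a < b" "l < m2 l" "m2 l < r" using 3(1) by (auto simp: match_left_def)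
      have "shift (Suc a) (m1 a) (Suc l) (m2 l) + lam (Suc a) (m1 a) (Suc l) (m2 l) \<le> K"
        using le 3(2) m lam_len[of "Suc (m1 a)" b "Suc (m2 l)" r]
          shift_inner[of "m1 a" b "m2 l" r "lam (Suc (m1 a)) b (Suc (m2 l)) r" a l] shift_Suc_left[of a "m1 a" l "m2 l"] by linarith
      then have "E (Suc a) (m1 a) (Suc l) (m2 l) = Suc (lam (Suc a) (m1 a) (Suc l) (m2 l))"
        using assms(8) m ab by (simp add: good_def exact_def)
      moreover have "shift (Suc (m1 a)) b (Suc (m2 l)) r + lam (Suc (m1 a)) b (Suc (m2 l)) r \<le> K"
        using le 3(2) m lam_len[of "Suc a" "m1 a" "Suc l" "m2 l"]
          shift_outer[of a "Suc (m1 a)" l "Suc (m2 l)" "lam (Suc a) (m1 a) (Suc l) (m2 l)" b r] by linarith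
      then have "E (Suc (m1 a)) b (Suc (m2 l)) r = Suc (lam (Suc (m1 a)) b (Suc (m2 l)) r)"
        using assms(8) m ab by (simp add: good_def exact_def)
      ultimately show ?thesis using 3 by (simp add: comb_def)
    qed
  qed
  then show ?thesis unfolding cell_left_def using above
    by (intro minc3_exact) auto
qed

lemma cell_right_exact:
  assumes ab: "a \<le> b" "b < N1" "l \<le> r" "r < N2" and snd: "sound E"
    and 1: "exact K E a b l (Suc r)" and 2: "good K E l r"
    and 3: "l \<le> m2 r \<Longrightarrow> m2 r < r \<Longrightarrow> good K E (Suc (m2 r)) r \<and> good K E l (m2 r)"
    and le: "shift a (Suc b) l (Suc r) + lam a (Suc b) l (Suc r) \<le> K"
  shows "cell_right E a b l r = Suc (lam a (Suc b) l (Suc r))"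
proof -
  note above = cell_right_above_aux[OF snd ab]
  let ?c = "comb (of_bool (lab1 b \<noteq> lab2 r)) (E (Suc (m1 b)) b (Suc (m2 r)) r) (E a (m1 b) l (m2 r))"
  let ?d = "lam a (Suc b) l (Suc r)"
  have "inc (E a b l (Suc r)) = Suc ?d \<or> inc (E a (Suc b) l r) = Suc ?d \<or> match_right a b l r \<and> ?c = Suc ?d"
  proof -
    consider "?d = Suc (lam a b l (Suc r))" | "?d = Suc (lam a (Suc b) l r)"
      | "match_right a b l r"
        "?d = 2 * of_bool (lab1 b \<noteq> lab2 r) + lam (Suc (m1 b)) b (Suc (m2 r)) r + lam a (m1 b) l (m2 r)"
      using lam_right[OF ab] unfolding match_right_def by blast
    then show ?thesis
    proof cases
      case 1: 1
      then have "shift a b l (Suc r) + lam a b l (Suc r) \<le> K" using le by (auto simp: shift_def)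
      then show ?thesis using exactD[OF assms(6)] 1 by (simp add: inc_def)
    next
      case 2: 2
      then have "shift a (Suc b) l r + lam a (Suc b) l r \<le> K" using le by (auto simp: shift_def)
      then show ?thesis using assms(7) ab 2 by (simp add: inc_def good_def exact_def)
    next
      case 3: 3
      have m: "a \<le> m1 b" "m1 b < b" "l \<le> m2 r" "m2 r < r" using 3(1) by (auto simp: match_right_def)
      have "shift (Suc (m1 b)) b (Suc (m2 r)) r + lam (Suc (m1 b)) b (Suc (m2 r)) r \<le> K"
        using le 3(2) m lam_len[of a "m1 b" l "m2 r"]
          shift_outer[of a "Suc (m1 b)" l "Suc (m2 r)" "lam a (m1 b) l (m2 r)" b r] shift_Suc_right[of a b l r] by linarith
      then have "E (Suc (m1 b)) b (Suc (m2 r)) r = Suc (lam (Suc (m1 b)) b (Suc (m2 r)) r)"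
        using assms(8) m ab by (simp add: good_def exact_def)
      moreover have "shift a (m1 b) l (m2 r) + lam a (m1 b) l (m2 r) \<le> K"
        using le 3(2) m lam_len[of "Suc (m1 b)" b "Suc (m2 r)" r]
          shift_inner[of "m1 b" "Suc b" "m2 r" "Suc r" "lam (Suc (m1 b)) b (Suc (m2 r)) r" a l] by linarith
      then have "E a (m1 b) l (m2 r) = Suc (lam a (m1 b) l (m2 r))"
        using assms(8) m ab by (simp add: good_def exact_def)
      ultimately show ?thesis using 3 by (simp add: comb_def)
    qed
  qed
  then show ?thesis unfolding cell_right_def using above
    by (intro minc3_exact) auto
qed

end

section \<open>The relevant intervals\<close>

text \<open>
  For \<open>p\<close> an odd multiple of a power of two \<open>A\<close>, an interval is grown from \<open>p\<close> to the window
  \<open>{p - A..<p + A}\<close>. It visits the interior of each node whose bracket pair surrounds \<open>p\<close> and fits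
  into the window. Every other node in the window surrounds only numbers
  that are less divisible by two. The windows of all \<open>p\<close> have total length \<open>O(N log N)\<close>; they take
  the place of heavy paths.
\<close>

context bracketing
begin

text \<open>\<open>D\<close> collects the second intervals already treated; these members are what
  \<open>cell_left\<close> reads besides \<open>(l, r)\<close> itself.\<close>

definition deps_left :: "(nat \<times> nat) set \<Rightarrow> nat \<Rightarrow> nat \<Rightarrow> bool" where
  "deps_left D l r \<longleftrightarrow> (Suc l, r) \<in> D \<and>
     (l < m l \<and> m l < r \<longrightarrow> (Suc l, m l) \<in> D \<and> (Suc (m l), r) \<in> D)"

definition deps_right :: "(nat \<times> nat) set \<Rightarrow> nat \<Rightarrow> nat \<Rightarrow> bool" where
  "deps_right D l r \<longleftrightarrow> (l, r) \<in> D \<and>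
     (l \<le> m r \<and> m r < r \<longrightarrow> (Suc (m r), r) \<in> D \<and> (l, m r) \<in> D)"

text \<open>\<open>r\<close> is the next bracket on the right. It is taken if its pair lies right of
  \<open>p\<close>, if it closes the bracket at the left end, or if the left end can move no
  further. Otherwise its partner lies left of \<open>p\<close>, and the left end moves
  first.\<close>

definition grow_right :: "nat \<Rightarrow> nat \<Rightarrow> nat \<Rightarrow> nat \<Rightarrow> nat \<Rightarrow> bool" where
  "grow_right L R p l r \<longleftrightarrow> r < R \<and> (p \<le> m r \<or> m r = l \<or> l = L)"

definition inside :: "nat \<Rightarrow> nat \<Rightarrow> (nat \<times> nat) set \<Rightarrow> bool" where
  "inside L R D \<longleftrightarrow> (\<forall>u. L \<le> u \<and> u < m u \<and> m u < R \<longrightarrow> (Suc u, m u) \<in> D)"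

definition diag :: "(nat \<times> nat) set \<Rightarrow> bool" where
  "diag D \<longleftrightarrow> (\<forall>x \<le> N. (x, x) \<in> D)"

text \<open>After the bounds and \<open>diag\<close>: interiors are known for nodes on one side of
  \<open>p\<close> and for those opened at \<open>l\<close> or later. The next two clauses say that
  pairs around \<open>p\<close> that fit into the window are taken from the inside out. A node open
  at the right end was begun with the same \<open>l\<close>; a node open at the left end was begun
  with the same \<open>r\<close>, and the right end is blocked until it is complete. Finally, if
  \<open>l\<close> opens a pair around \<open>p\<close> that fits and is still unclosed, its partner
  is the next bracket \<open>r\<close>.\<close>

definition grow_inv :: "nat \<Rightarrow> nat \<Rightarrow> nat \<Rightarrow> nat \<Rightarrow> nat \<Rightarrow> (nat \<times> nat) set \<Rightarrow> bool" where
  "grow_inv L R p l r D \<longleftrightarrow>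
     L \<le> l \<and> l \<le> p \<and> p \<le> r \<and> r \<le> R \<and> R \<le> N \<and> (l, r) \<in> D \<and> diag D \<and>
     (\<forall>u. L \<le> u \<and> u < m u \<and> m u < R \<and> (p \<le> u \<or> m u < p \<or> l \<le> u) \<longrightarrow> (Suc u, m u) \<in> D) \<and>
     (\<forall>x. l < x \<and> x < p \<longrightarrow> m x < r \<or> R \<le> m x) \<and>
     (\<forall>x. L \<le> x \<and> x < l \<longrightarrow> m x < p \<or> r \<le> m x) \<and>
     (\<forall>u. p \<le> u \<and> u < r \<and> r \<le> m u \<and> m u < R \<longrightarrow> (l, u) \<in> D) \<and>
     (\<forall>c. l \<le> c \<and> c < p \<and> L \<le> m c \<and> m c < l \<longrightarrow> (Suc c, r) \<in> D \<and> (r = R \<or> m r < p)) \<and>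
     (l < p \<and> r \<le> m l \<and> m l < R \<longrightarrow> m l = r)"

lemma grow_invD:
  assumes "grow_inv L R p l r D"
  shows "L \<le> l" "l \<le> p" "p \<le> r" "r \<le> R" "R \<le> N" "(l, r) \<in> D" "diag D"
    and "\<And>u. L \<le> u \<Longrightarrow> u < m u \<Longrightarrow> m u < R \<Longrightarrow> p \<le> u \<or> m u < p \<or> l \<le> u \<Longrightarrow> (Suc u, m u) \<in> D"
    and "\<And>x. l < x \<Longrightarrow> x < p \<Longrightarrow> m x < r \<or> R \<le> m x"
    and "\<And>x. L \<le> x \<Longrightarrow> x < l \<Longrightarrow> m x < p \<or> r \<le> m x"
    and "\<And>u. p \<le> u \<Longrightarrow> u < r \<Longrightarrow> r \<le> m u \<Longrightarrow> m u < R \<Longrightarrow> (l, u) \<in> D"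
    and "\<And>c. l \<le> c \<Longrightarrow> c < p \<Longrightarrow> L \<le> m c \<Longrightarrow> m c < l \<Longrightarrow> (Suc c, r) \<in> D \<and> (r = R \<or> m r < p)"
    and "l < p \<Longrightarrow> r \<le> m l \<Longrightarrow> m l < R \<Longrightarrow> m l = r"
  using assms unfolding grow_inv_def by auto

lemma diag_insert: "diag D \<Longrightarrow> diag (insert x D)"
  by (auto simp: diag_def)

lemma grow_right_step:
  assumes I: "grow_inv L R p l r D" and g: "grow_right L R p l r"
  shows "deps_right D l r" "grow_inv L R p l (Suc r) (insert (l, Suc r) D)"
proof -
  note I1 = grow_invD(1-7)[OF I] and light = grow_invD(8)[OF I] and i1 = grow_invD(9)[OF I]
    and i2 = grow_invD(10)[OF I] and i3 = grow_invD(11)[OF I] and i4 = grow_invD(12)[OF I]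
    and i5 = grow_invD(13)[OF I]
  have r: "r < R" "r < N" "m (m r) = r" and g: "p \<le> m r \<or> m r = l \<or> l = L"
    using g I1 m_m[of r] by (auto simp: grow_right_def)
  show "deps_right D l r"
    unfolding deps_right_def
  proof (intro conjI impI)
    show "(l, r) \<in> D" using I1 by simp
    assume m: "l \<le> m r \<and> m r < r"
    \<comment> \<open>If \<open>l = L\<close>, a partner strictly between \<open>l\<close> and
      \<open>p\<close> would open a fitting pair around \<open>p\<close> after \<open>l\<close> that
      is not closed before \<open>r\<close>, against \<open>i1\<close>.\<close>
    have "p \<le> m r \<or> m r = l \<and> l < p"
      using g i1[of "m r"] m r by fastforce
    then show "(Suc (m r), r) \<in> D" using light[of "m r"] m r I1 by auto
    show "(l, m r) \<in> D"
    proof (cases "p \<le> m r")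
      case True
      then show ?thesis using i3[of "m r"] m r by simp
    next
      case False
      then have "m r = l" using \<open>p \<le> m r \<or> m r = l \<and> l < p\<close> by simp
      then show ?thesis using I1 by (simp add: diag_def)
    qed
  qed
  have 1: "\<forall>u. L \<le> u \<and> u < m u \<and> m u < R \<and> (p \<le> u \<or> m u < p \<or> l \<le> u) \<longrightarrow>
      (Suc u, m u) \<in> insert (l, Suc r) D"
    using light by blast
  have 2: "\<forall>x. l < x \<and> x < p \<longrightarrow> m x < Suc r \<or> R \<le> m x"
    using i1 less_SucI by blast
  have 3: "\<forall>x. L \<le> x \<and> x < l \<longrightarrow> m x < p \<or> Suc r \<le> m x"
  proof (intro allI impI)
    fix x assume x: "L \<le> x \<and> x < l"
    then have "m x \<noteq> r" using g m_m[of x] I1 by auto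
    then show "m x < p \<or> Suc r \<le> m x" using i2[of x] x by auto
  qed
  have 4: "\<forall>u. p \<le> u \<and> u < Suc r \<and> Suc r \<le> m u \<and> m u < R \<longrightarrow> (l, u) \<in> insert (l, Suc r) D"
  proof (intro allI impI)
    fix u assume "p \<le> u \<and> u < Suc r \<and> Suc r \<le> m u \<and> m u < R"
    then show "(l, u) \<in> insert (l, Suc r) D" using i3[of u] I1(6) by (cases "u = r") auto
  qed
  \<comment> \<open>A node open at the left end blocks the right end unless \<open>m r = l\<close>,
    and then nesting puts the partner of \<open>c\<close> inside the pair of
    \<open>l\<close>.\<close>
  have False if "l \<le> c" "c < p" "L \<le> m c" "m c < l" for c
  proof -
    have "m r = l" using i4[OF that] g r that I1 by auto
    then have "m l = r" using r by simp
    have "c \<noteq> l" using that \<open>m l = r\<close> I1 by auto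
    then have "l < m c" using nest[of l c] that \<open>m l = r\<close> I1 r by auto
    then show False using that by simp
  qed
  then have 5: "\<forall>c. l \<le> c \<and> c < p \<and> L \<le> m c \<and> m c < l \<longrightarrow>
      (Suc c, Suc r) \<in> insert (l, Suc r) D \<and> (Suc r = R \<or> m (Suc r) < p)" by blast
  have 6: "l < p \<and> Suc r \<le> m l \<and> m l < R \<longrightarrow> m l = Suc r" using i5 by linarith
  show "grow_inv L R p l (Suc r) (insert (l, Suc r) D)"
    unfolding grow_inv_def using I1 r(1)
    by (intro conjI 1 2 3 4 5 6 diag_insert) simp_all
qed

lemma grow_left_step:
  assumes I: "grow_inv L R p (Suc x) r D" and g: "\<not> grow_right L R p (Suc x) r" and L: "L \<le> x"
  shows "deps_left D x r" "grow_inv L R p x r (insert (x, r) D)"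
proof -
  note I1 = grow_invD(1-7)[OF I] and light = grow_invD(8)[OF I] and i1 = grow_invD(9)[OF I]
    and i2 = grow_invD(10)[OF I] and i3 = grow_invD(11)[OF I] and i4 = grow_invD(12)[OF I]
    and i5 = grow_invD(13)[OF I]
  have x: "x < N" "m (m x) = x" using I1 m_m[of x] by auto
  have g: "r = R \<or> r < R \<and> r < N \<and> m (m r) = r \<and> m r < p \<and> m r \<noteq> Suc x"
    using g I1 m_m[of r] by (auto simp: grow_right_def)
  \<comment> \<open>Otherwise \<open>r\<close> lies inside the pair of \<open>x\<close>, so
    \<open>m r\<close> lies strictly between \<open>Suc x\<close> and \<open>p\<close> (at
    \<open>Suc x\<close> the right end would have moved), and \<open>i1\<close> demands that this
    inner pair close before \<open>r\<close>.\<close>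
  have key: "m x = r" if "p \<le> m x" "m x < R"
  proof (rule ccontr)
    assume n: "m x \<noteq> r"
    have "r \<le> m x" using i2[of x] that L by auto
    then have "r < R" "m r < p" "m r \<noteq> Suc x" "m (m r) = r" using g that by auto
    moreover have "x < m r" using nest[of x r] n \<open>r \<le> m x\<close> x I1 by auto
    ultimately show False using i1[of "m r"] by auto
  qed
  show "deps_left D x r"
    unfolding deps_left_def
  proof (intro conjI impI)
    show "(Suc x, r) \<in> D" using I1 by simp
    assume m: "x < m x \<and> m x < r"
    then have "m x < p" using i2[of x] L by auto
    then show "(Suc x, m x) \<in> D" using light[of x] L I1 m by auto
    show "(Suc (m x), r) \<in> D" using i4[of "m x"] m \<open>m x < p\<close> x L by auto
  qed
  have 1: "\<forall>u. L \<le> u \<and> u < m u \<and> m u < R \<and> (p \<le> u \<or> m u < p \<or> x \<le> u) \<longrightarrow>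
      (Suc u, m u) \<in> insert (x, r) D"
  proof (intro allI impI)
    fix u assume u: "L \<le> u \<and> u < m u \<and> m u < R \<and> (p \<le> u \<or> m u < p \<or> x \<le> u)"
    show "(Suc u, m u) \<in> insert (x, r) D"
    proof (cases "u = x \<and> p \<le> m u")
      case True
      then show ?thesis using u I1(6) key by auto
    next
      case False
      then have "p \<le> u \<or> m u < p \<or> Suc x \<le> u" using u by linarith
      then show ?thesis using light[of u] u by auto
    qed
  qed
  have 2: "\<forall>y. x < y \<and> y < p \<longrightarrow> m y < r \<or> R \<le> m y"
  proof (intro allI impI)
    fix y assume y: "x < y \<and> y < p"
    show "m y < r \<or> R \<le> m y"
    proof (cases "y = Suc x")
      case True
      have "m (m y) = y" using m_m[of y] y I1 by auto
      then show ?thesis using i5 g y True by fastforce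
    next
      case False
      then show ?thesis using i1[of y] y by auto
    qed
  qed
  have 3: "\<forall>y. L \<le> y \<and> y < x \<longrightarrow> m y < p \<or> r \<le> m y" using i2 by auto
  \<comment> \<open>The left end moves only when no fitting node is open on the right: such a node
    would contain the bracket \<open>r\<close>, whose partner lies left of \<open>p\<close>.\<close>
  have False if "p \<le> u" "u < r" "r \<le> m u" "m u < R" for u
  proof -
    have "r < R" using that by simp
    then have r: "m r < p" "m (m r) = r" using g by auto
    have "m u \<noteq> r" using r that m_m[of u] I1 by auto
    then show False using nest[of u r] that I1 r by auto
  qed
  then have 4: "\<forall>u. p \<le> u \<and> u < r \<and> r \<le> m u \<and> m u < R \<longrightarrow> (x, u) \<in> insert (x, r) D" by blast
  have 5: "\<forall>c. x \<le> c \<and> c < p \<and> L \<le> m c \<and> m c < x \<longrightarrow>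
      (Suc c, r) \<in> insert (x, r) D \<and> (r = R \<or> m r < p)"
  proof (intro allI impI)
    fix c assume "x \<le> c \<and> c < p \<and> L \<le> m c \<and> m c < x"
    then show "(Suc c, r) \<in> insert (x, r) D \<and> (r = R \<or> m r < p)"
      using i4[of c] g I1(6) by (cases "c = x") auto
  qed
  have 6: "x < p \<and> r \<le> m x \<and> m x < R \<longrightarrow> m x = r" using key I1 by auto
  show "grow_inv L R p x r (insert (x, r) D)"
    unfolding grow_inv_def using I1 L
    by (intro conjI 1 2 3 4 5 6 diag_insert) simp_all
qed

lemma grow_inv_start:
  assumes "L \<le> p" "p \<le> R" "R \<le> N" "diag D"
    "\<And>u. L \<le> u \<Longrightarrow> u < m u \<Longrightarrow> m u < R \<Longrightarrow> p \<le> u \<or> m u < p \<Longrightarrow> (Suc u, m u) \<in> D"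
  shows "grow_inv L R p p p D"
  unfolding grow_inv_def using assms by (auto simp: diag_def)

lemma grow_inv_end:
  assumes "grow_inv L R p L R D"
  shows "(L, R) \<in> D" "diag D" "inside L R D"
  using grow_invD(6-8)[OF assms] by (auto simp: inside_def)

section \<open>Dyadic phases and windows\<close>

definition nomult :: "nat \<Rightarrow> nat \<Rightarrow> nat \<Rightarrow> bool" where
  "nomult A u v \<longleftrightarrow> (\<forall>x. u < x \<and> x \<le> v \<longrightarrow> \<not> A dvd x)"

text \<open>Invariant between phases, where \<open>A\<close> runs through the powers of two. A
  number \<open>x\<close> with \<open>u < x \<le> m u\<close> is a cut between the two brackets of
  \<open>u\<close>; nodes without a multiple of \<open>A\<close> among their cuts have been treated.
  When \<open>A\<close> reaches \<open>N\<close>, the first window of the phase before has covered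
  the whole string.\<close>

definition phase_inv :: "nat \<Rightarrow> (nat \<times> nat) set \<Rightarrow> bool" where
  "phase_inv A D \<longleftrightarrow> diag D \<and> (N \<le> A \<longrightarrow> (0, N) \<in> D) \<and>
     (\<forall>u. u < m u \<and> m u < N \<and> nomult A u (m u) \<longrightarrow> (Suc u, m u) \<in> D)"

text \<open>Left of the current window, nodes are already treated by the standard
  \<open>2 * A\<close> of the next phase. The interval \<open>(0, min N (2 * A))\<close> is the
  outcome of the first window, the one centred at \<open>A\<close>.\<close>

definition window_inv :: "nat \<Rightarrow> nat \<Rightarrow> (nat \<times> nat) set \<Rightarrow> bool" where
  "window_inv A p D \<longleftrightarrow> diag D \<and> A > 0 \<and> (\<exists>t. p = A * (2 * t + 1)) \<and> A < N \<and>
     (A < p \<longrightarrow> (0, min N (2 * A)) \<in> D) \<and>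
     (\<forall>u. u < m u \<and> m u < N \<and> (nomult A u (m u) \<or> nomult (2 * A) u (m u) \<and> u < p - A)
       \<longrightarrow> (Suc u, m u) \<in> D)"

text \<open>Every node has a multiple of 1 among its cuts, so only the diagonal is demanded.\<close>

lemma phase_inv_start:
  assumes "diag D" "N > 1" shows "phase_inv 1 D"
  using assms by (auto simp: phase_inv_def nomult_def)

lemma window_inv_start:
  assumes "phase_inv A D" "A > 0" "A < N" shows "window_inv A A D"
  using assms by (auto simp: phase_inv_def window_inv_def intro: exI[of _ 0])

lemma not_dvd_between: "A * k < x \<Longrightarrow> x < A * Suc k \<Longrightarrow> \<not> A dvd (x::nat)"
  by (metis dvd_def mult_less_cancel1 not_less_eq)

lemma window_inv_grow:
  assumes W: "window_inv A p D" and p: "p < N"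
  shows "grow_inv (p - A) (min N (p + A)) p p p D"
proof -
  from W obtain t where t: "p = A * (2 * t + 1)" and A: "A > 0" by (auto simp: window_inv_def)
  have L: "p - A = A * (2 * t)" and R: "p + A = A * Suc (2 * t + 1)" using t by (simp_all add: algebra_simps)
  show ?thesis
  proof (rule grow_inv_start)
    fix u assume u: "p - A \<le> u" "u < m u" "m u < min N (p + A)" "p \<le> u \<or> m u < p"
    \<comment> \<open>A pair on one side of \<open>p\<close> has all its cuts strictly between two
      consecutive multiples of \<open>A\<close>.\<close>
    have "nomult A u (m u)"
      unfolding nomult_def
    proof (intro allI impI)
      fix x assume x: "u < x \<and> x \<le> m u"
      consider "A * (2 * t) < x" "x < A * Suc (2 * t)"
        | "A * (2 * t + 1) < x" "x < A * Suc (2 * t + 1)"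
        using u x L R t by fastforce
      then show "\<not> A dvd x" by cases (rule not_dvd_between; assumption)+
    qed
    then show "(Suc u, m u) \<in> D" using W u by (auto simp: window_inv_def)
  qed (use W p in \<open>auto simp: window_inv_def\<close>)
qed

lemma window_inv_step:
  assumes W: "window_inv A p D" and p: "p < N" and D: "D \<subseteq> D'"
    and G: "grow_inv (p - A) (min N (p + A)) p (p - A) (min N (p + A)) D'"
  shows "window_inv A (p + 2 * A) D'"
proof -
  note e = grow_inv_end[OF G]
  from W obtain t where t: "p = A * (2 * t + 1)" and A: "A > 0" by (auto simp: window_inv_def)
  have R: "p + A = (2 * A) * (t + 1)" using t by (simp add: algebra_simps)
  have "(Suc u, m u) \<in> D'" if u: "u < m u" "m u < N" "nomult (2 * A) u (m u)" "u < p + A" for u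
  proof (cases "u < p - A")
    case True
    then show ?thesis using W D that by (auto simp: window_inv_def)
  next
    case False
    \<comment> \<open>The right border \<open>p + A\<close> is a multiple of \<open>2 * A\<close>,
      so a node that surrounds no such multiple and opens in the window also closes in it.\<close>
    have "\<not> p + A \<le> m u" using u(3,4) R unfolding nomult_def by (metis dvd_triv_left)
    then show ?thesis using e(3) u False by (auto simp: inside_def)
  qed
  moreover have "(0, min N (2 * A)) \<in> D'"
  proof (cases "A < p")
    case True
    then show ?thesis using W D by (auto simp: window_inv_def)
  next
    case False
    then have "p = A" using t A by simp
    then show ?thesis using e(1) by (simp add: mult_2)
  qed
  moreover have "\<exists>t. p + 2 * A = A * (2 * t + 1)" using t by (intro exI[of _ "Suc t"]) simp
  ultimately show ?thesis using W D e(2) by (auto simp: window_inv_def)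
qed

lemma window_inv_end:
  assumes W: "window_inv A p D" and p: "N \<le> p"
  shows "phase_inv (2 * A) D"
proof -
  from W obtain t where t: "p = A * (2 * t + 1)" and A: "A > 0" "A < N" by (auto simp: window_inv_def)
  have "(Suc u, m u) \<in> D" if u: "u < m u" "m u < N" "nomult (2 * A) u (m u)" for u
  proof (cases "u < p - A")
    case True
    then show ?thesis using W that by (auto simp: window_inv_def)
  next
    case False
    have "nomult A u (m u)" unfolding nomult_def
    proof (intro allI impI)
      fix x assume "u < x \<and> x \<le> m u"
      then have "A * (2 * t) < x" "x < A * Suc (2 * t)" using False u p t by auto
      then show "\<not> A dvd x" by (rule not_dvd_between)
    qed
    then show ?thesis using W that by (auto simp: window_inv_def)
  qed
  moreover have "(0, min N (2 * A)) \<in> D" using W A p by (auto simp: window_inv_def)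
  ultimately show ?thesis using W by (auto simp: phase_inv_def window_inv_def min_def split: if_splits)
qed

end

section \<open>Weakest preconditions with a clock\<close>

text \<open>The clock is an argument of the postcondition, which can thus bound the total time; the
  existential includes termination.\<close>

definition wp :: "nat \<Rightarrow> com \<Rightarrow> (nat \<Rightarrow> state \<Rightarrow> bool) \<Rightarrow> nat \<Rightarrow> state \<Rightarrow> bool" where
  "wp w c Q t s \<longleftrightarrow> (\<exists>u s'. exec w c s u s' \<and> Q (t + u) s')"

lemma wp_Skip: "Q (t + 1) s \<Longrightarrow> wp w Skip Q t s"
  unfolding wp_def by (meson exec.Skip)

lemma wp_Assign:
  "Q (t + (1 + exp_time e)) (R(x := exp_val w e (R, m)), m) \<Longrightarrow> wp w (Assign x e) Q t (R, m)"
  unfolding wp_def by (metis exec.Assign fst_conv snd_conv)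

lemma wp_Store:
  "Q (t + (1 + exp_time e1 + exp_time e2)) (R, m(exp_val w e1 (R, m) := exp_val w e2 (R, m)))
   \<Longrightarrow> wp w (Store e1 e2) Q t (R, m)"
  unfolding wp_def by (metis exec.Store fst_conv snd_conv)

lemma wp_Seq: "wp w c1 (wp w c2 Q) t s \<Longrightarrow> wp w (Seq c1 c2) Q t s"
  unfolding wp_def using exec.Seq by (fastforce simp: add.assoc)

lemma wp_If:
  assumes "exp_val w e s \<noteq> 0 \<Longrightarrow> wp w c1 Q (t + (1 + exp_time e)) s"
    and "exp_val w e s = 0 \<Longrightarrow> wp w c2 Q (t + (1 + exp_time e)) s"
  shows "wp w (If e c1 c2) Q t s"
proof (cases "exp_val w e s = 0")
  case True
  then obtain u s' where "exec w c2 s u s'" "Q (t + (1 + exp_time e) + u) s'"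
    using assms(2) unfolding wp_def by blast
  then show ?thesis unfolding wp_def using exec.IfFalse[OF True] by (metis add.assoc)
next
  case False
  then obtain u s' where "exec w c1 s u s'" "Q (t + (1 + exp_time e) + u) s'"
    using assms(1) unfolding wp_def by blast
  then show ?thesis unfolding wp_def using exec.IfTrue[OF False] by (metis add.assoc)
qed

lemma wp_While_step:
  assumes "exp_val w e s \<noteq> 0" "wp w c (wp w (While e c) Q) (t + (1 + exp_time e)) s"
  shows "wp w (While e c) Q t s"
proof -
  obtain u s' u' s'' where "exec w c s u s'" "exec w (While e c) s' u' s''"
    "Q (t + (1 + exp_time e) + u + u') s''"
    using assms(2) unfolding wp_def by blast
  then show ?thesis unfolding wp_def using exec.WhileTrue[OF assms(1)] by (metis add.assoc)
qed

lemma wp_While_exit: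
  "exp_val w e s = 0 \<Longrightarrow> Q (t + (1 + exp_time e)) s \<Longrightarrow> wp w (While e c) Q t s"
  unfolding wp_def using exec.WhileFalse by blast

lemma wp_mono:
  "wp w c Q t s \<Longrightarrow> (\<And>t' s'. t \<le> t' \<Longrightarrow> Q t' s' \<Longrightarrow> Q' t' s') \<Longrightarrow> wp w c Q' t s"
  unfolding wp_def by (meson le_add1)

text \<open>The potential \<open>\<phi>\<close> pays for every iteration, so it also shows termination.\<close>

lemma wp_While:
  assumes step: "\<And>t s. I s \<Longrightarrow> exp_val w e s \<noteq> 0 \<Longrightarrow>
      wp w c (\<lambda>t' s'. I s' \<and> t' + \<phi> s' \<le> t + \<phi> s) (t + (1 + exp_time e)) s"
    and exit: "\<And>t' s'. I s' \<Longrightarrow> exp_val w e s' = 0 \<Longrightarrow> t' \<le> t + \<phi> s + (1 + exp_time e) \<Longrightarrow> Q t' s'"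
    and "I s"
  shows "wp w (While e c) Q t s"
proof -
  have "wp w (While e c) Q t' s'" if "I s'" "t' + \<phi> s' \<le> t + \<phi> s" for t' s'
    using that
  proof (induction "\<phi> s'" arbitrary: s' t' rule: less_induct)
    case less
    show ?case
    proof (cases "exp_val w e s' = 0")
      case True
      show ?thesis by (rule wp_While_exit[OF True], rule exit) (use less True in auto)
    next
      case False
      show ?thesis
      proof (rule wp_While_step[OF False], rule wp_mono[OF step[OF less(2) False]])
        fix t'' s''
        assume "t' + (1 + exp_time e) \<le> t''" "I s'' \<and> t'' + \<phi> s'' \<le> t' + \<phi> s'"
        then show "wp w (While e c) Q t'' s''" using less by auto
      qed
    qed
  qed
  then show ?thesis using \<open>I s\<close> by simp
qed

section \<open>Word arithmetic without overflow\<close>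

lemma val_Const: "v < 2 ^ w \<Longrightarrow> exp_val w (Const v) s = v"
  by (simp only: exp_val.simps mod_less)

lemma val_Add: "a + b < 2 ^ w \<Longrightarrow> binop_val w Add a b = a + b"
  by (simp only: binop_val.simps mod_less)

lemma val_Sub: assumes "b \<le> a" "a < 2 ^ w" shows "binop_val w Sub a b = a - b"
proof -
  have "a + 2 ^ w - b = (a - b) + 2 ^ w" using assms(1) by simp
  moreover have "a - b < 2 ^ w" using assms(2) by simp
  ultimately show ?thesis by (simp only: binop_val.simps mod_add_self2 mod_less)
qed

lemma val_Mul: "a * b < 2 ^ w \<Longrightarrow> binop_val w Mul a b = a * b"
  by (simp only: binop_val.simps mod_less)

lemma val_Div: assumes "a < 2 ^ w" shows "binop_val w Div a b = a div b"
  using le_less_trans[OF div_le_dividend assms] by (simp only: binop_val.simps mod_less)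

lemma val_Less: assumes "0 < w" shows "binop_val w Less a b = of_bool (a < b)"
proof -
  have "(1::nat) < 2 ^ w" by (rule one_less_power) (simp_all add: assms)
  then show ?thesis by (cases "a < b") (simp_all only: binop_val.simps of_bool_eq mod_less mod_0 simp_thms)
qed

lemma val_Eq: assumes "0 < w" shows "binop_val w Eq a b = of_bool (a = b)"
proof -
  have "(1::nat) < 2 ^ w" by (rule one_less_power) (simp_all add: assms)
  then show ?thesis by (cases "a = b") (simp_all only: binop_val.simps of_bool_eq mod_less mod_0 simp_thms)
qed

lemmas vals = val_Add val_Sub val_Mul val_Div val_Less val_Eq val_Const
declare binop_val.simps [simp del]

section \<open>The program\<close>

abbreviation add (infixl "[+]" 65) where "add \<equiv> Bin Add"
abbreviation sub (infixl "[-]" 65) where "sub \<equiv> Bin Sub"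
abbreviation mul (infixl "[*]" 70) where "mul \<equiv> Bin Mul"
abbreviation less (infix "[<]" 50) where "less \<equiv> Bin Less"
abbreviation equal (infix "[=]" 50) where "equal \<equiv> Bin Eq"
abbreviation assign (infix ":==" 45) where "assign \<equiv> Assign"
abbreviation seq (infixr ";;" 40) where "seq \<equiv> Seq"
abbreviation "when e c \<equiv> If e c Skip"

text \<open>
  With the stride \<open>M\<close> larger than the input, the partners and labels of the two bracket strings are
  stored at multiples of \<open>M\<close>, the parser's stack at \<open>5 M\<close> and \<open>6 M\<close>, and the four-dimensional
  table from \<open>M ^ 4\<close> on.
\<close>

definition adr :: "nat \<Rightarrow> nat \<Rightarrow> nat \<Rightarrow> nat \<Rightarrow> nat \<Rightarrow> nat" where
  "adr M a b l r = (((M + a) * M + b) * M + l) * M + r"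

definition adrx :: "exp \<Rightarrow> exp \<Rightarrow> exp \<Rightarrow> exp \<Rightarrow> exp" where
  "adrx a b l r =
     (((Reg ''M'' [+] a) [*] Reg ''M'' [+] b) [*] Reg ''M'' [+] l) [*] Reg ''M'' [+] r"

text \<open>Truth values are words: conjunction is a product, disjunction a sum.\<close>

definition upd :: "exp \<Rightarrow> com" where
  "upd e = (''z'' :== e ;;
     when ((Const 0 [<] Reg ''z'') [*] ((Reg ''v'' [=] Const 0) [+] (Reg ''z'' [<] Reg ''v'')))
       (''v'' :== Reg ''z''))"

definition upd_inc :: "exp \<Rightarrow> com" where
  "upd_inc e = (''x'' :== Load e ;; upd (Reg ''x'' [+] (Const 0 [<] Reg ''x'')))"

definition upd_comb :: "exp \<Rightarrow> exp \<Rightarrow> exp \<Rightarrow> exp \<Rightarrow> com" where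
  "upd_comb i j e1 e2 = (''x'' :== Load e1 ;; ''y'' :== Load e2 ;;
     when ((Const 0 [<] Reg ''x'') [*] (Const 0 [<] Reg ''y''))
       (upd (Reg ''x'' [+] Reg ''y'' [-] Const 1 [+]
         Const 2 [*] ((Load (Reg ''B2'' [+] i) [=] Load (Reg ''B4'' [+] j)) [=] Const 0))))"

definition cellL :: com where
  "cellL = (
     upd_inc (adrx (Reg ''a'' [+] Const 1) (Reg ''b'') (Reg ''l'') (Reg ''r'')) ;;
     upd_inc (adrx (Reg ''a'') (Reg ''b'') (Reg ''l'' [+] Const 1) (Reg ''r'')) ;;
     ''c'' :== Load (Reg ''M'' [+] Reg ''a'') ;;
     ''e'' :== Load (Reg ''B3'' [+] Reg ''l'') ;;
     when ((Reg ''a'' [<] Reg ''c'') [*] (Reg ''c'' [<] Reg ''b'') [*]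
           (Reg ''l'' [<] Reg ''e'') [*] (Reg ''e'' [<] Reg ''r''))
       (upd_comb (Reg ''a'') (Reg ''l'')
         (adrx (Reg ''a'' [+] Const 1) (Reg ''c'') (Reg ''l'' [+] Const 1) (Reg ''e''))
         (adrx (Reg ''c'' [+] Const 1) (Reg ''b'') (Reg ''e'' [+] Const 1) (Reg ''r''))))"

definition cellR :: com where
  "cellR = (
     ''f'' :== Reg ''b'' [-] Const 1 ;;
     ''g'' :== Reg ''r'' [-] Const 1 ;;
     upd_inc (adrx (Reg ''a'') (Reg ''f'') (Reg ''l'') (Reg ''r'')) ;;
     upd_inc (adrx (Reg ''a'') (Reg ''b'') (Reg ''l'') (Reg ''g'')) ;;
     ''c'' :== Load (Reg ''M'' [+] Reg ''f'') ;;
     ''e'' :== Load (Reg ''B3'' [+] Reg ''g'') ;;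
     when ((Reg ''a'' [<] Reg ''c'' [+] Const 1) [*] (Reg ''c'' [<] Reg ''f'') [*]
           (Reg ''l'' [<] Reg ''e'' [+] Const 1) [*] (Reg ''e'' [<] Reg ''g''))
       (upd_comb (Reg ''f'') (Reg ''g'')
         (adrx (Reg ''c'' [+] Const 1) (Reg ''f'') (Reg ''e'' [+] Const 1) (Reg ''g''))
         (adrx (Reg ''a'') (Reg ''c'') (Reg ''l'') (Reg ''e''))))"

text \<open>If one interval is empty, \<open>lam\<close> is the length of the other; the final
  \<open>1\<close> is the successor of the encoding. The flag \<open>d\<close> tells at which end
  the second interval was last extended, hence which recurrence applies.\<close>

definition cell :: com where
  "cell = (
     If ((Reg ''a'' [=] Reg ''b'') [+] (Reg ''l'' [=] Reg ''r''))
       (''v'' :== (Reg ''b'' [-] Reg ''a'') [+] (Reg ''r'' [-] Reg ''l'') [+] Const 1)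
       (''v'' :== Const 0 ;; If (Reg ''d'') cellR cellL) ;;
     Store (adrx (Reg ''a'') (Reg ''b'') (Reg ''l'') (Reg ''r'')) (Reg ''v''))"

text \<open>Descending \<open>a\<close> and ascending \<open>b\<close> suit both recurrences: within
  the same second interval the left one reads \<open>(a + 1, b)\<close>, the right one
  \<open>(a, b - 1)\<close>. The row counter \<open>s\<close> is \<open>a + 1\<close>, so that the
  descent can include \<open>a = 0\<close>; \<open>hb\<close> is an exclusive bound too.\<close>

definition block :: com where
  "block = (
     ''s'' :== Reg ''l'' [+] Reg ''K'' [+] Const 1 ;;
     when (Reg ''N1'' [<] Reg ''s'') (''s'' :== Reg ''N1'' [+] Const 1) ;;
     ''lo'' :== Const 0 ;;
     when (Reg ''K'' [<] Reg ''l'') (''lo'' :== Reg ''l'' [-] Reg ''K'') ;;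
     ''hb'' :== Reg ''r'' [+] Reg ''K'' [+] Const 1 ;;
     when (Reg ''N1'' [<] Reg ''hb'') (''hb'' :== Reg ''N1'' [+] Const 1) ;;
     ''lb'' :== Const 0 ;;
     when (Reg ''K'' [<] Reg ''r'') (''lb'' :== Reg ''r'' [-] Reg ''K'') ;;
     While (Reg ''lo'' [<] Reg ''s'') (
       ''a'' :== Reg ''s'' [-] Const 1 ;;
       ''b'' :== Reg ''a'' ;;
       when (Reg ''a'' [<] Reg ''lb'') (''b'' :== Reg ''lb'') ;;
       While (Reg ''b'' [<] Reg ''hb'') (
         cell ;;
         ''b'' :== Reg ''b'' [+] Const 1) ;;
       ''s'' :== Reg ''a''))"

section \<open>Correctness of one block\<close>

lemma exp_time_adrx [simp]:
  "exp_time (adrx a b l r) = 11 + exp_time a + exp_time b + exp_time l + exp_time r"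
  by (simp add: adrx_def)

text \<open>Addresses are numerals to base \<open>M\<close> with leading digit \<open>M + a\<close>,
  which lies between \<open>M\<close> and \<open>2 * M\<close>; hence the factor 2.\<close>

lemma adr_bounds:
  assumes "a < M" "b < M" "l < M" "r < M"
  shows "(M + a) * M + b < 2 * M ^ 2" "((M + a) * M + b) * M + l < 2 * M ^ 3" "adr M a b l r < 2 * M ^ 4"
    "M ^ 4 \<le> adr M a b l r"
proof -
  have step: "x * M + y < 2 * M ^ Suc n" if "x < 2 * M ^ n" "y < M" for x y n
  proof -
    have "x * M + y < Suc x * M" using that by simp
    also have "\<dots> \<le> (2 * M ^ n) * M" using that by (intro mult_right_mono) auto
    finally show ?thesis by (simp add: mult_ac)
  qed
  have "M + a < 2 * M ^ 1" using assms by simp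
  from step[OF this assms(2)] show 1: "(M + a) * M + b < 2 * M ^ 2" by (simp only: Suc_1)
  from step[OF this assms(3)] show 2: "((M + a) * M + b) * M + l < 2 * M ^ 3" by (simp add: numeral_3_eq_3 numeral_2_eq_2)
  from step[OF this assms(4)] show "adr M a b l r < 2 * M ^ 4" by (simp add: adr_def eval_nat_numeral)
  have "M ^ 4 = ((M * M) * M) * M" by (simp add: eval_nat_numeral)
  also have "\<dots> \<le> adr M a b l r" unfolding adr_def
    by (intro trans_le_add1 mult_right_mono) auto
  finally show "M ^ 4 \<le> adr M a b l r" .
qed

lemma adr_inject:
  assumes "b < M" "l < M" "r < M" "b' < M" "l' < M" "r' < M"
  shows "adr M a b l r = adr M a' b' l' r' \<longleftrightarrow> a = a' \<and> b = b' \<and> l = l' \<and> r = r'"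
proof -
  have *: "x * M + y = x' * M + y' \<longleftrightarrow> x = x' \<and> y = y'" if "y < M" "y' < M" for x y x' y'
  proof -
    have "x = (x * M + y) div M" "x' = (x' * M + y') div M"
      "y = (x * M + y) mod M" "y' = (x' * M + y') mod M" using that by simp_all
    then show ?thesis by metis
  qed
  show ?thesis unfolding adr_def using assms by (auto simp: *)
qed

lemma exp_val_adrx:
  assumes "fst s ''M'' = M" "exp_val w a s < M" "exp_val w b s < M" "exp_val w l s < M" "exp_val w r s < M"
    and W: "2 * M ^ 4 \<le> 2 ^ w"
  shows "exp_val w (adrx a b l r) s = adr M (exp_val w a s) (exp_val w b s) (exp_val w l s) (exp_val w r s)"
proof -
  note b = adr_bounds[OF assms(2-5)]
  have M: "0 < M" using assms by auto
  have le: "2 * M ^ n \<le> 2 ^ w" if "n \<le> 4" for n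
    using power_increasing[OF that, of M] M W by linarith
  have "M + exp_val w a s < 2 ^ w" using le[of 1] assms(2) by simp
  moreover have "(M + exp_val w a s) * M + exp_val w b s < 2 ^ w" using b(1) le[of 2] by linarith
  moreover have "((M + exp_val w a s) * M + exp_val w b s) * M + exp_val w l s < 2 ^ w" using b(2) le[of 3] by linarith
  moreover have "adr M (exp_val w a s) (exp_val w b s) (exp_val w l s) (exp_val w r s) < 2 ^ w"
    using b(3) W by linarith
  ultimately show ?thesis unfolding adrx_def adr_def
    by (simp add: assms(1) val_Add val_Mul)
qed

lemma wp_upd:
  assumes "1 < w" "\<And>t'. t' \<le> t + exp_time e + 20 \<Longrightarrow>
    Q t' (R(''z'' := exp_val w e (R, m), ''v'' := minc (R ''v'') (exp_val w e (R, m))), m)"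
  shows "wp w (upd e) Q t (R, m)"
proof -
  have w: "(2::nat) < 2 ^ w" using assms(1) power_strict_increasing[of 1 w "2::nat"] by simp
  have w0: "0 < w" using assms(1) by simp
  let ?z = "exp_val w e (R, m)"
  have c: "exp_val w ((Const 0 [<] Reg ''z'') [*] ((Reg ''v'' [=] Const 0) [+] (Reg ''z'' [<] Reg ''v''))) (R(''z'' := ?z), m) \<noteq> 0
      \<longleftrightarrow> ?z \<noteq> 0 \<and> (R ''v'' = 0 \<or> ?z < R ''v'')"
    using w w0 by (auto simp: vals)
  have Q: "Q t' s'" if "t' \<le> t + exp_time e + 20" "s' = (R(''z'' := ?z, ''v'' := minc (R ''v'') ?z), m)" for t' s'
    using assms(2)[OF that(1)] that(2) by simp
  show ?thesis
    unfolding upd_def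
  proof (rule wp_Seq, rule wp_Assign, rule wp_If)
    assume "exp_val w ((Const 0 [<] Reg ''z'') [*] ((Reg ''v'' [=] Const 0) [+] (Reg ''z'' [<] Reg ''v''))) (R(''z'' := ?z), m) \<noteq> 0"
    then have "?z \<noteq> 0 \<and> (R ''v'' = 0 \<or> ?z < R ''v'')" using c by simp
    then show "wp w (''v'' :== Reg ''z'') Q (t + (1 + exp_time e) + (1 + exp_time ((Const 0 [<] Reg ''z'') [*] ((Reg ''v'' [=] Const 0) [+] (Reg ''z'' [<] Reg ''v''))))) (R(''z'' := ?z), m)"
      by (intro wp_Assign Q) (auto simp: minc_def)
  next
    assume "exp_val w ((Const 0 [<] Reg ''z'') [*] ((Reg ''v'' [=] Const 0) [+] (Reg ''z'' [<] Reg ''v''))) (R(''z'' := ?z), m) = 0"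
    then have "\<not> (?z \<noteq> 0 \<and> (R ''v'' = 0 \<or> ?z < R ''v''))" using c by simp
    then show "wp w Skip Q (t + (1 + exp_time e) + (1 + exp_time ((Const 0 [<] Reg ''z'') [*] ((Reg ''v'' [=] Const 0) [+] (Reg ''z'' [<] Reg ''v''))))) (R(''z'' := ?z), m)"
      by (intro wp_Skip Q) (auto simp: minc_def fun_upd_idem)
  qed
qed

lemma val_conj: assumes "0 < w" shows "binop_val w Mul (of_bool P) (of_bool Q) = of_bool (P \<and> Q)"
proof -
  have "(1::nat) < 2 ^ w" by (rule one_less_power) (simp_all add: assms)
  then have "of_bool P * of_bool Q < (2::nat) ^ w" by (auto simp: of_bool_def)
  then show ?thesis by (simp add: val_Mul of_bool_conj)
qed

lemma minc_0 [simp]: "minc 0 z = z" "minc v 0 = v"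
  by (simp_all add: minc_def)

lemma wp_upd_inc:
  assumes "1 < w" "m (exp_val w e (R, m)) + 1 < 2 ^ w"
    and Q: "\<And>t' R'. t' \<le> t + exp_time e + 40 \<Longrightarrow> \<forall>x. x \<notin> {''x'', ''v'', ''z''} \<longrightarrow> R' x = R x \<Longrightarrow>
      R' ''v'' = minc (R ''v'') (inc (m (exp_val w e (R, m)))) \<Longrightarrow> Q t' (R', m)"
  shows "wp w (upd_inc e) Q t (R, m)"
proof -
  have "0 < w" using assms(1) by simp
  then have v: "exp_val w (Reg ''x'' [+] (Const 0 [<] Reg ''x'')) (R(''x'' := m (exp_val w e (R, m))), m)
      = inc (m (exp_val w e (R, m)))"
    using assms(2) by (cases "m (exp_val w e (R, m)) = 0") (auto simp: vals inc_def)
  show ?thesis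
    unfolding upd_inc_def
    by (rule wp_Seq, rule wp_Assign, rule wp_upd[OF assms(1)], rule Q) (use v in auto)
qed

text \<open>The address \<open>e2\<close> is evaluated after ''x'' has been overwritten, hence the
  hypothesis for all \<open>q\<close>.\<close>

lemma wp_upd_comb:
  assumes w: "1 < w" and e2: "\<And>q. exp_val w e2 (R(''x'' := q), m) = ad2"
    and b: "m (exp_val w e1 (R, m)) + m ad2 + 2 < 2 ^ w"
    and ij: "i \<notin> {''x'', ''y'', ''z'', ''v''}" "j \<notin> {''x'', ''y'', ''z'', ''v''}"
    and ijb: "R ''B2'' + R i < 2 ^ w" "R ''B4'' + R j < 2 ^ w"
    and Q: "\<And>t' R'. t' \<le> t + exp_time e1 + exp_time e2 + 100 \<Longrightarrow>
      \<forall>x. x \<notin> {''x'', ''y'', ''v'', ''z''} \<longrightarrow> R' x = R x \<Longrightarrow>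
      R' ''v'' = minc (R ''v'') (comb (of_bool (m (R ''B2'' + R i) \<noteq> m (R ''B4'' + R j)))
        (m (exp_val w e1 (R, m))) (m ad2)) \<Longrightarrow> Q t' (R', m)"
  shows "wp w (upd_comb (Reg i) (Reg j) e1 e2) Q t (R, m)"
proof -
  have w0: "0 < w" using w by simp
  let ?x = "m (exp_val w e1 (R, m))" and ?y = "m ad2"
  let ?R = "R(''x'' := ?x, ''y'' := ?y)"
  let ?c = "(Const 0 [<] Reg ''x'') [*] (Const 0 [<] Reg ''y'')"
  have c: "exp_val w ?c (?R, m) = of_bool (0 < ?x \<and> 0 < ?y)"
    using w0 by (simp add: val_Less val_conj)
  have "(2::nat) < 2 ^ w" using w power_strict_increasing[of 1 w "2::nat"] by simp
  then have v: "exp_val w (Reg ''x'' [+] Reg ''y'' [-] Const 1 [+]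
         Const 2 [*] ((Load (Reg ''B2'' [+] Reg i) [=] Load (Reg ''B4'' [+] Reg j)) [=] Const 0)) (?R, m)
      = comb (of_bool (m (R ''B2'' + R i) \<noteq> m (R ''B4'' + R j))) ?x ?y" if "0 < ?x" "0 < ?y"
    using that w0 b ij ijb by (auto simp: vals comb_def)
  show ?thesis
    unfolding upd_comb_def
    apply (rule wp_Seq, rule wp_Assign, rule wp_Seq, rule wp_Assign, rule wp_If)
    subgoal
      apply (rule wp_upd[OF w], rule Q)
      using v c e2 by (auto split: if_splits)
    subgoal
      apply (rule wp_Skip, rule Q)
      using c e2 by (auto simp: comb_def)
    done
qed

locale machine = two_bracketings m1 lab1 N1 m2 lab2 N2
  for m1 :: "nat \<Rightarrow> nat" and lab1 :: "nat \<Rightarrow> nat" and N1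
  and m2 :: "nat \<Rightarrow> nat" and lab2 :: "nat \<Rightarrow> nat" and N2 +
  fixes w M K :: nat
  assumes M: "N1 + N2 + 4 \<le> M" and W: "2 * M ^ 4 \<le> 2 ^ w" and K: "K \<le> 4 * M"
begin

definition arrays :: "(nat \<Rightarrow> nat) \<Rightarrow> bool" where
  "arrays m \<longleftrightarrow> (\<forall>i<N1. m (M + i) = m1 i \<and> m (2 * M + i) = lab1 i) \<and>
     (\<forall>i<N2. m (3 * M + i) = m2 i \<and> m (4 * M + i) = lab2 i)"

definition tab :: "(nat \<Rightarrow> nat) \<Rightarrow> table" where
  "tab m a b l r = m (adr M a b l r)"

definition regs :: "(reg \<Rightarrow> nat) \<Rightarrow> bool" where
  "regs R \<longleftrightarrow> R ''M'' = M \<and> R ''B2'' = 2 * M \<and> R ''B3'' = 3 * M \<and> R ''B4'' = 4 * M \<and>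
     R ''K'' = K \<and> R ''N1'' = N1 \<and> R ''N2'' = N2"

text \<open>Keeps sums of entries within a word. It survives a match because a relabelling adds 2
  while the four matched brackets drop out of the lengths.\<close>

definition small :: "table \<Rightarrow> bool" where
  "small E \<longleftrightarrow> (\<forall>a b l r. a \<le> b \<and> b \<le> N1 \<and> l \<le> r \<and> r \<le> N2 \<longrightarrow> E a b l r \<le> Suc (b - a + (r - l)))"

lemma smallD: "small E \<Longrightarrow> a \<le> b \<Longrightarrow> b \<le> N1 \<Longrightarrow> l \<le> r \<Longrightarrow> r \<le> N2 \<Longrightarrow> E a b l r \<le> Suc (b - a + (r - l))"
  by (simp add: small_def)

lemma W16: "32 * M \<le> 2 ^ w"
proof -
  have "(4::nat) * 4 * 4 \<le> M * M * M" using M by (intro mult_mono) auto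
  then have "64 * M \<le> (M * M * M) * M" by simp
  also have "\<dots> = M ^ 4" by (simp add: eval_nat_numeral)
  finally show ?thesis using W by linarith
qed

lemma w1: "1 < w"
proof (rule ccontr)
  assume "\<not> 1 < w"
  then have "(2::nat) ^ w \<le> 2 ^ 1" by (intro power_increasing) auto
  then show False using W16 M by simp
qed

lemma minc_le: "v \<le> x \<Longrightarrow> z \<le> x \<Longrightarrow> minc v z \<le> x"
  by (simp add: minc_def)

lemma cell_left_small:
  assumes S: "small E" and ab: "a < b" "b \<le> N1" "l < r" "r \<le> N2"
  shows "cell_left E a b l r \<le> Suc (b - a + (r - l))"
proof -
  have "inc (E (Suc a) b l r) \<le> Suc (b - a + (r - l))" "inc (E a b (Suc l) r) \<le> Suc (b - a + (r - l))"
    using smallD[OF S, of "Suc a" b l r] smallD[OF S, of a b "Suc l" r] ab by (auto simp: inc_def)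
  moreover have "comb (of_bool (lab1 a \<noteq> lab2 l)) (E (Suc a) (m1 a) (Suc l) (m2 l)) (E (Suc (m1 a)) b (Suc (m2 l)) r)
      \<le> Suc (b - a + (r - l))" if "match_left a b l r"
    using smallD[OF S, of "Suc a" "m1 a" "Suc l" "m2 l"] smallD[OF S, of "Suc (m1 a)" b "Suc (m2 l)" r] that ab
    unfolding comb_def match_left_def by (auto simp: of_bool_def)
  ultimately show ?thesis unfolding cell_left_def by (auto intro!: minc_le)
qed

lemma cell_right_small:
  assumes S: "small E" and ab: "a \<le> b" "b < N1" "l \<le> r" "r < N2"
  shows "cell_right E a b l r \<le> Suc (Suc b - a + (Suc r - l))"
proof -
  have "inc (E a b l (Suc r)) \<le> Suc (Suc b - a + (Suc r - l))" "inc (E a (Suc b) l r) \<le> Suc (Suc b - a + (Suc r - l))"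
    using smallD[OF S, of a b l "Suc r"] smallD[OF S, of a "Suc b" l r] ab by (auto simp: inc_def)
  moreover have "comb (of_bool (lab1 b \<noteq> lab2 r)) (E (Suc (m1 b)) b (Suc (m2 r)) r) (E a (m1 b) l (m2 r))
      \<le> Suc (Suc b - a + (Suc r - l))" if "match_right a b l r"
    using smallD[OF S, of "Suc (m1 b)" b "Suc (m2 r)" r] smallD[OF S, of a "m1 b" l "m2 r"] that ab
    unfolding comb_def match_right_def by (auto simp: of_bool_def)
  ultimately show ?thesis unfolding cell_right_def by (auto intro!: minc_le)
qed

abbreviation tmps :: "reg set" where
  "tmps \<equiv> {''x'', ''y'', ''v'', ''z'', ''c'', ''e'', ''f'', ''g''}"

lemma tab_bound:
  assumes "small (tab m)" "a \<le> b" "b \<le> N1" "l \<le> r" "r \<le> N2"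
  shows "m (adr M a b l r) \<le> M"
  using smallD[OF assms(1), of a b l r] assms M unfolding tab_def by simp

lemma wp_cellL:
  assumes R: "regs R" "R ''a'' = a" "R ''b'' = b" "R ''l'' = l" "R ''r'' = r" "R ''v'' = 0"
    and ab: "a < b" "b \<le> N1" "l < r" "r \<le> N2" and m: "arrays m" "small (tab m)"
    and Q: "\<And>t' R'. t' \<le> t + 500 \<Longrightarrow> \<forall>x. x \<notin> tmps \<longrightarrow> R' x = R x \<Longrightarrow>
      R' ''v'' = cell_left (tab m) a b l r \<Longrightarrow> Q t' (R', m)"
  shows "wp w cellL Q t (R, m)"
proof -
  have Rs: "R ''M'' = M" "R ''B2'' = 2 * M" "R ''B3'' = 3 * M" "R ''B4'' = 4 * M"
    using R by (auto simp: regs_def)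
  have arr: "m (M + a) = m1 a" "m (2 * M + a) = lab1 a" "m (3 * M + l) = m2 l" "m (4 * M + l) = lab2 l"
    using m ab by (auto simp: arrays_def)
  have bd: "a + 1 < M" "b < M" "l + 1 < M" "r < M" "m1 a + 1 < M" "m2 l + 1 < M"
    using ab M X.m_less[of a] Y.m_less[of l] by auto
  have lt: "x < 2 ^ w" if "x \<le> 8 * M" for x
    using that W16 M by linarith
  have w0: "0 < w" using w1 by simp
  \<comment> \<open>Stated for every \<open>S\<close> that agrees with \<open>R\<close> outside the
    scratch registers, which is all that the preceding commands guarantee.\<close>
  have i1: "exp_val w (adrx (Reg ''a'' [+] Const 1) (Reg ''b'') (Reg ''l'') (Reg ''r'')) (S, m) = adr M (Suc a) b l r"
    and i2: "exp_val w (adrx (Reg ''a'') (Reg ''b'') (Reg ''l'' [+] Const 1) (Reg ''r'')) (S, m) = adr M a b (Suc l) r"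
    and i3: "S ''c'' = m1 a \<Longrightarrow> S ''e'' = m2 l \<Longrightarrow>
      exp_val w (adrx (Reg ''a'' [+] Const 1) (Reg ''c'') (Reg ''l'' [+] Const 1) (Reg ''e'')) (S, m) = adr M (Suc a) (m1 a) (Suc l) (m2 l)"
    and i4: "S ''c'' = m1 a \<Longrightarrow> S ''e'' = m2 l \<Longrightarrow>
      exp_val w (adrx (Reg ''c'' [+] Const 1) (Reg ''b'') (Reg ''e'' [+] Const 1) (Reg ''r'')) (S, m) = adr M (Suc (m1 a)) b (Suc (m2 l)) r"
    if S: "\<forall>x. x \<notin> tmps \<longrightarrow> S x = R x" for S
    using w0 bd R(2-5) Rs lt[of "Suc a"] lt[of "Suc l"] lt[of "Suc (m1 a)"] lt[of "Suc (m2 l)"]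
    by (subst exp_val_adrx[where M = M, OF _ _ _ _ _ W]; simp add: S vals)+
  have tb: "m (adr M (Suc a) b l r) \<le> M" "m (adr M a b (Suc l) r) \<le> M"
    "match_left a b l r \<Longrightarrow> m (adr M (Suc a) (m1 a) (Suc l) (m2 l)) \<le> M"
    "match_left a b l r \<Longrightarrow> m (adr M (Suc (m1 a)) b (Suc (m2 l)) r) \<le> M"
    using ab by (auto intro!: tab_bound[OF m(2)] simp: match_left_def)
  show ?thesis
    unfolding cellL_def
  proof (rule wp_Seq, rule wp_upd_inc[OF w1], goal_cases)
    case 1
    show ?case using i1[of R] tb(1) lt[of "Suc (m (adr M (Suc a) b l r))"] M by simp
  next
    case (2 t1 R1)
    have v1: "R1 ''v'' = inc (tab m (Suc a) b l r)" using 2(3) R(6) i1[of R] by (simp add: tab_def)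
    note S1 = 2(1,2)
    show ?case
    proof (rule wp_Seq, rule wp_upd_inc[OF w1], goal_cases)
      case 1
      show ?case using i2[of R1] S1 tb(2) lt[of "Suc (m (adr M a b (Suc l) r))"] M by simp
    next
      case (2 t2 R2)
      have v2: "R2 ''v'' = minc (inc (tab m (Suc a) b l r)) (inc (tab m a b (Suc l) r))"
        using 2(3) v1 i2[of R1] S1 by (simp add: tab_def)
      have S2: "\<forall>x. x \<notin> tmps \<longrightarrow> R2 x = R x" using 2(2) S1 by simp
      have t2: "t2 \<le> t + 150" using 2(1) S1(1) by simp
      let ?R = "R2(''c'' := m1 a, ''e'' := m2 l)"
      let ?g = "(Reg ''a'' [<] Reg ''c'') [*] (Reg ''c'' [<] Reg ''b'') [*]
           (Reg ''l'' [<] Reg ''e'') [*] (Reg ''e'' [<] Reg ''r'')"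
      have g: "exp_val w ?g (?R, m) = of_bool (match_left a b l r)"
        using w0 S2 R by (simp add: val_Less val_conj match_left_def)
      have L: "exp_val w (Load (Reg ''M'' [+] Reg ''a'')) (R2, m) = m1 a"
        "exp_val w (Load (Reg ''B3'' [+] Reg ''l'')) (R2(''c'' := m1 a), m) = m2 l"
        using S2 R Rs arr bd lt[of "M + a"] lt[of "3 * M + l"] by (simp_all add: vals)
      show ?case
      proof (rule wp_Seq, rule wp_Assign, rule wp_Seq, rule wp_Assign, unfold L, rule wp_If, goal_cases)
        case 1
        then have ml: "match_left a b l r" using g by simp
        note i34 = i3[of ?R] i4[of "?R(''x'' := q)" for q]
        show ?case
        proof (rule wp_upd_comb[OF w1, where ?ad2.0 = "adr M (Suc (m1 a)) b (Suc (m2 l)) r"], goal_cases)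
          case (1 q)
          show ?case by (rule i4) (use S2 in auto)
        next
          case 2
          show ?case using tb(3,4)[OF ml] i3[of ?R] S2 lt[of "M + M + 2"] M by simp
        next
          case (7 t3 R3)
          show ?case
          proof (rule Q)
            show "R3 ''v'' = cell_left (tab m) a b l r"
              using 7(3) v2 i3[of ?R] S2 R Rs arr ml unfolding cell_left_def tab_def by simp
          qed (use 7 t2 S2 in auto)
        qed (use S2 R Rs bd lt in auto)
      next
        case 2
        then have ml: "\<not> match_left a b l r" using g by simp
        show ?case
        proof (rule wp_Skip, rule Q)
          show "?R ''v'' = cell_left (tab m) a b l r"
            using v2 ml unfolding cell_left_def by simp
        qed (use t2 S2 in auto)
      qed
    qed
  qed
qed

lemma wp_cellR:
  assumes R: "regs R" "R ''a'' = a" "R ''b'' = Suc b" "R ''l'' = l" "R ''r'' = Suc r" "R ''v'' = 0"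
    and ab: "a \<le> b" "b < N1" "l \<le> r" "r < N2" and m: "arrays m" "small (tab m)"
    and Q: "\<And>t' R'. t' \<le> t + 500 \<Longrightarrow> \<forall>x. x \<notin> tmps \<longrightarrow> R' x = R x \<Longrightarrow>
      R' ''v'' = cell_right (tab m) a b l r \<Longrightarrow> Q t' (R', m)"
  shows "wp w cellR Q t (R, m)"
proof -
  have Rs: "R ''M'' = M" "R ''B2'' = 2 * M" "R ''B3'' = 3 * M" "R ''B4'' = 4 * M"
    using R by (auto simp: regs_def)
  have arr: "m (M + b) = m1 b" "m (2 * M + b) = lab1 b" "m (3 * M + r) = m2 r" "m (4 * M + r) = lab2 r"
    using m ab by (auto simp: arrays_def)
  have bd: "a < M" "b + 1 < M" "l < M" "r + 1 < M" "m1 b + 1 < M" "m2 r + 1 < M"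
    using ab M X.m_less[of b] Y.m_less[of r] by auto
  have lt: "x < 2 ^ w" if "x \<le> 8 * M" for x
    using that W16 M by linarith
  have w0: "0 < w" using w1 by simp
  let ?R0 = "R(''f'' := b, ''g'' := r)"
  have i1: "exp_val w (adrx (Reg ''a'') (Reg ''f'') (Reg ''l'') (Reg ''r'')) (S, m) = adr M a b l (Suc r)"
    and i2: "exp_val w (adrx (Reg ''a'') (Reg ''b'') (Reg ''l'') (Reg ''g'')) (S, m) = adr M a (Suc b) l r"
    and i3: "S ''c'' = m1 b \<Longrightarrow> S ''e'' = m2 r \<Longrightarrow>
      exp_val w (adrx (Reg ''c'' [+] Const 1) (Reg ''f'') (Reg ''e'' [+] Const 1) (Reg ''g'')) (S, m) = adr M (Suc (m1 b)) b (Suc (m2 r)) r"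
    and i4: "S ''c'' = m1 b \<Longrightarrow> S ''e'' = m2 r \<Longrightarrow>
      exp_val w (adrx (Reg ''a'') (Reg ''c'') (Reg ''l'') (Reg ''e'')) (S, m) = adr M a (m1 b) l (m2 r)"
    if S: "\<forall>x. x \<notin> tmps - {''f'', ''g''} \<longrightarrow> S x = ?R0 x" for S
    using w0 bd R(2-5) Rs lt[of "Suc b"] lt[of "Suc r"] lt[of "Suc (m1 b)"] lt[of "Suc (m2 r)"]
    by (subst exp_val_adrx[where M = M, OF _ _ _ _ _ W]; simp add: S vals)+
  have tb: "m (adr M a b l (Suc r)) \<le> M" "m (adr M a (Suc b) l r) \<le> M"
    "match_right a b l r \<Longrightarrow> m (adr M (Suc (m1 b)) b (Suc (m2 r)) r) \<le> M"
    "match_right a b l r \<Longrightarrow> m (adr M a (m1 b) l (m2 r)) \<le> M"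
    using ab by (auto intro!: tab_bound[OF m(2)] simp: match_right_def)
  have V: "exp_val w (Reg ''b'' [-] Const 1) (R, m) = b" "exp_val w (Reg ''r'' [-] Const 1) (R(''f'' := b), m) = r"
    using R bd w0 lt[of "Suc b"] lt[of "Suc r"] by (simp_all add: vals)
  show ?thesis
    unfolding cellR_def
  proof (rule wp_Seq, rule wp_Assign, rule wp_Seq, rule wp_Assign, unfold V, rule wp_Seq, rule wp_upd_inc[OF w1], goal_cases)
    case 1
    show ?case using i1[of ?R0] tb(1) lt[of "Suc (m (adr M a b l (Suc r)))"] M by simp
  next
    case (2 t1 R1)
    have v1: "R1 ''v'' = inc (tab m a b l (Suc r))" using 2(3) R(6) i1[of ?R0] by (simp add: tab_def)
    note S1 = 2(1,2)
    show ?case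
    proof (rule wp_Seq, rule wp_upd_inc[OF w1], goal_cases)
      case 1
      show ?case using i2[of R1] S1 tb(2) lt[of "Suc (m (adr M a (Suc b) l r))"] M by simp
    next
      case (2 t2 R2)
      have v2: "R2 ''v'' = minc (inc (tab m a b l (Suc r))) (inc (tab m a (Suc b) l r))"
        using 2(3) v1 i2[of R1] S1 by (simp add: tab_def)
      have S2: "\<forall>x. x \<notin> tmps - {''f'', ''g''} \<longrightarrow> R2 x = ?R0 x" using 2(2) S1 by simp
      have t2: "t2 \<le> t + 160" using 2(1) S1(1) by simp
      let ?R = "R2(''c'' := m1 b, ''e'' := m2 r)"
      let ?g = "(Reg ''a'' [<] Reg ''c'' [+] Const 1) [*] (Reg ''c'' [<] Reg ''f'') [*]
           (Reg ''l'' [<] Reg ''e'' [+] Const 1) [*] (Reg ''e'' [<] Reg ''g'')"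
      have g: "exp_val w ?g (?R, m) = of_bool (match_right a b l r)"
        using w0 S2 R bd lt[of "Suc (m1 b)"] lt[of "Suc (m2 r)"]
        by (simp add: val_Less val_Add val_Const val_conj match_right_def less_Suc_eq_le)
      have L: "exp_val w (Load (Reg ''M'' [+] Reg ''f'')) (R2, m) = m1 b"
        "exp_val w (Load (Reg ''B3'' [+] Reg ''g'')) (R2(''c'' := m1 b), m) = m2 r"
        using S2 R Rs arr bd lt[of "M + b"] lt[of "3 * M + r"] by (simp_all add: vals)
      show ?case
      proof (rule wp_Seq, rule wp_Assign, rule wp_Seq, rule wp_Assign, unfold L, rule wp_If, goal_cases)
        case 1
        then have ml: "match_right a b l r" using g by simp
        show ?case
        proof (rule wp_upd_comb[OF w1, where ?ad2.0 = "adr M a (m1 b) l (m2 r)"], goal_cases)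
          case (1 q)
          show ?case by (rule i4) (use S2 in auto)
        next
          case 2
          show ?case using tb(3,4)[OF ml] i3[of ?R] S2 lt[of "M + M + 2"] M by simp
        next
          case (7 t3 R3)
          show ?case
          proof (rule Q)
            show "R3 ''v'' = cell_right (tab m) a b l r"
              using 7(3) v2 i3[of ?R] S2 R Rs arr ml unfolding cell_right_def tab_def by simp
          qed (use 7 t2 S2 in auto)
        qed (use S2 R Rs bd lt in auto)
      next
        case 2
        then have ml: "\<not> match_right a b l r" using g by simp
        show ?case
        proof (rule wp_Skip, rule Q)
          show "?R ''v'' = cell_right (tab m) a b l r"
            using v2 ml unfolding cell_right_def by simp
        qed (use t2 S2 in auto)
      qed
    qed
  qed
qed

definition cell_val :: "nat \<Rightarrow> table \<Rightarrow> nat \<Rightarrow> nat \<Rightarrow> nat \<Rightarrow> nat \<Rightarrow> nat" where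
  "cell_val d E a b l r = (if a = b \<or> l = r then Suc (b - a + (r - l))
     else if d = 0 then cell_left E a b l r else cell_right E a (b - 1) l (r - 1))"

lemma wp_cell:
  assumes R: "regs R" "R ''a'' = a" "R ''b'' = b" "R ''l'' = l" "R ''r'' = r" "R ''d'' = d"
    and ab: "a \<le> b" "b \<le> N1" "l \<le> r" "r \<le> N2" and m: "arrays m" "small (tab m)"
    and Q: "\<And>t' R'. t' \<le> t + 600 \<Longrightarrow> \<forall>x. x \<notin> tmps \<longrightarrow> R' x = R x \<Longrightarrow>
      Q t' (R', m(adr M a b l r := cell_val d (tab m) a b l r))"
  shows "wp w cell Q t (R, m)"
proof -
  have w0: "0 < w" using w1 by simp
  have lt: "x < 2 ^ w" if "x \<le> 8 * M" for x
    using that W16 M by linarith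
  have M4: "4 \<le> M" using M by simp
  have guard: "exp_val w ((Reg ''a'' [=] Reg ''b'') [+] (Reg ''l'' [=] Reg ''r'')) (R, m) = 0 \<longleftrightarrow> \<not> (a = b \<or> l = r)"
    using R w0 lt[of "of_bool (a = b) + of_bool (l = r)"] M4 by (simp add: val_Eq val_Add of_bool_def)
  have A: "exp_val w (adrx (Reg ''a'') (Reg ''b'') (Reg ''l'') (Reg ''r'')) (S, m) = adr M a b l r"
    if "\<forall>x. x \<notin> tmps \<longrightarrow> S x = R x" for S
    using R ab M by (subst exp_val_adrx[where M = M, OF _ _ _ _ _ W]; simp add: that regs_def)
  have fin: "wp w (Store (adrx (Reg ''a'') (Reg ''b'') (Reg ''l'') (Reg ''r'')) (Reg ''v'')) Q t' (R', m)"
    if "t' \<le> t + 570" "\<forall>x. x \<notin> tmps \<longrightarrow> R' x = R x" "R' ''v'' = cell_val d (tab m) a b l r" for t' R'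
  proof (rule wp_Store)
    have "Q (t' + 17) (R', m(adr M a b l r := cell_val d (tab m) a b l r))" using that by (intro Q) auto
    then show "Q (t' + (1 + exp_time (adrx (Reg ''a'') (Reg ''b'') (Reg ''l'') (Reg ''r'')) + exp_time (Reg ''v'')))
        (R', m(exp_val w (adrx (Reg ''a'') (Reg ''b'') (Reg ''l'') (Reg ''r'')) (R', m) := exp_val w (Reg ''v'') (R', m)))"
      using A[OF that(2)] that(3) by (simp add: add.commute)
  qed
  show ?thesis
    unfolding cell_def
  proof (rule wp_Seq, rule wp_If, goal_cases)
    case 1
    then have "a = b \<or> l = r" using guard by auto
    then show ?case
      using R ab M4 M lt[of "b - a + (r - l) + 1"] lt[of b] lt[of r] w0
      by (intro wp_Assign fin) (auto simp: vals cell_val_def)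
  next
    case 2
    then have ne: "a < b" "l < r" using guard ab by auto
    show ?case
    proof (rule wp_Seq, rule wp_Assign, rule wp_If, goal_cases)
      case 1
      then have d: "d \<noteq> 0" using R by simp
      obtain b' r' where br: "b = Suc b'" "r = Suc r'" using ne by (metis Suc_pred' gr0I not_less0)
      show ?case
        by (rule wp_cellR[where a = a and b = b' and l = l and r = r'], use R ab ne br m w0 in \<open>simp_all add: regs_def\<close>)
          (rule fin, use d ne br in \<open>simp_all add: cell_val_def\<close>)
    next
      case 2
      then have d: "d = 0" using R by simp
      show ?case
        by (rule wp_cellL[where a = a and b = b and l = l and r = r], use R ab ne m w0 in \<open>simp_all add: regs_def\<close>)
          (rule fin, use d ne in \<open>simp_all add: cell_val_def\<close>)
    qed
  qed
qed

end

lemma wp_when_assign: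
  assumes "\<And>t'. t' \<le> t + exp_time e + exp_time f + 5 \<Longrightarrow>
    Q t' (R(x := if exp_val w e (R, m) = 0 then R x else exp_val w f (R, m)), m)"
  shows "wp w (when e (x :== f)) Q t (R, m)"
proof (rule wp_If)
  assume "exp_val w e (R, m) \<noteq> 0"
  then show "wp w (x :== f) Q (t + (1 + exp_time e)) (R, m)"
    using assms[of "t + (1 + exp_time e) + (1 + exp_time f)"] by (intro wp_Assign) simp
next
  assume "exp_val w e (R, m) = 0"
  then show "wp w Skip Q (t + (1 + exp_time e)) (R, m)"
    using assms[of "t + (1 + exp_time e) + 1"] by (intro wp_Skip) (simp add: fun_upd_idem)
qed

context machine
begin

definition deps :: "nat \<Rightarrow> (nat \<times> nat) set \<Rightarrow> nat \<Rightarrow> nat \<Rightarrow> bool" where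
  "deps d D l r \<longleftrightarrow> l = r \<or> l < r \<and>
     (if d = 0 then Y.deps_left D l r else Y.deps_right D l (r - 1))"

definition inv :: "(nat \<Rightarrow> nat) \<Rightarrow> (nat \<times> nat) set \<Rightarrow> bool" where
  "inv m D \<longleftrightarrow> arrays m \<and> small (tab m) \<and> sound (tab m) \<and>
     (\<forall>l r. (l, r) \<in> D \<and> l \<le> r \<and> r \<le> N2 \<longrightarrow> good K (tab m) l r)"

lemma tab_upd:
  assumes "a \<le> N1" "b \<le> N1" "l \<le> N2" "r \<le> N2" "a' \<le> N1" "b' \<le> N1" "l' \<le> N2" "r' \<le> N2"
  shows "tab (m(adr M a b l r := v)) a' b' l' r' =
    (if a' = a \<and> b' = b \<and> l' = l \<and> r' = r then v else tab m a' b' l' r')"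
  using adr_inject[of b' M l' r' b l r a' a] assms M unfolding tab_def by auto

text \<open>Joins both recurrences. Two neighbouring cells of the current second interval are
  assumed exact; every other second interval comes from \<open>D\<close>.\<close>

lemma cell_val_good:
  assumes ab: "a \<le> b" "b \<le> N1" "l \<le> r" "r \<le> N2" and I: "inv m D" and D: "deps d D l r"
    and ex: "a < b \<Longrightarrow> exact K (tab m) (Suc a) b l r" "a < b \<Longrightarrow> exact K (tab m) a (b - 1) l r"
  shows "above (lam a b l r) (cell_val d (tab m) a b l r)"
    and "cell_val d (tab m) a b l r \<le> Suc (b - a + (r - l))"
    and "shift a b l r + lam a b l r \<le> K \<Longrightarrow> cell_val d (tab m) a b l r = Suc (lam a b l r)"
proof -
  have S: "small (tab m)" "sound (tab m)" and G: "\<And>l r. (l, r) \<in> D \<Longrightarrow> l \<le> r \<Longrightarrow> r \<le> N2 \<Longrightarrow> good K (tab m) l r"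
    using I by (auto simp: inv_def)
  consider (triv) "a = b \<or> l = r" | (left) "a < b" "l < r" "d = 0"
    | (right) b' r' where "a < b" "l < r" "d \<noteq> 0" "b = Suc b'" "r = Suc r'"
    using ab by (metis le_neq_implies_less less_imp_Suc_add not0_implies_Suc not_less0)
  then have "above (lam a b l r) (cell_val d (tab m) a b l r) \<and>
     cell_val d (tab m) a b l r \<le> Suc (b - a + (r - l)) \<and>
     (shift a b l r + lam a b l r \<le> K \<longrightarrow> cell_val d (tab m) a b l r = Suc (lam a b l r))"
  proof cases
    case triv
    then show ?thesis by (auto simp: cell_val_def above_def)
  next
    case left
    then have c: "cell_val d (tab m) a b l r = cell_left (tab m) a b l r" by (simp add: cell_val_def)
    have D: "Y.deps_left D l r" using D left by (auto simp: deps_def)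
    have "cell_left (tab m) a b l r = Suc (lam a b l r)" if "shift a b l r + lam a b l r \<le> K"
      using left ab that D ex by (intro cell_left_exact[OF _ _ _ _ S(2)]) (auto simp: Y.deps_left_def intro!: G)
    then show ?thesis using c cell_left_small[OF S(1)] cell_left_above[OF S(2)] left ab by simp
  next
    case right
    then have c: "cell_val d (tab m) a b l r = cell_right (tab m) a b' l r'" by (simp add: cell_val_def)
    have D: "Y.deps_right D l r'" using D right by (auto simp: deps_def)
    have "cell_right (tab m) a b' l r' = Suc (lam a b l r)" if "shift a b l r + lam a b l r \<le> K"
      unfolding right(4,5)
      using right ab that D ex by (intro cell_right_exact[OF _ _ _ _ S(2)]) (auto simp: Y.deps_right_def intro!: G)
    then show ?thesis using c cell_right_small[OF S(1), of a b' l r'] cell_right_above[OF S(2), of a b' l r'] right ab by simp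
  qed
  then show "above (lam a b l r) (cell_val d (tab m) a b l r)"
    and "cell_val d (tab m) a b l r \<le> Suc (b - a + (r - l))"
    and "shift a b l r + lam a b l r \<le> K \<Longrightarrow> cell_val d (tab m) a b l r = Suc (lam a b l r)"
    by blast+
qed

lemma adr_large: "a < M \<Longrightarrow> b < M \<Longrightarrow> l < M \<Longrightarrow> r < M \<Longrightarrow> 64 * M \<le> adr M a b l r"
proof -
  assume "a < M" "b < M" "l < M" "r < M"
  moreover have "(4::nat) * 4 * 4 \<le> M * M * M" using M by (intro mult_mono) auto
  then have "64 * M \<le> (M * M * M) * M" by simp
  moreover have "(M * M * M) * M = M ^ 4" by (simp add: eval_nat_numeral)
  ultimately show ?thesis using adr_bounds(4)[of a M b l r] by linarith
qed

text \<open>A store may overwrite an entry that was exact before, as a second interval can come up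
  again; \<open>cell_val_good\<close> shows that within the budget the same value is
  written.\<close>

lemma inv_store:
  assumes ab: "a \<le> b" "b \<le> N1" "l \<le> r" "r \<le> N2" and I: "inv m D" and D: "deps d D l r"
    and ex: "a < b \<Longrightarrow> exact K (tab m) (Suc a) b l r" "a < b \<Longrightarrow> exact K (tab m) a (b - 1) l r"
  defines "m' \<equiv> m(adr M a b l r := cell_val d (tab m) a b l r)"
  shows "inv m' D" "exact K (tab m') a b l r"
    and "\<And>a' b'. a' \<le> b' \<Longrightarrow> b' \<le> N1 \<Longrightarrow> exact K (tab m) a' b' l r \<Longrightarrow> exact K (tab m') a' b' l r"
proof -
  note v = cell_val_good[OF ab I D ex]
  have T: "tab m' a' b' l' r' = (if a' = a \<and> b' = b \<and> l' = l \<and> r' = r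
      then cell_val d (tab m) a b l r else tab m a' b' l' r')"
    if "a' \<le> b'" "b' \<le> N1" "l' \<le> r'" "r' \<le> N2" for a' b' l' r'
    unfolding m'_def using ab that by (intro tab_upd) auto
  have ex': "exact K (tab m') a' b' l' r'" if "exact K (tab m) a' b' l' r'" "a' \<le> b'" "b' \<le> N1" "l' \<le> r'" "r' \<le> N2" for a' b' l' r'
    using that v(3) by (auto simp: exact_def T)
  show "exact K (tab m') a b l r" using v(3) ab by (auto simp: exact_def T)
  show "exact K (tab m') a' b' l r" if "a' \<le> b'" "b' \<le> N1" "exact K (tab m) a' b' l r" for a' b'
    using ex' that ab by simp
  have "64 * M \<le> adr M a b l r" using ab M by (intro adr_large) auto
  then have "arrays m'" using I M by (auto simp: inv_def arrays_def m'_def)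
  moreover have "small (tab m')" using I v(2) by (auto simp: inv_def small_def T)
  moreover have "sound (tab m')" using I v(1) by (auto simp: inv_def sound_def T)
  moreover have "good K (tab m') l' r'" if "(l', r') \<in> D" "l' \<le> r'" "r' \<le> N2" for l' r'
    using I that ex' by (auto simp: inv_def good_def)
  ultimately show "inv m' D" by (simp add: inv_def)
qed

lemma exact_far: "K < shift a b l r \<Longrightarrow> exact K E a b l r"
  by (simp add: exact_def)

text \<open>At most \<open>2 * K + 1\<close> rows with at most \<open>2 * K + 1\<close> visited
  cells each; 620 pays for a cell with its loop overhead, 60 for the rest of a row.\<close>

definition btime :: nat where
  "btime = (2 * K + 1) * ((2 * K + 1) * 620 + 60) + 150"

abbreviation btmps :: "reg set" where
  "btmps \<equiv> {''x'', ''y'', ''v'', ''z'', ''c'', ''e'', ''f'', ''g'', ''s'', ''lo'', ''hb'', ''lb'', ''a'', ''b''}"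

text \<open>The cells before \<open>b0\<close> and from \<open>hb\<close> on are displaced by more
  than \<open>K\<close>, so \<open>exact\<close> holds for them without a visit.\<close>

lemma wp_row:
  assumes R: "regs R" "R ''l'' = l" "R ''r'' = r" "R ''d'' = d" "R ''a'' = a" "R ''hb'' = hb" "R ''b'' = b0"
    and lr: "l \<le> r" "r \<le> N2" and I: "inv m D" and D: "deps d D l r"
    and a: "a \<le> N1" "a \<le> b0" "hb \<le> Suc N1" "hb - b0 \<le> 2 * K + 1"
    and b0: "\<And>b. a \<le> b \<Longrightarrow> b < b0 \<Longrightarrow> K < shift a b l r"
    and hb: "\<And>b. a \<le> b \<Longrightarrow> hb \<le> b \<Longrightarrow> b \<le> N1 \<Longrightarrow> K < shift a b l r"
    and ex: "\<And>a' b. a < a' \<Longrightarrow> a' \<le> b \<Longrightarrow> b \<le> N1 \<Longrightarrow> exact K (tab m) a' b l r"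
    and Q: "\<And>t' R' m'. t' \<le> t + (2 * K + 1) * 620 + 5 \<Longrightarrow> \<forall>x. x \<notin> insert ''b'' tmps \<longrightarrow> R' x = R x \<Longrightarrow>
      inv m' D \<Longrightarrow> (\<And>a' b. a \<le> a' \<Longrightarrow> a' \<le> b \<Longrightarrow> b \<le> N1 \<Longrightarrow> exact K (tab m') a' b l r) \<Longrightarrow> Q t' (R', m')"
  shows "wp w (While (Reg ''b'' [<] Reg ''hb'') (cell ;; ''b'' :== Reg ''b'' [+] Const 1)) Q t (R, m)"
proof -
  have w0: "0 < w" using w1 by simp
  have lt: "x < 2 ^ w" if "x \<le> 8 * M" for x
    using that W16 M by linarith
  let ?I = "\<lambda>(R', m'). (\<forall>x. x \<notin> insert ''b'' tmps \<longrightarrow> R' x = R x) \<and> inv m' D \<and> b0 \<le> R' ''b'' \<and>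
     (\<forall>a' b. a < a' \<and> a' \<le> b \<and> b \<le> N1 \<longrightarrow> exact K (tab m') a' b l r) \<and>
     (\<forall>b. a \<le> b \<and> b < R' ''b'' \<and> b \<le> N1 \<longrightarrow> exact K (tab m') a b l r)"
  show ?thesis
  proof (rule wp_While[where I = ?I and \<phi> = "\<lambda>(R', m'). (hb - R' ''b'') * 620"], goal_cases)
    case (1 t1 s)
    obtain R1 m1' where s: "s = (R1, m1')" by (cases s)
    note I1 = 1(1)[unfolded s, simplified]
    define b where "b = R1 ''b''"
    have R1: "regs R1" "R1 ''a'' = a" "R1 ''b'' = b" "R1 ''l'' = l" "R1 ''r'' = r" "R1 ''d'' = d" "R1 ''hb'' = hb"
      using I1 R by (auto simp: regs_def b_def)
    have b: "b < hb" "b0 \<le> b" using 1(2) w0 R1 I1 by (auto simp: s val_Less)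
    then have b1: "b \<le> N1" "a \<le> b" "Suc b \<le> M" using a M by auto
    have inv1: "inv m1' D" using I1 by simp
    have E1: "exact K (tab m1') a' b' l r" if "a < a'" "a' \<le> b'" "b' \<le> N1" for a' b'
      using I1 that by blast
    have E2: "exact K (tab m1') a b' l r" if "a \<le> b'" "b' < b" "b' \<le> N1" for b'
      using I1 that unfolding b_def by blast
    have ex1: "a < b \<Longrightarrow> exact K (tab m1') (Suc a) b l r" "a < b \<Longrightarrow> exact K (tab m1') a (b - 1) l r"
      using E1[of "Suc a" b] E2[of "b - 1"] b1 by simp_all
    note st = inv_store[OF b1(2,1) lr inv1 D ex1]
    show ?case unfolding s
    proof (rule wp_Seq, rule wp_cell[OF R1(1-6) b1(2,1) lr], goal_cases)
      case (3 t2 R2)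
      have R2b: "R2 ''b'' = b" using 3(2) R1 by simp
      have "Suc b < 2 ^ w" using lt[of "Suc b"] b1 by simp
      then have V: "exp_val w (Reg ''b'' [+] Const 1) (R2, m1'(adr M a b l r := cell_val d (tab m1') a b l r)) = Suc b"
        using w0 R2b by (simp add: vals)
      have "(hb - b) * 620 = (hb - Suc b) * 620 + 620"
        using b by (simp flip: Suc_diff_Suc)
      moreover have "\<forall>x. x \<notin> insert ''b'' tmps \<longrightarrow> (R2(''b'' := Suc b)) x = R x" using 3(2) I1 by simp
      moreover have "exact K (tab (m1'(adr M a b l r := cell_val d (tab m1') a b l r))) a b' l r"
        if "a \<le> b'" "b' < Suc b" "b' \<le> N1" for b'
        using st(2) st(3)[of a b'] E2[of b'] that by (cases "b' = b") auto
      moreover have "exact K (tab (m1'(adr M a b l r := cell_val d (tab m1') a b l r))) a' b' l r"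
        if "a < a'" "a' \<le> b'" "b' \<le> N1" for a' b'
        using st(3)[of a' b'] E1 that by blast
      ultimately show ?case
        using 3(1) st(1) b R1(3) by (intro wp_Assign, unfold V) simp
    qed (use inv1 in \<open>auto simp: inv_def\<close>)
  next
    case (2 t1 s)
    obtain R1 m1' where s: "s = (R1, m1')" by (cases s)
    note I1 = 2(1)[unfolded s, simplified]
    have b: "hb \<le> R1 ''b''" using 2(2) w0 I1 R by (auto simp: s val_Less)
    have "exact K (tab m1') a' b l r" if "a \<le> a'" "a' \<le> b" "b \<le> N1" for a' b
    proof (cases "a' = a")
      case True
      then show ?thesis using I1 that hb[of b] \<open>hb \<le> R1 ''b''\<close> exact_far by (meson le_trans not_le)
    next
      case False
      then show ?thesis using I1 that by auto
    qed
    moreover have "t1 \<le> t + (2 * K + 1) * 620 + 5"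
      using 2(3) R a(4) mult_le_mono1[OF a(4), of 620] by simp
    ultimately show ?case unfolding s using I1 by (intro Q) auto
  next
    case 3
    show ?case using R I ex b0 exact_far by auto
  qed
qed

lemma wp_block:
  assumes R: "regs R" "R ''l'' = l" "R ''r'' = r" "R ''d'' = d"
    and lr: "l \<le> r" "r \<le> N2" and I: "inv m D" and D: "deps d D l r"
    and Q: "\<And>t' R' m'. t' \<le> t + btime \<Longrightarrow> \<forall>x. x \<notin> btmps \<longrightarrow> R' x = R x \<Longrightarrow>
      inv m' (insert (l, r) D) \<Longrightarrow> Q t' (R', m')"
  shows "wp w block Q t (R, m)"
proof -
  have w0: "0 < w" using w1 by simp
  have lt: "x < 2 ^ w" if "x \<le> 8 * M" for x
    using that W16 M by linarith
  have bd: "l + K + 1 < 2 ^ w" "r + K + 1 < 2 ^ w" "N1 + 1 < 2 ^ w" "l < 2 ^ w" "r < 2 ^ w"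
    using lr M K by (auto intro!: lt)
  have Rs: "R ''K'' = K" "R ''N1'' = N1" using R by (auto simp: regs_def)
  define s0 where "s0 = min (Suc N1) (Suc (l + K))"
  define hb where "hb = min (Suc N1) (Suc (r + K))"
  have V1: "exp_val w (Reg ''l'' [+] Reg ''K'' [+] Const 1) (R, m) = Suc (l + K)"
    using bd R Rs w0 by (simp add: vals)
  let ?R1 = "R(''s'' := Suc (l + K))"
  have V2: "(if exp_val w (Reg ''N1'' [<] Reg ''s'') (?R1, m) = 0 then ?R1 ''s''
      else exp_val w (Reg ''N1'' [+] Const 1) (?R1, m)) = s0"
    using bd R Rs w0 by (auto simp: vals s0_def min_def)
  let ?R2 = "R(''s'' := s0, ''lo'' := 0)"
  have V3: "(if exp_val w (Reg ''K'' [<] Reg ''l'') (?R2, m) = 0 then ?R2 ''lo''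
      else exp_val w (Reg ''l'' [-] Reg ''K'') (?R2, m)) = l - K"
    using bd R Rs w0 by (auto simp: vals)
  have V4: "exp_val w (Reg ''r'' [+] Reg ''K'' [+] Const 1) (R(''s'' := s0, ''lo'' := l - K), m) = Suc (r + K)"
    using bd R Rs w0 by (simp add: vals)
  let ?R3 = "R(''s'' := s0, ''lo'' := l - K, ''hb'' := Suc (r + K))"
  have V5: "(if exp_val w (Reg ''N1'' [<] Reg ''hb'') (?R3, m) = 0 then ?R3 ''hb''
      else exp_val w (Reg ''N1'' [+] Const 1) (?R3, m)) = hb"
    using bd R Rs w0 by (auto simp: vals hb_def min_def)
  let ?R4 = "R(''s'' := s0, ''lo'' := l - K, ''hb'' := hb, ''lb'' := 0)"
  have V6: "(if exp_val w (Reg ''K'' [<] Reg ''r'') (?R4, m) = 0 then ?R4 ''lb''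
      else exp_val w (Reg ''r'' [-] Reg ''K'') (?R4, m)) = r - K"
    using bd R Rs w0 by (auto simp: vals)
  have C0: "exp_val w (Const 0) s = 0" for s by simp
  let ?R5 = "R(''s'' := s0, ''lo'' := l - K, ''hb'' := hb, ''lb'' := r - K)"
  let ?I = "\<lambda>(R', m'). (\<forall>x. x \<notin> {''s'', ''a'', ''b''} \<union> tmps \<longrightarrow> R' x = ?R5 x) \<and> inv m' D \<and> R' ''s'' \<le> Suc N1 \<and>
     (\<forall>a b. R' ''s'' \<le> a \<and> a \<le> b \<and> b \<le> N1 \<longrightarrow> exact K (tab m') a b l r)"
  let ?X = "(2 * K + 1) * 620 + 60"
  show ?thesis
    unfolding block_def
  proof (rule wp_Seq, rule wp_Assign, unfold V1, rule wp_Seq, rule wp_when_assign, unfold V2 fun_upd_upd,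
      rule wp_Seq, rule wp_Assign, unfold C0, rule wp_Seq, rule wp_when_assign, unfold V3 fun_upd_upd,
      rule wp_Seq, rule wp_Assign, unfold V4, rule wp_Seq, rule wp_when_assign, unfold V5 fun_upd_upd,
      rule wp_Seq, rule wp_Assign, unfold C0, rule wp_Seq, rule wp_when_assign, unfold V6 fun_upd_upd,
      rule wp_While[where I = ?I and \<phi> = "\<lambda>(R', m'). (R' ''s'' - (l - K)) * ?X"], goal_cases)
    case (1 _ _ _ _ t1 s)
    obtain R1 m1' where s: "s = (R1, m1')" by (cases s)
    note I1 = 1(5)[unfolded s, simplified]
    have sl: "l - K < R1 ''s''" using 1(6) w0 I1 by (auto simp: s val_Less)
    then obtain a where a: "R1 ''s'' = Suc a" by (cases "R1 ''s''") auto
    have aN: "a \<le> N1" "l - K \<le> a" using I1 a sl by auto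
    have R1s: "regs R1" "R1 ''l'' = l" "R1 ''r'' = r" "R1 ''d'' = d" "R1 ''hb'' = hb"
      using I1 R by (simp_all add: regs_def)
    have inv1: "inv m1' D" using I1 by simp
    have V: "exp_val w (Reg ''s'' [-] Const 1) (R1, m1') = a"
      using a w0 lt[of "Suc a"] aN M by (simp add: vals)
    let ?b0 = "max a (r - K)"
    have Vb: "(if exp_val w (Reg ''a'' [<] Reg ''lb'') (R1(''a'' := a, ''b'' := a), m1') = 0 then (R1(''a'' := a, ''b'' := a)) ''b''
      else exp_val w (Reg ''lb'') (R1(''a'' := a, ''b'' := a), m1')) = ?b0"
      using I1 w0 by (auto simp: val_Less max_def)
    have Va: "exp_val w (Reg ''a'') (R1(''a'' := a), m1') = a" by simp
    show ?case unfolding s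
    proof (rule wp_Seq, rule wp_Assign, unfold V, rule wp_Seq, rule wp_Assign, unfold Va, rule wp_Seq,
        rule wp_when_assign, unfold Vb fun_upd_upd, rule wp_Seq,
        rule wp_row[where D = D and a = a and l = l and r = r and d = d and hb = hb and ?b0.0 = ?b0], goal_cases)
      case (19 t2 t3 R3 m3)
      have "(Suc a - (l - K)) * ?X = (a - (l - K)) * ?X + ?X" using aN by (simp add: Suc_diff_le)
      moreover have "t3 + 2 + (a - (l - K)) * ?X \<le> t1 + ((a - (l - K)) * ?X + ?X)" using 19(1,2) by simp
      moreover have "R3 ''a'' = a" using 19(3) by simp
      moreover have "\<forall>x. x \<notin> {''s'', ''a'', ''b''} \<union> tmps \<longrightarrow> (R3(''s'' := a)) x = ?R5 x" using 19(3) I1 by simp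
      moreover have "\<forall>a' b. a \<le> a' \<and> a' \<le> b \<and> b \<le> N1 \<longrightarrow> exact K (tab m3) a' b l r" using 19(5) by blast
      ultimately show ?case using 19(4) a aN by (intro wp_Assign) simp
    next
      case 15
      show ?case by (simp add: hb_def)
    next
      case (16 _ b)
      then have "b < r - K" by linarith
      then show ?case by (simp add: shift_def)
    next
      case (17 _ b)
      then have "r + K < b" by (simp add: hb_def)
      then show ?case by (simp add: shift_def)
    next
      case (18 _ a' b)
      then have "R1 ''s'' \<le> a'" using a by simp
      then show ?case using I1 18 by blast
    qed (use R1s lr D aN inv1 in \<open>simp_all add: regs_def hb_def\<close>)
  next
    case (2 t1 t2 t3 t4 t5 s)
    obtain R1 m1' where s: "s = (R1, m1')" by (cases s)
    note I1 = 2(5)[unfolded s, simplified]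
    have sl: "R1 ''s'' \<le> l - K" using 2(6) w0 I1 by (auto simp: s val_Less)
    have "exact K (tab m1') a b l r" if "a \<le> b" "b \<le> N1" for a b
    proof (cases "R1 ''s'' \<le> a")
      case True
      then show ?thesis using I1 that by auto
    next
      case False
      then show ?thesis using sl by (intro exact_far) (auto simp: shift_def)
    qed
    then have "good K (tab m1') l r" by (simp add: good_def)
    then have "inv m1' (insert (l, r) D)" using I1 by (auto simp: inv_def)
    moreover have "s0 - (l - K) \<le> 2 * K + 1" by (auto simp: s0_def)
    then have "(s0 - (l - K)) * ?X \<le> (2 * K + 1) * ?X" by (rule mult_le_mono1)
    then have "t5 \<le> t + btime" using 2(1-4,7) by (simp add: btime_def)
    ultimately show ?case unfolding s using I1 by (intro Q) auto
  next
    case (3 t1 t2 t3 t4)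
    have "exact K (tab m) a b l r" if "s0 \<le> a" "a \<le> b" "b \<le> N1" for a b
      using that by (intro exact_far) (auto simp: s0_def shift_def)
    then show ?case using I by (simp add: s0_def)
  qed
qed

end

section \<open>Loops over growing intervals, windows and phases\<close>

definition growc :: com where
  "growc = While ((Reg ''L'' [<] Reg ''l'') [+] (Reg ''r'' [<] Reg ''R'')) (
     ''d'' :== (Reg ''r'' [<] Reg ''R'') [*]
       (((Load (Reg ''B3'' [+] Reg ''r'') [<] Reg ''p'') [=] Const 0) [+]
        (Load (Reg ''B3'' [+] Reg ''r'') [=] Reg ''l'') [+] (Reg ''l'' [=] Reg ''L'')) ;;
     If (Reg ''d'') (''r'' :== Reg ''r'' [+] Const 1) (''l'' :== Reg ''l'' [-] Const 1) ;;
     block)"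

definition windowc :: com where
  "windowc = While (Reg ''p'' [<] Reg ''N2'') (
     ''L'' :== Reg ''p'' [-] Reg ''A'' ;;
     ''R'' :== Reg ''p'' [+] Reg ''A'' ;;
     when (Reg ''N2'' [<] Reg ''R'') (''R'' :== Reg ''N2'') ;;
     ''l'' :== Reg ''p'' ;;
     ''r'' :== Reg ''p'' ;;
     growc ;;
     ''p'' :== Reg ''p'' [+] Reg ''A'' [+] Reg ''A'')"

definition phasec :: com where
  "phasec = While (Reg ''A'' [<] Reg ''N2'') (
     ''p'' :== Reg ''A'' ;;
     windowc ;;
     ''A'' :== Reg ''A'' [+] Reg ''A'')"

definition initc :: com where
  "initc = (''l'' :== Const 0 ;;
     While (Reg ''l'' [<] Reg ''N2'' [+] Const 1) (
       ''r'' :== Reg ''l'' ;;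
       block ;;
       ''l'' :== Reg ''l'' [+] Const 1))"

definition mainc :: com where
  "mainc = (initc ;;
     ''A'' :== Const 1 ;;
     phasec ;;
     ''out'' :== Bin Div (Load (adrx (Const 0) (Reg ''N1'') (Const 0) (Reg ''N2''))) (Const 2))"

context machine
begin

abbreviation gtmps :: "reg set" where
  "gtmps \<equiv> {''x'', ''y'', ''v'', ''z'', ''c'', ''e'', ''f'', ''g'', ''s'', ''lo'', ''hb'', ''lb'', ''a'', ''b'', ''l'', ''r'', ''d''}"

lemma wp_growc:
  assumes R: "regs R" "R ''p'' = p" "R ''L'' = L" "R ''R'' = Rr" "R ''l'' = l0" "R ''r'' = r0"
    and I: "inv m D" and G: "Y.grow_inv L Rr p l0 r0 D"
    and Q: "\<And>t' R' m' D'. t' \<le> t + ((l0 - L) + (Rr - r0)) * (btime + 60) + 10 \<Longrightarrow>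
      \<forall>x. x \<notin> gtmps \<longrightarrow> R' x = R x \<Longrightarrow> D \<subseteq> D' \<Longrightarrow> inv m' D' \<Longrightarrow> Y.grow_inv L Rr p L Rr D' \<Longrightarrow> Q t' (R', m')"
  shows "wp w growc Q t (R, m)"
proof -
  have w0: "0 < w" using w1 by simp
  have lt: "x < 2 ^ w" if "x \<le> 8 * M" for x
    using that W16 M by linarith
  have M4: "4 \<le> M" using M by simp
  let ?I = "\<lambda>(R', m'). (\<forall>x. x \<notin> gtmps \<longrightarrow> R' x = R x) \<and>
     (\<exists>D'. D \<subseteq> D' \<and> inv m' D' \<and> Y.grow_inv L Rr p (R' ''l'') (R' ''r'') D')"
  let ?g = "(Reg ''L'' [<] Reg ''l'') [+] (Reg ''r'' [<] Reg ''R'')"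
  have g: "exp_val w ?g (R1, m1') = 0 \<longleftrightarrow> \<not> (L < R1 ''l'') \<and> \<not> (R1 ''r'' < Rr)"
    if "\<forall>x. x \<notin> gtmps \<longrightarrow> R1 x = R x" for R1 m1'
    using that R w0 lt[of "of_bool (L < R1 ''l'') + of_bool (R1 ''r'' < Rr)"] M4
    by (simp add: val_Less val_Add of_bool_def)
  show ?thesis
    unfolding growc_def
  proof (rule wp_While[where I = ?I and \<phi> = "\<lambda>(R', m'). ((R' ''l'' - L) + (Rr - R' ''r'')) * (btime + 60)"], goal_cases)
    case (1 t1 s)
    obtain R1 m1' where s: "s = (R1, m1')" by (cases s)
    have fr: "\<forall>x. x \<notin> gtmps \<longrightarrow> R1 x = R x" using 1(1) s by simp
    obtain D' where D': "D \<subseteq> D'" "inv m1' D'" "Y.grow_inv L Rr p (R1 ''l'') (R1 ''r'') D'"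
      using 1(1) unfolding s by blast
    define l r where "l = R1 ''l''" and "r = R1 ''r''"
    note G1 = D'(3)[folded l_def r_def]
    note b = Y.grow_invD(1-5)[OF G1]
    have nz: "L < l \<or> r < Rr" using 1(2) g[OF fr] unfolding s l_def r_def by simp
    let ?e = "(Reg ''r'' [<] Reg ''R'') [*]
       (((Load (Reg ''B3'' [+] Reg ''r'') [<] Reg ''p'') [=] Const 0) [+]
        (Load (Reg ''B3'' [+] Reg ''r'') [=] Reg ''l'') [+] (Reg ''l'' [=] Reg ''L''))"
    define d where "d = exp_val w ?e (R1, m1')"
    have rs: "R1 ''B3'' = 3 * M" "R1 ''p'' = p" "R1 ''L'' = L" "R1 ''R'' = Rr" "R1 ''l'' = l" "R1 ''r'' = r"
      using R fr by (simp_all add: regs_def l_def r_def)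
    have d: "d \<noteq> 0 \<longleftrightarrow> Y.grow_right L Rr p l r"
    proof -
      let ?P = "m1' (3 * M + r) < p" and ?P2 = "m1' (3 * M + r) = l" and ?P3 = "l = L"
      have ad: "3 * M + r < 2 ^ w" using b M by (intro lt) simp
      have s3: "of_bool (\<not> ?P) + of_bool ?P2 + of_bool ?P3 < (2::nat) ^ w"
        "of_bool (\<not> ?P) + of_bool ?P2 < (2::nat) ^ w"
        "of_bool (r < Rr) * (of_bool (\<not> ?P) + of_bool ?P2 + of_bool ?P3) < (2::nat) ^ w"
        using M4 by (auto intro!: lt simp: of_bool_def)
      have "d = of_bool (r < Rr) * (of_bool (\<not> ?P) + of_bool ?P2 + of_bool ?P3)"
        unfolding d_def using rs w0 ad s3 by (simp add: val_Less val_Add val_Eq val_Mul)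
      \<comment> \<open>For \<open>r = Rr\<close> the loaded word may lie beyond the partner array;
        the factor \<open>r < Rr\<close> cancels it.\<close>
      moreover have "m1' (3 * M + r) = m2 r" if "r < Rr"
        using D'(2) that b by (auto simp: inv_def arrays_def)
      ultimately show ?thesis by (auto simp: Y.grow_right_def)
    qed
    have rg: "regs (R1(''d'' := d, ''r'' := r', ''l'' := l'))" for r' l'
      using R fr by (simp add: regs_def)
    have st: "wp w block (\<lambda>t' s'. ?I s' \<and> t' + (case s' of (R', m') \<Rightarrow> ((R' ''l'' - L) + (Rr - R' ''r'')) * (btime + 60))
         \<le> t1 + ((l - L) + (Rr - r)) * (btime + 60)) t2 (R1(''d'' := d, ''r'' := r', ''l'' := l'), m1')"
      if t2: "t2 \<le> t1 + 60" and dp: "deps d D' l' r'" and gi: "Y.grow_inv L Rr p l' r' (insert (l', r') D')"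
        and dec: "Suc ((l' - L) + (Rr - r')) \<le> (l - L) + (Rr - r)" for t2 l' r'
    proof (rule wp_block[where l = l' and r = r' and d = d and D = D'], goal_cases)
      case 5 show ?case using Y.grow_invD(2,3)[OF gi] by simp
    next
      case 6 show ?case using Y.grow_invD(4,5)[OF gi] by simp
    next
      case (9 t' R' m')
      have "Suc ((l' - L) + (Rr - r')) * (btime + 60) \<le> ((l - L) + (Rr - r)) * (btime + 60)"
        using dec by (rule mult_le_mono1)
      then have "t' + ((l' - L) + (Rr - r')) * (btime + 60) \<le> t1 + ((l - L) + (Rr - r)) * (btime + 60)"
        using 9(1) t2 by simp
      moreover have "R' ''l'' = l'" "R' ''r'' = r'" using 9(2) by simp_all
      moreover have "\<forall>x. x \<notin> gtmps \<longrightarrow> R' x = R x" using 9(2) fr by simp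
      moreover have "D \<subseteq> insert (l', r') D'" using D'(1) by blast
      ultimately show ?case unfolding prod.case using 9(3) gi
        by (intro conjI exI[of _ "insert (l', r') D'"]) simp_all
    qed (use rg dp D'(2) in simp_all)
    have lb: "l < 2 ^ w" "Suc r < 2 ^ w \<or> \<not> r < Rr" using b M by (auto intro!: lt)
    show ?case unfolding s
    proof (rule wp_Seq, rule wp_Assign, fold d_def, rule wp_Seq, rule wp_If, goal_cases)
      case 1
      then have g: "Y.grow_right L Rr p l r" using d by simp
      then have rR: "r < Rr" by (simp add: Y.grow_right_def)
      have V: "exp_val w (Reg ''r'' [+] Const 1) (R1(''d'' := d), m1') = Suc r"
        using lb rR rs w0 by (simp add: vals)
      have e: "R1(''d'' := d, ''r'' := Suc r) = R1(''d'' := d, ''r'' := Suc r, ''l'' := l)"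
        using rs by (simp add: fun_upd_idem)
      note gs = Y.grow_right_step[OF G1 g]
      have dp: "deps d D' l (Suc r)" using gs(1) 1 b by (simp add: deps_def)
      show ?case
        unfolding l_def[symmetric] r_def[symmetric] prod.case
        by (rule wp_Assign, unfold V, subst e, rule st[OF _ dp gs(2), unfolded prod.case]) (use rR in simp_all)
    next
      case 2
      then have g: "\<not> Y.grow_right L Rr p l r" using d by simp
      then have "L < l" using nz b(1) by (auto simp: Y.grow_right_def)
      then obtain x where x: "l = Suc x" "L \<le> x" by (cases l) auto
      have V: "exp_val w (Reg ''l'' [-] Const 1) (R1(''d'' := d), m1') = x"
        using lb x rs w0 by (simp add: vals)
      have e: "R1(''d'' := d, ''l'' := x) = R1(''d'' := d, ''r'' := r, ''l'' := x)"
        using rs by (simp add: fun_upd_idem)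
      note gs = Y.grow_left_step[OF G1[unfolded x] g[unfolded x] x(2)]
      have dp: "deps d D' x r" using gs(1) 2 b x by (simp add: deps_def)
      show ?case
        unfolding l_def[symmetric] r_def[symmetric] prod.case
        by (rule wp_Assign, unfold V, subst e, rule st[OF _ dp gs(2), unfolded prod.case]) (use x in simp_all)
    qed
  next
    case (2 t1 s)
    obtain R1 m1' where s: "s = (R1, m1')" by (cases s)
    have fr: "\<forall>x. x \<notin> gtmps \<longrightarrow> R1 x = R x" using 2(1) s by simp
    obtain D' where D': "D \<subseteq> D'" "inv m1' D'" "Y.grow_inv L Rr p (R1 ''l'') (R1 ''r'') D'"
      using 2(1) unfolding s by blast
    note b = Y.grow_invD(1-5)[OF D'(3)]
    have "\<not> (L < R1 ''l'') \<and> \<not> (R1 ''r'' < Rr)" using 2(2) g[OF fr] unfolding s by simp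
    then have "R1 ''l'' = L" "R1 ''r'' = Rr" using b by auto
    then show ?case unfolding s using D' fr 2(3) R by (intro Q[where D' = D']) auto
  next
    case 3
    show ?case using R I G by auto
  qed
qed

lemma wp_windowc:
  assumes R: "regs R" "R ''p'' = A" "R ''A'' = A" and I: "inv m D" and P: "Y.phase_inv A D" "0 < A" "A < N2"
    and Q: "\<And>t' R' m' D'. t' \<le> t + (N2 + A) * (btime + 100) + 10 \<Longrightarrow>
      regs R' \<Longrightarrow> R' ''A'' = A \<Longrightarrow> inv m' D' \<Longrightarrow> Y.phase_inv (2 * A) D' \<Longrightarrow> Q t' (R', m')"
  shows "wp w windowc Q t (R, m)"
proof -
  have w0: "0 < w" using w1 by simp
  have lt: "x < 2 ^ w" if "x \<le> 8 * M" for x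
    using that W16 M by linarith
  let ?I = "\<lambda>(R', m'). regs R' \<and> R' ''A'' = A \<and> (\<exists>D'. inv m' D' \<and> Y.window_inv A (R' ''p'') D')"
  show ?thesis
    unfolding windowc_def
  \<comment> \<open>Each window is charged its full length \<open>2 * A\<close>, even if it is cut
    off at \<open>N2\<close>; the additional \<open>2 * A\<close> in the potential covers the last
    one.\<close>
  proof (rule wp_While[where I = ?I and \<phi> = "\<lambda>(R', m'). (N2 + 2 * A - R' ''p'') * (btime + 100)"], goal_cases)
    case (1 t1 s)
    obtain R1 m1' where s: "s = (R1, m1')" by (cases s)
    have I1: "regs R1" "R1 ''A'' = A" using 1(1) by (auto simp: s)
    obtain D' where D': "inv m1' D'" "Y.window_inv A (R1 ''p'') D'"
      using 1(1) unfolding s by blast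
    define p where "p = R1 ''p''"
    have N: "R1 ''N2'' = N2" using I1 by (simp add: regs_def)
    have pN: "p < N2" using 1(2) w0 N by (simp add: s val_Less p_def)
    have Ap: "A \<le> p" using D'(2) unfolding p_def by (auto simp: Y.window_inv_def)
    have bd: "p + A + A < 2 ^ w" "p + A < 2 ^ w" using pN P M by (auto intro!: lt)
    have V: "exp_val w (Reg ''p'' [-] Reg ''A'') (R1, m1') = p - A"
      "exp_val w (Reg ''p'' [+] Reg ''A'') (R1(''L'' := p - A), m1') = p + A"
      using bd Ap I1 by (simp_all add: vals p_def[symmetric])
    let ?R = "R1(''L'' := p - A, ''R'' := p + A)"
    have V2: "(if exp_val w (Reg ''N2'' [<] Reg ''R'') (?R, m1') = 0 then ?R ''R''
      else exp_val w (Reg ''N2'') (?R, m1')) = min N2 (p + A)"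
      using w0 N by (auto simp: val_Less min_def)
    let ?R2 = "R1(''L'' := p - A, ''R'' := min N2 (p + A))"
    have V3: "exp_val w (Reg ''p'') (?R2, m1') = p" "exp_val w (Reg ''p'') (?R2(''l'' := p), m1') = p"
      by (simp_all add: p_def)
    have W: "Y.window_inv A p D'" using D'(2) by (simp add: p_def)
    note gi = Y.window_inv_grow[OF W pN]
    show ?case unfolding s
    proof (rule wp_Seq, rule wp_Assign, unfold V, rule wp_Seq, rule wp_Assign, unfold V, rule wp_Seq,
        rule wp_when_assign, unfold V2 fun_upd_upd, rule wp_Seq, rule wp_Assign, unfold V3, rule wp_Seq,
        rule wp_Assign, unfold V3, rule wp_Seq,
        rule wp_growc[where p = p and L = "p - A" and Rr = "min N2 (p + A)" and ?l0.0 = p and ?r0.0 = p and D = D'], goal_cases)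
      case (9 t2 t3 R3 m3 D3)
      have R3: "R3 ''p'' = p" "R3 ''A'' = A" using 9(3) I1 by (simp_all add: p_def)
      have V4: "exp_val w (Reg ''p'' [+] Reg ''A'' [+] Reg ''A'') (R3, m3) = p + 2 * A"
        using bd R3 by (simp add: vals)
      have "Y.window_inv A (p + 2 * A) D3" using Y.window_inv_step[OF W pN 9(4,6)] .
      moreover have "((p - (p - A)) + (min N2 (p + A) - p)) * (btime + 60) \<le> (2 * A) * (btime + 60)"
        by (intro mult_le_mono1) auto
      moreover have "(2 * A) * (btime + 60) + 80 \<le> (2 * A) * (btime + 100)"
        using P(2) by (simp add: algebra_simps)
      moreover have "N2 + 2 * A - p = 2 * A + (N2 + 2 * A - (p + 2 * A))" using pN by simp
      then have "(N2 + 2 * A - p) * (btime + 100) = (2 * A) * (btime + 100) + (N2 + 2 * A - (p + 2 * A)) * (btime + 100)"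
        by (simp only: add_mult_distrib)
      moreover have "t3 + 6 \<le> t1 + ((p - (p - A)) + (min N2 (p + A) - p)) * (btime + 60) + 80" using 9(1,2) by simp
      ultimately have "Y.window_inv A (p + 2 * A) D3"
        "t3 + 6 + (N2 + 2 * A - (p + 2 * A)) * (btime + 100) \<le> t1 + (N2 + 2 * A - p) * (btime + 100)"
        by linarith+
      moreover have "regs (R3(''p'' := p + 2 * A))" using 9(3) I1 by (simp add: regs_def)
      ultimately show ?case
        using 9(5) R3 by (intro wp_Assign, unfold V4 prod.case p_def[symmetric])
          (intro conjI exI[of _ D3], simp_all)
    qed (use I1 gi D' in \<open>auto simp: regs_def p_def\<close>)
  next
    case (2 t1 s)
    obtain R1 m1' where s: "s = (R1, m1')" by (cases s)
    have I1: "regs R1" "R1 ''A'' = A" using 2(1) by (auto simp: s)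
    obtain D' where D': "inv m1' D'" "Y.window_inv A (R1 ''p'') D'"
      using 2(1) unfolding s by blast
    have N: "R1 ''N2'' = N2" using I1 by (simp add: regs_def)
    have "N2 \<le> R1 ''p''" using 2(2) w0 N by (simp add: s val_Less)
    then have "Y.phase_inv (2 * A) D'" using Y.window_inv_end[OF D'(2)] by simp
    moreover have e: "N2 + 2 * A - A = N2 + A" by simp
    have "t1 \<le> t + (N2 + A) * (btime + 100) + 10" using 2(3) unfolding prod.case R(2) e by simp
    ultimately show ?case unfolding s using I1 D'(1) by (intro Q)
  next
    case 3
    show ?case using R I P Y.window_inv_start by auto
  qed
qed

lemma wp_phasec:
  assumes R: "regs R" "R ''A'' = 1" and I: "inv m D" and P: "Y.phase_inv 1 D" and J: "N2 \<le> 2 ^ J"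
    and Q: "\<And>t' R' m' D'. t' \<le> t + J * (2 * N2 * (btime + 100) + 30) + 10 \<Longrightarrow>
      regs R' \<Longrightarrow> inv m' D' \<Longrightarrow> (0, N2) \<in> D' \<Longrightarrow> Q t' (R', m')"
  shows "wp w phasec Q t (R, m)"
proof -
  have w0: "0 < w" using w1 by simp
  have lt: "x < 2 ^ w" if "x \<le> 8 * M" for x
    using that W16 M by linarith
  let ?I = "\<lambda>(R', m'). regs R' \<and> (\<exists>j. j \<le> J \<and> R' ''A'' = 2 ^ j) \<and> (\<exists>D'. inv m' D' \<and> Y.phase_inv (R' ''A'') D')"
  \<comment> \<open>The number of remaining phases as a function of the register ''A'' alone:
    \<open>J - j\<close> for \<open>A = 2 ^ j\<close>.\<close>
  let ?n = "\<lambda>A. card {i. i < J \<and> A \<le> (2::nat) ^ i}"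
  have n: "?n (2 ^ j) = J - j" for j
  proof -
    have "{i. i < J \<and> (2::nat) ^ j \<le> 2 ^ i} = {j..<J}" by auto
    then show ?thesis by simp
  qed
  let ?X = "2 * N2 * (btime + 100) + 30"
  show ?thesis
    unfolding phasec_def
  proof (rule wp_While[where I = ?I and \<phi> = "\<lambda>(R', m'). ?n (R' ''A'') * ?X"], goal_cases)
    case (1 t1 s)
    obtain R1 m1' where s: "s = (R1, m1')" by (cases s)
    have I1: "regs R1" using 1(1) by (auto simp: s)
    obtain j where j: "j \<le> J" "R1 ''A'' = 2 ^ j" using 1(1) unfolding s by blast
    obtain D' where D': "inv m1' D'" "Y.phase_inv (R1 ''A'') D'"
      using 1(1) unfolding s by blast
    have N: "R1 ''N2'' = N2" using I1 by (simp add: regs_def)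
    define A where "A = R1 ''A''"
    have A: "A < N2" using 1(2) w0 N by (simp add: s val_Less A_def)
    have "j \<noteq> J" using A J j A_def by auto
    then have jJ: "Suc j \<le> J" using j by simp
    have V0: "exp_val w (Reg ''A'') (R1, m1') = A" by (simp add: A_def)
    show ?case unfolding s
    proof (rule wp_Seq, rule wp_Assign, unfold V0, rule wp_Seq, rule wp_windowc[where A = A and D = D'], goal_cases)
      case (8 t2 R2 m2' D2)
      have bd: "A + A < 2 ^ w" using A M by (auto intro!: lt)
      have V: "exp_val w (Reg ''A'' [+] Reg ''A'') (R2, m2') = 2 * A" using 8(3) bd by (simp add: vals)
      have "?n A * ?X = ?X + ?n (2 * A) * ?X"
        using n[of j] n[of "Suc j"] j jJ by (simp add: A_def Suc_diff_Suc flip: mult_Suc)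
      moreover have "(N2 + A) * (btime + 100) \<le> (2 * N2) * (btime + 100)"
        using A by (intro mult_le_mono1) simp
      moreover have "t2 \<le> t1 + 16 + (N2 + A) * (btime + 100)" using 8(1) by simp
      ultimately have "t2 + 4 + ?n (2 * A) * ?X \<le> t1 + ?n A * ?X" by linarith
      moreover have "2 * A = 2 ^ Suc j" using j by (simp add: A_def)
      moreover have "regs (R2(''A'' := 2 * A))" using 8(2) by (simp add: regs_def)
      ultimately show ?case
        using 8(4,5) jJ by (intro wp_Assign, unfold V prod.case A_def[symmetric])
          (intro conjI exI[of _ "Suc j"] exI[of _ D2], simp_all)
    qed (use I1 D' A j in \<open>auto simp: regs_def A_def\<close>)
  next
    case (2 t1 s)
    obtain R1 m1' where s: "s = (R1, m1')" by (cases s)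
    have I1: "regs R1" using 2(1) by (auto simp: s)
    obtain D' where D': "inv m1' D'" "Y.phase_inv (R1 ''A'') D'"
      using 2(1) unfolding s by blast
    have N: "R1 ''N2'' = N2" using I1 by (simp add: regs_def)
    have "N2 \<le> R1 ''A''" using 2(2) w0 N by (simp add: s val_Less)
    then have "(0, N2) \<in> D'" using D'(2) by (simp add: Y.phase_inv_def)
    moreover have "t1 \<le> t + J * ?X + 10" using 2(3) R n[of 0] by simp
    ultimately show ?case unfolding s using I1 D'(1) by (intro Q) auto
  next
    case 3
    show ?case using R I P by (auto intro: exI[of _ 0])
  qed
qed

text \<open>Supplies \<open>diag\<close>: empty second intervals are where all growth starts and
  where an exhausted side of a match ends.\<close>

lemma wp_initc:
  assumes R: "regs R" and I: "inv m {}"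
    and Q: "\<And>t' R' m' D'. t' \<le> t + (N2 + 1) * (btime + 30) + 20 \<Longrightarrow>
      regs R' \<Longrightarrow> inv m' D' \<Longrightarrow> Y.diag D' \<Longrightarrow> Q t' (R', m')"
  shows "wp w initc Q t (R, m)"
proof -
  have w0: "0 < w" using w1 by simp
  have lt: "x < 2 ^ w" if "x \<le> 8 * M" for x
    using that W16 M by linarith
  let ?I = "\<lambda>(R', m'). regs R' \<and> R' ''l'' \<le> Suc N2 \<and> (\<exists>D'. inv m' D' \<and> (\<forall>x < R' ''l''. (x, x) \<in> D'))"
  have g: "exp_val w (Reg ''l'' [<] Reg ''N2'' [+] Const 1) (R1, m1') = of_bool (R1 ''l'' < Suc N2)"
    if "regs R1" for R1 m1'
    using that w0 lt[of "Suc N2"] M by (simp add: vals regs_def)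
  have C0: "exp_val w (Const 0) s = 0" for s by simp
  show ?thesis
    unfolding initc_def
  proof (rule wp_Seq, rule wp_Assign, unfold C0,
      rule wp_While[where I = ?I and \<phi> = "\<lambda>(R', m'). (Suc N2 - R' ''l'') * (btime + 30)"], goal_cases)
    case (1 t1 s)
    obtain R1 m1' where s: "s = (R1, m1')" by (cases s)
    have I1: "regs R1" using 1(1) by (auto simp: s)
    obtain D' where D': "inv m1' D'" "\<forall>x < R1 ''l''. (x, x) \<in> D'" using 1(1) unfolding s by blast
    define l where "l = R1 ''l''"
    have l: "l \<le> N2" using 1(2) g[OF I1] by (simp add: s l_def)
    have V: "exp_val w (Reg ''l'') (R1, m1') = l" by (simp add: l_def)
    show ?case unfolding s
    proof (rule wp_Seq, rule wp_Assign, unfold V, rule wp_Seq,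
        rule wp_block[where l = l and r = l and d = "R1 ''d''" and D = D'], goal_cases)
      case (9 t2 R2 m2')
      have R2: "R2 ''l'' = l" using 9(2) by (simp add: l_def)
      have V2: "exp_val w (Reg ''l'' [+] Const 1) (R2, m2') = Suc l"
        using R2 l w0 lt[of "Suc l"] M by (simp add: vals)
      have "(Suc N2 - l) * (btime + 30) = (Suc N2 - Suc l) * (btime + 30) + (btime + 30)"
        using l by (simp add: Suc_diff_le)
      then have "t2 + 4 + (Suc N2 - Suc l) * (btime + 30) \<le> t1 + (Suc N2 - l) * (btime + 30)" using 9(1) by simp
      moreover have "\<forall>x < Suc l. (x, x) \<in> insert (l, l) D'" using D'(2) by (auto simp: l_def less_Suc_eq)
      moreover have "regs (R2(''l'' := Suc l))" using 9(2) I1 by (simp add: regs_def)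
      ultimately show ?case
        using 9(3) l by (intro wp_Assign, unfold V2 prod.case l_def[symmetric])
          (intro conjI exI[of _ "insert (l, l) D'"], simp_all)
    qed (use I1 D' l in \<open>auto simp: regs_def l_def deps_def\<close>)
  next
    case (2 t1 s)
    obtain R1 m1' where s: "s = (R1, m1')" by (cases s)
    have I1: "regs R1" using 2(1) by (auto simp: s)
    obtain D' where D': "inv m1' D'" "\<forall>x < R1 ''l''. (x, x) \<in> D'" using 2(1) unfolding s by blast
    have "Suc N2 \<le> R1 ''l''" using 2(2) g[OF I1] by (simp add: s)
    then have "Y.diag D'" using D'(2) by (auto simp: Y.diag_def)
    then show ?case unfolding s using 2(3) I1 D'(1) by (intro Q) auto
  next
    case 3
    show ?case using R I by (auto simp: regs_def)
  qed
qed

definition mtime :: "nat \<Rightarrow> nat" where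
  "mtime J = (N2 + 1) * (btime + 30) + J * (2 * N2 * (btime + 100) + 30) + 80"

lemma wp_mainc:
  assumes R: "regs R" and m: "arrays m" "\<And>x. 64 * M \<le> x \<Longrightarrow> m x = 0" and N2: "1 < N2" and J: "N2 \<le> 2 ^ J"
    and K: "shift 0 N1 0 N2 + lam 0 N1 0 N2 \<le> K"
    and Q: "\<And>t' R' m'. t' \<le> t + mtime J \<Longrightarrow> R' ''out'' = Suc (lam 0 N1 0 N2) div 2 \<Longrightarrow> Q t' (R', m')"
  shows "wp w mainc Q t (R, m)"
proof -
  have w0: "0 < w" using w1 by simp
  have z: "tab m a b l r = 0" if "a \<le> b" "b \<le> N1" "l \<le> r" "r \<le> N2" for a b l r
    unfolding tab_def using that M by (intro m(2) adr_large) auto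
  then have I: "inv m {}" using m(1) by (simp add: inv_def small_def sound_def)
  have C1: "exp_val w (Const 1) s = 1" for s using w1 by (simp add: vals)
  show ?thesis
    unfolding mainc_def
  proof (rule wp_Seq, rule wp_initc[OF R I], rule wp_Seq, rule wp_Assign, unfold C1, rule wp_Seq,
      rule wp_phasec[OF _ _ _ _ J], goal_cases)
    case (5 t1 R1 m1' D1 t2 R2 m2' D2)
    have R2: "R2 ''M'' = M" "R2 ''N1'' = N1" "R2 ''N2'' = N2" using 5(6) by (auto simp: regs_def)
    have "tab m2' 0 N1 0 N2 = Suc (lam 0 N1 0 N2)"
      using 5(7,8) K by (auto simp: inv_def good_def exact_def)
    moreover have "exp_val w (adrx (Const 0) (Reg ''N1'') (Const 0) (Reg ''N2'')) (R2, m2') = adr M 0 N1 0 N2"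
      using R2 M by (subst exp_val_adrx[where M = M, OF _ _ _ _ _ W]; simp)
    ultimately have "exp_val w (Load (adrx (Const 0) (Reg ''N1'') (Const 0) (Reg ''N2''))) (R2, m2') = Suc (lam 0 N1 0 N2)"
      by (simp add: tab_def)
    moreover have "Suc (lam 0 N1 0 N2) < 2 ^ w" using K machine.K[OF machine_axioms] W16 M by linarith
    moreover have "exp_val w (Const 2) (R2, m2') = 2" using W16 M by (intro val_Const) linarith
    ultimately have V: "exp_val w (Bin Div (Load (adrx (Const 0) (Reg ''N1'') (Const 0) (Reg ''N2''))) (Const 2)) (R2, m2')
      = Suc (lam 0 N1 0 N2) div 2" by (simp only: exp_val.simps(4) val_Div)
    show ?case
      using 5(1,5) by (intro wp_Assign, unfold V, intro Q) (simp_all add: mtime_def)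
  qed (use N2 Y.phase_inv_start in \<open>auto simp: regs_def\<close>)
qed

end

section \<open>Parsing the input\<close>

text \<open>Positions \<open>p\<close> and \<open>Suc (p + 2 * sz ts)\<close> hold the brackets of
  the first node. Both carry its label, since the right recurrence looks it up at the closing
  bracket.\<close>

fun arr :: "(nat \<Rightarrow> nat) \<Rightarrow> (nat \<Rightarrow> 'a) \<Rightarrow> nat \<Rightarrow> 'a forest \<Rightarrow> bool" where
  "arr m lab p [] \<longleftrightarrow> True"
| "arr m lab p (Node a ts # F) \<longleftrightarrow>
     m p = Suc (p + 2 * sz ts) \<and> m (Suc (p + 2 * sz ts)) = p \<and> lab p = a \<and> lab (Suc (p + 2 * sz ts)) = a \<and>
     arr m lab (Suc p) ts \<and> arr m lab (Suc (Suc (p + 2 * sz ts))) F"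

lemma arr_cong:
  "(\<And>i. p \<le> i \<Longrightarrow> i < p + 2 * sz F \<Longrightarrow> m' i = m i \<and> lab' i = lab i) \<Longrightarrow> arr m lab p F \<Longrightarrow> arr m' lab' p F"
proof (induction F arbitrary: p rule: sz.induct)
  case (2 a ts F)
  have "arr m' lab' (Suc p) ts" using 2 by (intro 2(1)) auto
  moreover have "arr m' lab' (Suc (Suc (p + 2 * sz ts))) F" using 2 by (intro 2(2)) auto
  ultimately show ?case using 2(3,4) by auto
qed simp

lemma fo_arr: "arr m lab p F \<Longrightarrow> fo m lab p (p + 2 * sz F) = F"
proof (induction F arbitrary: p rule: sz.induct)
  case (2 a ts F)
  then show ?case
    using 2(1)[of "Suc p"] 2(2)[of "Suc (Suc (p + 2 * sz ts))"]
    by (subst fo_open) (auto simp: algebra_simps)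
qed simp

lemma wfm_arr:
  "arr m lab p F \<Longrightarrow> wfm p (p + 2 * sz F) m \<and> (\<forall>i. p \<le> i \<and> i < p + 2 * sz F \<longrightarrow> lab (m i) = lab i)"
proof (induction F arbitrary: p rule: sz.induct)
  case (2 a ts F)
  let ?c = "Suc (p + 2 * sz ts)" and ?e = "p + 2 * sz (Node a ts # F)"
  have m: "m p = ?c" "m ?c = p" "lab p = a" "lab ?c = a" using 2(3) by auto
  have 1: "wfm (Suc p) ?c m" "\<And>i. Suc p \<le> i \<Longrightarrow> i < ?c \<Longrightarrow> lab (m i) = lab i"
    using 2(1)[of "Suc p"] 2(3) by auto
  have 2: "wfm (Suc ?c) ?e m" "\<And>i. Suc ?c \<le> i \<Longrightarrow> i < ?e \<Longrightarrow> lab (m i) = lab i"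
    using 2(2)[of "Suc ?c"] 2(3) by (auto simp: algebra_simps)
  note w1 = wfmD[OF 1(1)] and w2 = wfmD[OF 2(1)]
  have "p \<le> m i \<and> m i < ?e \<and> m (m i) = i \<and> m i \<noteq> i \<and> (\<forall>j. i < j \<and> j < m i \<longrightarrow> i < m j \<and> m j < m i)
      \<and> lab (m i) = lab i" if i: "p \<le> i" "i < ?e" for i
  proof -
    consider "i = p" | "Suc p \<le> i" "i < ?c" | "i = ?c" | "Suc ?c \<le> i" using i by linarith
    then show ?thesis
    proof cases
      case 1
      have "p < m j \<and> m j < ?c" if "p < j" "j < ?c" for j
        using w1(1,2)[of j] that by auto
      then show ?thesis using 1 m by auto
    next
      case 2
      then show ?thesis using w1[of i] 1(2)[of i] by auto
    next
      case 3
      then show ?thesis using m by auto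
    next
      case 4
      then show ?thesis using w2[of i] 2(2)[of i] i by auto
    qed
  qed
  then show ?case unfolding wfm_def by blast
qed (auto simp: wfm_def)

lemma bracketing_arr: "arr m lab 0 F \<Longrightarrow> bracketing m lab (2 * sz F)"
  using wfm_arr[of m lab 0 F] by unfold_locales auto

text \<open>The stack cell at ''sp'' holds the position of the innermost open bracket, the cell
  \<open>M\<close> further on the number of its children still to come. At zero the next bracket
  closes; otherwise a node is read.\<close>

definition pbody :: com where
  "pbody = If (Load (Reg ''sp'' [+] Reg ''M''))
     (Store (Reg ''sp'' [+] Reg ''M'') (Load (Reg ''sp'' [+] Reg ''M'') [-] Const 1) ;;
      ''sp'' :== Reg ''sp'' [+] Const 1 ;;
      Store (Reg ''sp'') (Reg ''pos'') ;;
      Store (Reg ''sp'' [+] Reg ''M'') (Load (Reg ''i'' [+] Const 1)) ;;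
      Store (Reg ''bL'' [+] Reg ''pos'') (Load (Reg ''i'')) ;;
      ''i'' :== Reg ''i'' [+] Const 2 ;;
      ''pos'' :== Reg ''pos'' [+] Const 1)
     (''u'' :== Load (Reg ''sp'') ;;
      Store (Reg ''bP'' [+] Reg ''pos'') (Reg ''u'') ;;
      Store (Reg ''bP'' [+] Reg ''u'') (Reg ''pos'') ;;
      Store (Reg ''bL'' [+] Reg ''pos'') (Load (Reg ''bL'' [+] Reg ''u'')) ;;
      ''sp'' :== Reg ''sp'' [-] Const 1 ;;
      ''pos'' :== Reg ''pos'' [+] Const 1)"

definition ploop :: com where
  "ploop = While (Reg ''pos'' [<] Reg ''N'') pbody"

lemma ploop_step:
  assumes "exp_val w (Reg ''pos'' [<] Reg ''N'') s \<noteq> 0" "wp w pbody (wp w ploop Q) (t + 4) s"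
  shows "wp w ploop Q t s"
  using wp_While_step[OF assms(1), of pbody Q t] assms(2) unfolding ploop_def by (simp add: eval_nat_numeral)

text \<open>The bottom of the stack is a virtual root with one child. The loop stops at
  \<open>pos = N\<close>, before that root would be closed.\<close>

definition parsec :: com where
  "parsec = (''pos'' :== Const 0 ;; ''sp'' :== Reg ''B4'' [+] Reg ''M'' ;;
     Store (Reg ''sp'' [+] Reg ''M'') (Const 1) ;; ploop)"

abbreviation preorders :: "nat forest \<Rightarrow> nat list" where
  "preorders F \<equiv> concat (map preorder F)"

lemma length_preorders: "length (preorders F) = 2 * sz F"
  by (induction F rule: sz.induct) auto

lemma length_le_sz: "length F \<le> sz F"
  by (induction F rule: sz.induct) auto

locale parser =
  fixes w M bP bL N :: nat
  assumes W: "16 * M \<le> 2 ^ w" and M: "4 \<le> M" and N: "N \<le> M"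
    and bases: "M \<le> bP" "bP + M \<le> bL" "bL + M \<le> 5 * M"
begin

definition pregs :: "(reg \<Rightarrow> nat) \<Rightarrow> bool" where
  "pregs R \<longleftrightarrow> R ''M'' = M \<and> R ''bP'' = bP \<and> R ''bL'' = bL \<and> R ''N'' = N"

lemma lt: "x \<le> 15 * M \<Longrightarrow> x < 2 ^ w"
  using W M by linarith

lemma w0: "0 < w"
  using lt[of 1] M by (cases w) auto

lemma wp_popen:
  assumes R: "pregs R" "R ''pos'' = p" "R ''sp'' = S" "R ''i'' = i"
    and m: "m (S + M) = Suc q" "q < M" and b: "p < N" "5 * M \<le> S" "Suc S < 6 * M" "Suc i < M"
    and Q: "\<And>t'. t' \<le> t + 60 \<Longrightarrow> wp w ploop Q t' (R(''sp'' := Suc S, ''i'' := i + 2, ''pos'' := Suc p),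
       m(S + M := q, Suc S := p, Suc S + M := m (Suc i), bL + p := m i))"
  shows "wp w ploop Q t (R, m)"
proof -
  have Rs: "R ''M'' = M" "R ''bP'' = bP" "R ''bL'' = bL" "R ''N'' = N" using R by (auto simp: pregs_def)
  have bd: "S + M < 2 ^ w" "Suc S < 2 ^ w" "Suc S + M < 2 ^ w" "Suc i < 2 ^ w" "i + 2 < 2 ^ w" "Suc p < 2 ^ w"
    "bL + p < 2 ^ w" "Suc q < 2 ^ w"
    using b m N bases by (auto intro!: lt)
  have c2: "exp_val w (Const 2) s = 2" for s using lt[of 2] M by (intro val_Const) simp
  show ?thesis
  proof (rule ploop_step)
    show "exp_val w (Reg ''pos'' [<] Reg ''N'') (R, m) \<noteq> 0" using R Rs b w0 by (simp add: val_Less)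
    show "wp w pbody (wp w ploop Q) (t + 4) (R, m)"
      unfolding pbody_def
    proof (rule wp_If, goal_cases)
      case 1
      have V1: "exp_val w (Reg ''sp'' [+] Reg ''M'') (R, m) = S + M"
        "exp_val w (Load (Reg ''sp'' [+] Reg ''M'') [-] Const 1) (R, m) = q"
        using R Rs bd m w0 by (simp_all add: vals)
      let ?m1 = "m(S + M := q)"
      have V2: "exp_val w (Reg ''sp'' [+] Const 1) (R, ?m1) = Suc S" using R bd w0 by (simp add: vals)
      let ?R1 = "R(''sp'' := Suc S)"
      have V3: "exp_val w (Reg ''sp'') (?R1, ?m1) = Suc S" "exp_val w (Reg ''pos'') (?R1, ?m1) = p" using R by simp_all
      let ?m2 = "?m1(Suc S := p)"
      have V4: "exp_val w (Reg ''sp'' [+] Reg ''M'') (?R1, ?m2) = Suc S + M"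
        "exp_val w (Load (Reg ''i'' [+] Const 1)) (?R1, ?m2) = m (Suc i)"
        using R Rs bd w0 b by (simp_all add: vals)
      let ?m3 = "?m2(Suc S + M := m (Suc i))"
      have V5: "exp_val w (Reg ''bL'' [+] Reg ''pos'') (?R1, ?m3) = bL + p"
        "exp_val w (Load (Reg ''i'')) (?R1, ?m3) = m i"
        using R Rs bd w0 b by (simp_all add: vals)
      let ?m4 = "?m3(bL + p := m i)"
      have V6: "exp_val w (Reg ''i'' [+] Const 2) (?R1, ?m4) = i + 2"
        using R bd w0 c2 by (simp add: vals)
      have V7: "exp_val w (Reg ''pos'' [+] Const 1) (?R1(''i'' := i + 2), ?m4) = Suc p"
        using R bd w0 by (simp add: vals)
      show ?case
        by (rule wp_Seq, rule wp_Store, unfold V1, rule wp_Seq, rule wp_Assign, unfold V2,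
            rule wp_Seq, rule wp_Store, unfold V3, rule wp_Seq, rule wp_Store, unfold V4,
            rule wp_Seq, rule wp_Store, unfold V5, rule wp_Seq, rule wp_Assign, unfold V6,
            rule wp_Assign, unfold V7, rule Q) simp
    next
      case 2
      then show ?case using R Rs bd m w0 by (simp add: vals)
    qed
  qed
qed

lemma wp_pclose:
  assumes R: "pregs R" "R ''pos'' = p" "R ''sp'' = Suc S"
    and m: "m (Suc S + M) = 0" "m (Suc S) = u" and b: "p < N" "u < N" "5 * M \<le> S" "Suc S < 6 * M"
    and Q: "\<And>t'. t' \<le> t + 60 \<Longrightarrow> wp w ploop Q t' (R(''u'' := u, ''sp'' := S, ''pos'' := Suc p),
       m(bP + p := u, bP + u := p, bL + p := m (bL + u)))"
  shows "wp w ploop Q t (R, m)"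
proof -
  have Rs: "R ''M'' = M" "R ''bP'' = bP" "R ''bL'' = bL" "R ''N'' = N" using R by (auto simp: pregs_def)
  have bd: "Suc S < 2 ^ w" "Suc S + M < 2 ^ w" "Suc p < 2 ^ w" "bP + p < 2 ^ w" "bP + u < 2 ^ w"
    "bL + p < 2 ^ w" "bL + u < 2 ^ w"
    using b m N bases by (auto intro!: lt)
  show ?thesis
  proof (rule ploop_step)
    show "exp_val w (Reg ''pos'' [<] Reg ''N'') (R, m) \<noteq> 0" using R Rs b w0 by (simp add: val_Less)
    show "wp w pbody (wp w ploop Q) (t + 4) (R, m)"
      unfolding pbody_def
    proof (rule wp_If, goal_cases)
      case 1
      then show ?case using R Rs bd m w0 by (simp add: vals)
    next
      case 2
      let ?R1 = "R(''u'' := u)"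
      have V1: "exp_val w (Load (Reg ''sp'')) (R, m) = u" using R m by simp
      have V2: "exp_val w (Reg ''bP'' [+] Reg ''pos'') (?R1, m) = bP + p" "exp_val w (Reg ''u'') (?R1, m) = u"
        using R Rs bd by (simp_all add: vals)
      let ?m1 = "m(bP + p := u)"
      have V3: "exp_val w (Reg ''bP'' [+] Reg ''u'') (?R1, ?m1) = bP + u" "exp_val w (Reg ''pos'') (?R1, ?m1) = p"
        using R Rs bd by (simp_all add: vals)
      let ?m2 = "?m1(bP + u := p)"
      have V4: "exp_val w (Reg ''bL'' [+] Reg ''pos'') (?R1, ?m2) = bL + p"
        "exp_val w (Load (Reg ''bL'' [+] Reg ''u'')) (?R1, ?m2) = m (bL + u)"
        using R Rs bd b N bases by (simp_all add: vals)
      let ?m3 = "?m2(bL + p := m (bL + u))"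
      have V5: "exp_val w (Reg ''sp'' [-] Const 1) (?R1, ?m3) = S"
        "exp_val w (Reg ''pos'' [+] Const 1) (?R1(''sp'' := S), ?m3) = Suc p"
        using R bd w0 by (simp_all add: vals)
      show ?case
        by (rule wp_Seq, rule wp_Assign, unfold V1, rule wp_Seq, rule wp_Store, unfold V2,
            rule wp_Seq, rule wp_Store, unfold V3, rule wp_Seq, rule wp_Store, unfold V4,
            rule wp_Seq, rule wp_Assign, unfold V5, rule wp_Assign, unfold V5, rule Q) simp
    qed
  qed
qed

definition touched :: "nat \<Rightarrow> nat \<Rightarrow> nat \<Rightarrow> nat set" where
  "touched S p n = {x. bP + p \<le> x \<and> x < bP + p + 2 * n \<or> bL + p \<le> x \<and> x < bL + p + 2 * n \<or>
     S < x \<and> x \<le> S + n \<or> S + M \<le> x \<and> x \<le> S + M + n}"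

text \<open>In continuation style, because a forest is only a segment of the single parser loop: the
  induction chains the segments for the opening bracket, the children, the closing bracket and the
  siblings. \<open>x\<close> counts siblings still expected after \<open>F\<close>.\<close>

lemma wp_ploop_forest:
  assumes "pregs R" "R ''pos'' = p" "R ''sp'' = S" "R ''i'' = i" "m (S + M) = length F + x" "length F + x < M"
    "p + 2 * sz F \<le> N" "5 * M \<le> S" "S + sz F < 6 * M" "i + 2 * sz F < M"
    "\<And>j. j < 2 * sz F \<Longrightarrow> m (i + j) = preorders F ! j"
    "\<And>t' R' m'. t' \<le> t + sz F * 120 \<Longrightarrow>
      \<forall>y. y \<notin> {''pos'', ''i'', ''sp'', ''u''} \<longrightarrow> R' y = R y \<Longrightarrow>
      R' ''pos'' = p + 2 * sz F \<Longrightarrow> R' ''sp'' = S \<Longrightarrow> R' ''i'' = i + 2 * sz F \<Longrightarrow> m' (S + M) = x \<Longrightarrow>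
      arr (\<lambda>j. m' (bP + j)) (\<lambda>j. m' (bL + j)) p F \<Longrightarrow> \<forall>y. y \<notin> touched S p (sz F) \<longrightarrow> m' y = m y \<Longrightarrow>
      wp w ploop Q t' (R', m')"
  shows "wp w ploop Q t (R, m)"
  using assms
proof (induction F arbitrary: R m p S i x t rule: sz.induct)
  case 1
  show ?case by (rule 1(12)) (use 1 in auto)
next
  case (2 a ts F)
  note prems = 2(3-13) and Q = 2(14)
  let ?n = "sz ts" and ?c = "Suc (p + 2 * sz ts)"
  have inp: "m i = a" "m (Suc i) = length ts"
    "\<And>j. j < 2 * sz ts \<Longrightarrow> m (i + 2 + j) = preorders ts ! j"
    "\<And>j. j < 2 * sz F \<Longrightarrow> m (i + 2 + 2 * sz ts + j) = preorders F ! j"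
  proof -
    have p: "preorders (Node a ts # F) = a # length ts # preorders ts @ preorders F" by simp
    show "m i = a" using prems(11)[of 0] by simp
    show "m (Suc i) = length ts" using prems(11)[of 1] by simp
    show "m (i + 2 + j) = preorders ts ! j" if "j < 2 * sz ts" for j
      using prems(11)[of "2 + j"] that length_preorders[of ts] unfolding p by (simp add: nth_append)
    show "m (i + 2 + 2 * sz ts + j) = preorders F ! j" if "j < 2 * sz F" for j
      using prems(11)[of "2 + (2 * sz ts + j)"] that length_preorders[of ts] unfolding p
      by (simp add: nth_append add.assoc)
  qed
  show ?case
  proof (rule wp_popen[where p = p and S = S and i = i and q = "length F + x"], goal_cases)
    case (11 t1)
    let ?R1 = "R(''sp'' := Suc S, ''i'' := i + 2, ''pos'' := Suc p)"
    let ?m1 = "m(S + M := length F + x, Suc S := p, Suc S + M := m (Suc i), bL + p := m i)"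
    have low1: "?m1 y = m y" if "y < M" for y using that prems bases N by auto
    show ?case
    proof (rule 2(1)[where x = 0 and S = "Suc S" and p = "Suc p" and i = "i + 2"], goal_cases)
      case 6 show ?case using length_le_sz[of ts] prems by simp
    next
      case (11 j)
      then show ?case using low1[of "i + 2 + j"] inp(3) prems by simp
    next
      case (12 t2 R2 m2)
      note h = 12 and e2 = 12(7) and t1 = 11
      have f2: "m2 y = ?m1 y" if "y \<notin> touched (Suc S) (Suc p) ?n" for y using 12(8) that by blast
      have o: "m2 (Suc S) = p" "m2 (bL + p) = a" "m2 (S + M) = length F + x"
        using f2[of "Suc S"] f2[of "bL + p"] f2[of "S + M"] prems bases N inp by (auto simp: touched_def)
      have low2: "m2 y = m y" if "y < M" for y
        using f2[of y] low1[OF that] that prems bases N by (auto simp: touched_def)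
      have R2s: "pregs R2" "R2 ''pos'' = ?c" "R2 ''sp'' = Suc S" "R2 ''i'' = i + 2 + 2 * sz ts" "m2 (Suc S + M) = 0"
        using h(2-6) prems(1-4) by (simp_all add: pregs_def)
      show ?case
      proof (rule wp_pclose[where p = ?c and S = S and u = p], goal_cases)
        case (10 t3)
        let ?R3 = "R2(''u'' := p, ''sp'' := S, ''pos'' := Suc ?c)"
        let ?m3 = "m2(bP + ?c := p, bP + p := ?c, bL + ?c := m2 (bL + p))"
        have low3: "?m3 y = m y" if "y < M" for y using low2 that prems bases N by auto
        show ?case
        proof (rule 2(2)[where x = x and S = S and p = "Suc ?c" and i = "i + 2 + 2 * sz ts"], goal_cases)
          case 5 show ?case using o prems bases N by auto
        next
          case (11 j)
          then show ?case using low3[of "i + 2 + 2 * sz ts + j"] inp(4) prems by simp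
        next
          case (12 t4 R4 m4)
          note e = 12
          have f4: "m4 y = ?m3 y" if "y \<notin> touched S (Suc ?c) (sz F)" for y using e(8) that by blast
          have g4: "m4 (bP + j) = ?m3 (bP + j)" "m4 (bL + j) = ?m3 (bL + j)" if "p \<le> j" "j \<le> ?c" for j
            using f4[of "bP + j"] f4[of "bL + j"] that prems bases N by (auto simp: touched_def)
          have "arr (\<lambda>j. m4 (bP + j)) (\<lambda>j. m4 (bL + j)) (Suc p) ts"
          proof (rule arr_cong[OF _ e2])
            fix j assume j: "Suc p \<le> j" "j < Suc p + 2 * sz ts"
            then show "m4 (bP + j) = m2 (bP + j) \<and> m4 (bL + j) = m2 (bL + j)"
              using g4[of j] prems bases N by auto
          qed
          then have A: "arr (\<lambda>j. m4 (bP + j)) (\<lambda>j. m4 (bL + j)) p (Node a ts # F)"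
            using e(7) g4[of p] g4[of ?c] o prems bases N by auto
          have "m4 y = m y" if "y \<notin> touched S p (sz (Node a ts # F))" for y
          proof -
            have "m4 y = ?m3 y" using that by (intro f4) (auto simp: touched_def)
            also have "\<dots> = m2 y" using that by (auto simp: touched_def)
            also have "\<dots> = ?m1 y" using that by (intro f2) (auto simp: touched_def)
            also have "\<dots> = m y" using that by (auto simp: touched_def)
            finally show ?thesis .
          qed
          then have fr: "\<forall>y. y \<notin> touched S p (sz (Node a ts # F)) \<longrightarrow> m4 y = m y" by blast
          have "\<forall>y. y \<notin> {''pos'', ''i'', ''sp'', ''u''} \<longrightarrow> R4 y = R y" using e(2) h(2) by simp
          moreover have "t4 \<le> t + sz (Node a ts # F) * 120" using e(1) h(1) t1 10 by simp
          ultimately show ?case using A fr e(3-6) by (intro Q) simp_all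
        qed (use R2s prems in \<open>simp_all add: pregs_def\<close>)
      qed (use R2s o prems in simp_all)
    qed (use prems inp bases N in \<open>auto simp: pregs_def\<close>)
  qed (use prems in \<open>auto simp: pregs_def\<close>)
qed

end

lemma fo_arr_0: "arr m lab 0 F \<Longrightarrow> fo m lab 0 (2 * sz F) = F"
  using fo_arr[of m lab 0 F] by simp

context parser
begin

lemma wp_parsec:
  assumes R: "pregs R" "R ''B4'' = 4 * M" "R ''i'' = i" and T: "N = 2 * sz [T]" "i + N < M"
    and inp: "\<And>j. j < N \<Longrightarrow> m (i + j) = preorder T ! j"
    and Q: "\<And>t' R' m'. t' \<le> t + sz [T] * 120 + 40 \<Longrightarrow>
      \<forall>y. y \<notin> {''pos'', ''i'', ''sp'', ''u''} \<longrightarrow> R' y = R y \<Longrightarrow> R' ''i'' = i + N \<Longrightarrow>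
      arr (\<lambda>j. m' (bP + j)) (\<lambda>j. m' (bL + j)) 0 [T] \<Longrightarrow>
      \<forall>y. y \<notin> touched (5 * M) 0 (sz [T]) \<longrightarrow> m' y = m y \<Longrightarrow> Q t' (R', m')"
  shows "wp w parsec Q t (R, m)"
proof -
  have Rs: "R ''M'' = M" using R by (auto simp: pregs_def)
  have V1: "exp_val w (Const 0) (R, m) = 0" by simp
  have V2: "exp_val w (Reg ''B4'' [+] Reg ''M'') (R(''pos'' := 0), m) = 5 * M"
    using R Rs lt[of "5 * M"] by (simp add: val_Add)
  let ?R = "R(''pos'' := 0, ''sp'' := 5 * M)"
  have V3: "exp_val w (Reg ''sp'' [+] Reg ''M'') (?R, m) = 6 * M" "exp_val w (Const 1) (?R, m) = 1"
    using Rs w0 lt[of "6 * M"] M by (simp_all add: val_Add val_Const)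
  have pR: "pregs ?R" using R(1) by (simp add: pregs_def)
  show ?thesis
    unfolding parsec_def
  proof (rule wp_Seq, rule wp_Assign, unfold V1, rule wp_Seq, rule wp_Assign, unfold V2, rule wp_Seq,
      rule wp_Store, unfold V3, rule wp_ploop_forest[where F = "[T]" and p = 0 and S = "5 * M" and i = i and x = 0], goal_cases)
    case (11 j)
    then show ?case using inp[of j] T by simp
  next
    case (12 t' R' m')
    have fr: "\<forall>y. y \<notin> touched (5 * M) 0 (sz [T]) \<longrightarrow> m' y = m y"
    proof (intro allI impI)
      fix y assume y: "y \<notin> touched (5 * M) 0 (sz [T])"
      then have "y \<noteq> 6 * M" by (auto simp: touched_def)
      then show "m' y = m y" using 12(8) y by simp
    qed
    have "R' ''N'' = N" using 12(2) R(1) by (simp add: pregs_def)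
    then have "exp_val w (Reg ''pos'' [<] Reg ''N'') (R', m') = 0"
      using 12(3) T(1) w0 by (simp add: val_Less)
    moreover have "Q (t' + (1 + exp_time (Reg ''pos'' [<] Reg ''N''))) (R', m')"
    proof (rule Q)
      show "\<forall>y. y \<notin> {''pos'', ''i'', ''sp'', ''u''} \<longrightarrow> R' y = R y" using 12(2) by simp
    qed (use 12 T fr in simp_all)
    ultimately show ?case unfolding ploop_def by (rule wp_While_exit)
  qed (use pR R T M in simp_all)
qed

end

section \<open>The whole program\<close>

text \<open>For \<open>k = 0\<close> the output register keeps its initial zero, which is the
  distance, and the time is constant. Capping \<open>k\<close> by \<open>N1 + N2\<close> keeps the
  budget within a word and still leaves it above the distance.\<close>

definition program :: com where
  "program = when (Load (Const 0)) (
     ''N1'' :== Load (Const 1) [+] Load (Const 1) ;;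
     ''N2'' :== Load (Const 2) [+] Load (Const 2) ;;
     ''M'' :== Reg ''N1'' [+] Reg ''N2'' [+] Const 4 ;;
     ''B2'' :== Reg ''M'' [+] Reg ''M'' ;;
     ''B3'' :== Reg ''B2'' [+] Reg ''M'' ;;
     ''B4'' :== Reg ''B3'' [+] Reg ''M'' ;;
     ''K'' :== Load (Const 0) ;;
     when (Reg ''N1'' [+] Reg ''N2'' [<] Reg ''K'') (''K'' :== Reg ''N1'' [+] Reg ''N2'') ;;
     ''K'' :== Const 4 [*] Reg ''K'' ;;
     ''i'' :== Const 3 ;;
     ''N'' :== Reg ''N1'' ;; ''bP'' :== Reg ''M'' ;; ''bL'' :== Reg ''B2'' ;; parsec ;;
     ''N'' :== Reg ''N2'' ;; ''bP'' :== Reg ''B3'' ;; ''bL'' :== Reg ''B4'' ;; parsec ;;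
     mainc)"

lemma nth_input: "input k T1 T2 ! (3 + j) = (preorder T1 @ preorder T2) ! j"
  by (simp add: input_def numeral_3_eq_3)

lemma dl_le_sz: "dl F G \<le> sz F + sz G"
  by (induction F G rule: dl.induct) auto

definition total_time :: "nat \<Rightarrow> nat \<Rightarrow> nat \<Rightarrow> nat \<Rightarrow> nat" where
  "total_time n1 n2 K J = (n1 + n2) * 120 + 400 +
     (2 * n2 + 1) * ((2 * K + 1) * ((2 * K + 1) * 620 + 60) + 180) +
     J * (4 * n2 * ((2 * K + 1) * ((2 * K + 1) * 620 + 60) + 250) + 30)"

lemma wp_program:
  fixes T1 T2 :: "nat tree" and k w J :: nat
  defines "n1 \<equiv> sz [T1]" and "n2 \<equiv> sz [T2]"
  defines "M \<equiv> 2 * n1 + 2 * n2 + 4" and "\<kappa> \<equiv> min k (2 * n1 + 2 * n2)"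
  assumes W: "2 * M ^ 4 \<le> 2 ^ w" and k: "0 < k" "dl [T1] [T2] \<le> k" and J: "2 * n2 \<le> 2 ^ J"
  shows "wp w program (\<lambda>t s. t \<le> total_time n1 n2 (4 * \<kappa>) J \<and> result s = dl [T1] [T2]) 0 (start (input k T1 T2))"
proof -
  let ?Q = "\<lambda>t s. t \<le> total_time n1 n2 (4 * \<kappa>) J \<and> result s = dl [T1] [T2]"
  obtain m where s: "start (input k T1 T2) = (\<lambda>_. 0, m)" by (simp add: start_def)
  have len: "length (preorder T1) = 2 * n1" "length (preorder T2) = 2 * n2"
    using length_preorders[of "[T1]"] length_preorders[of "[T2]"] by (simp_all add: n1_def n2_def)
  have m: "m 0 = k" "m 1 = n1" "m 2 = n2" "\<And>j. j < 2 * n1 \<Longrightarrow> m (3 + j) = preorder T1 ! j"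
    "\<And>j. j < 2 * n2 \<Longrightarrow> m (3 + 2 * n1 + j) = preorder T2 ! j" "\<And>x. M \<le> x \<Longrightarrow> m x = 0"
  proof -
    have mm: "m = (\<lambda>i. if i < length (input k T1 T2) then input k T1 T2 ! i else 0)"
      using s by (simp add: start_def)
    have L: "length (input k T1 T2) = 3 + 2 * n1 + 2 * n2" by (simp add: input_def len)
    show "m 0 = k" "m 1 = n1" "m 2 = n2"
      unfolding mm L by (simp_all add: input_def nodes_eq_sz n1_def n2_def)
    show "m (3 + j) = preorder T1 ! j" if "j < 2 * n1" for j
      using that len unfolding mm L by (simp add: nth_input nth_append)
    show "m (3 + 2 * n1 + j) = preorder T2 ! j" if "j < 2 * n2" for j
      using that len unfolding mm L by (simp add: nth_input nth_append add.assoc)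
    show "m x = 0" if "M \<le> x" for x using that unfolding mm L M_def by simp
  qed
  have M4: "4 \<le> M" by (simp add: M_def)
  have W32: "32 * M \<le> 2 ^ w"
  proof -
    have "(4::nat) * 4 * 4 \<le> M * M * M" using M4 by (intro mult_mono) auto
    then have "64 * M \<le> (M * M * M) * M" by simp
    also have "\<dots> = M ^ 4" by (simp add: eval_nat_numeral)
    finally show ?thesis using W by linarith
  qed
  have lt: "x < 2 ^ w" if "x \<le> 31 * M" for x using that W32 M4 by linarith
  have C: "exp_val w (Const c) s = c" if "c \<le> 4" for c s using that M4 by (intro val_Const lt) simp
  interpret P1: parser w M M "2 * M" "2 * n1"
    using W32 M4 by unfold_locales (auto simp: M_def)
  interpret P2: parser w M "3 * M" "4 * M" "2 * n2"
    using W32 M4 by unfold_locales (auto simp: M_def)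
  have w0: "0 < w" by (rule P1.w0)
  have kle: "\<kappa> \<le> 2 * n1 + 2 * n2" by (simp add: \<kappa>_def)
  define R0 :: "reg \<Rightarrow> nat" where "R0 = (\<lambda>_. 0)"
  define R1 where "R1 = R0(''N1'' := 2 * n1, ''N2'' := 2 * n2, ''M'' := M, ''B2'' := 2 * M, ''B3'' := 3 * M, ''B4'' := 4 * M)"
  define R2 where "R2 = R1(''K'' := 4 * \<kappa>, ''i'' := 3, ''N'' := 2 * n1, ''bP'' := M, ''bL'' := 2 * M)"
  have V: "exp_val w (Load (Const 1) [+] Load (Const 1)) (R0, m) = 2 * n1"
    "exp_val w (Load (Const 2) [+] Load (Const 2)) (R0(''N1'' := 2 * n1), m) = 2 * n2"
    using m(2,3) lt[of "2 * n1"] lt[of "2 * n2"] by (simp_all add: C val_Add M_def del: exp_val.simps(1))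
  have V2: "exp_val w (Reg ''N1'' [+] Reg ''N2'' [+] Const 4) (R0(''N1'' := 2 * n1, ''N2'' := 2 * n2), m) = M"
    using lt[of M] by (simp add: C val_Add M_def del: exp_val.simps(1))
  have V3: "exp_val w (Reg ''M'' [+] Reg ''M'') (R0(''N1'' := 2 * n1, ''N2'' := 2 * n2, ''M'' := M), m) = 2 * M"
    "exp_val w (Reg ''B2'' [+] Reg ''M'') (R0(''N1'' := 2 * n1, ''N2'' := 2 * n2, ''M'' := M, ''B2'' := 2 * M), m) = 3 * M"
    "exp_val w (Reg ''B3'' [+] Reg ''M'') (R0(''N1'' := 2 * n1, ''N2'' := 2 * n2, ''M'' := M, ''B2'' := 2 * M, ''B3'' := 3 * M), m) = 4 * M"
    using lt[of "2 * M"] lt[of "3 * M"] lt[of "4 * M"] by (simp_all add: val_Add)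
  have V4: "exp_val w (Load (Const 0)) (R1, m) = k" using m(1) by (simp add: C)
  have V5: "(if exp_val w (Reg ''N1'' [+] Reg ''N2'' [<] Reg ''K'') (R1(''K'' := k), m) = 0 then (R1(''K'' := k)) ''K''
      else exp_val w (Reg ''N1'' [+] Reg ''N2'') (R1(''K'' := k), m)) = \<kappa>"
    using lt[of "2 * n1 + 2 * n2"] w0 by (auto simp: val_Add val_Less R1_def \<kappa>_def M_def)
  have V6: "exp_val w (Const 4 [*] Reg ''K'') (R1(''K'' := \<kappa>), m) = 4 * \<kappa>"
  proof -
    have "4 * \<kappa> < 2 ^ w" using kle by (intro lt) (simp add: M_def)
    then show ?thesis by (simp add: C val_Mul del: exp_val.simps(1))
  qed
  have V7: "exp_val w (Const 3) (S, m) = 3" for S by (rule C) simp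
  have V8: "exp_val w (Reg ''N1'') (R1(''K'' := 4 * \<kappa>, ''i'' := 3), m) = 2 * n1"
    "exp_val w (Reg ''M'') (R1(''K'' := 4 * \<kappa>, ''i'' := 3, ''N'' := 2 * n1), m) = M"
    "exp_val w (Reg ''B2'') (R1(''K'' := 4 * \<kappa>, ''i'' := 3, ''N'' := 2 * n1, ''bP'' := M), m) = 2 * M"
    by (simp_all add: R1_def)
  have k0: "exp_val w (Load (Const 0)) (R0, m) = k" using m(1) by (simp add: C)
  show ?thesis
    unfolding s program_def R0_def[symmetric]
  proof (rule wp_If, rule wp_Seq, rule wp_Assign, unfold V, rule wp_Seq, rule wp_Assign, unfold V,
      rule wp_Seq, rule wp_Assign, unfold V2, rule wp_Seq, rule wp_Assign, unfold V3, rule wp_Seq, rule wp_Assign, unfold V3,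
      rule wp_Seq, rule wp_Assign, unfold V3, fold R1_def, rule wp_Seq, rule wp_Assign, unfold V4, rule wp_Seq,
      rule wp_when_assign, unfold V5 fun_upd_upd, rule wp_Seq, rule wp_Assign, unfold V6 fun_upd_upd,
      rule wp_Seq, rule wp_Assign, unfold V7, rule wp_Seq, rule wp_Assign, unfold V8, rule wp_Seq, rule wp_Assign, unfold V8,
      rule wp_Seq, rule wp_Assign, unfold V8, fold R2_def, rule wp_Seq, rule P1.wp_parsec[where T = T1 and i = 3], goal_cases)
    case 1 show ?case by (simp add: P1.pregs_def R2_def R1_def)
  next
    case 2 show ?case by (simp add: R2_def R1_def)
  next
    case 3 show ?case by (simp add: R2_def R1_def)
  next
    case 4 show ?case by (simp add: n1_def)
  next
    case 5 show ?case by (simp add: M_def)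
  next
    case (6 t j) then show ?case using m(4) by simp
  next
    case (7 t0 t1 S1 m1)
    note t01 = 7(2,3)
    have S1: "S1 y = R2 y" if "y \<notin> {''pos'', ''i'', ''sp'', ''u''}" for y using 7(4) that by blast
    let ?S2 = "S1(''N'' := 2 * n2, ''bP'' := 3 * M, ''bL'' := 4 * M)"
    have U: "exp_val w (Reg ''N2'') (S1, m1) = 2 * n2" "exp_val w (Reg ''B3'') (S1(''N'' := 2 * n2), m1) = 3 * M"
      "exp_val w (Reg ''B4'') (S1(''N'' := 2 * n2, ''bP'' := 3 * M), m1) = 4 * M"
      by (simp_all add: S1 R2_def R1_def)
    have fr1: "m1 y = m y" if "y < M \<or> 7 * M \<le> y" for y
    proof -
      have "2 * sz [T1] < M" by (simp add: M_def n1_def)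
      then have "y \<notin> P1.touched (5 * M) 0 (sz [T1])" using that by (auto simp: P1.touched_def)
      then show ?thesis using 7(7) by blast
    qed
    show ?case
    proof (rule wp_Seq, rule wp_Assign, unfold U, rule wp_Seq, rule wp_Assign, unfold U, rule wp_Seq, rule wp_Assign, unfold U,
        rule wp_Seq, rule P2.wp_parsec[where T = T2 and i = "3 + 2 * n1"], goal_cases)
      case 1 show ?case by (simp add: P2.pregs_def S1 R2_def R1_def)
    next
      case 2 show ?case by (simp add: S1 R2_def R1_def)
    next
      case 3 show ?case using 7(5) by simp
    next
      case 4 show ?case by (simp add: n2_def)
    next
      case 5 show ?case by (simp add: M_def)
    next
      case (6 j)
      then show ?case using m(5) fr1[of "3 + 2 * n1 + j"] by (simp add: M_def)
    next
      case (7 t2 S3 m3)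
      note h = 7
      have S3: "S3 y = R2 y" if "y \<notin> {''pos'', ''i'', ''sp'', ''u'', ''N'', ''bP'', ''bL''}" for y
        using h(2) S1[of y] that by simp
      have fr3: "m3 y = m1 y" if "y < 3 * M \<or> 7 * M \<le> y" for y
      proof -
        have "2 * sz [T2] < M" by (simp add: M_def n2_def)
        then have "y \<notin> P2.touched (5 * M) 0 (sz [T2])" using that by (auto simp: P2.touched_def)
        then show ?thesis using h(5) by blast
      qed
      have A1: "arr (\<lambda>j. m3 (M + j)) (\<lambda>j. m3 (2 * M + j)) 0 [T1]"
      proof (rule arr_cong[OF _ \<open>arr (\<lambda>j. m1 (M + j)) (\<lambda>j. m1 (2 * M + j)) 0 [T1]\<close>])
        fix j assume "j < 0 + 2 * sz [T1]"
        then have "j < M" by (simp add: M_def n1_def)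
        then show "m3 (M + j) = m1 (M + j) \<and> m3 (2 * M + j) = m1 (2 * M + j)" using fr3 by simp
      qed
      have A2: "arr (\<lambda>j. m3 (3 * M + j)) (\<lambda>j. m3 (4 * M + j)) 0 [T2]" by (rule h(4))
      interpret B1: bracketing "\<lambda>j. m3 (M + j)" "\<lambda>j. m3 (2 * M + j)" "2 * n1"
        unfolding n1_def by (rule bracketing_arr[OF A1])
      interpret B2: bracketing "\<lambda>j. m3 (3 * M + j)" "\<lambda>j. m3 (4 * M + j)" "2 * n2"
        unfolding n2_def by (rule bracketing_arr[OF A2])
      interpret X: machine "\<lambda>j. m3 (M + j)" "\<lambda>j. m3 (2 * M + j)" "2 * n1"
          "\<lambda>j. m3 (3 * M + j)" "\<lambda>j. m3 (4 * M + j)" "2 * n2" w M "4 * \<kappa>"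
        by unfold_locales (use W kle in \<open>auto simp: M_def\<close>)
      have fo: "fo (\<lambda>j. m3 (M + j)) (\<lambda>j. m3 (2 * M + j)) 0 (2 * n1) = [T1]"
        "fo (\<lambda>j. m3 (3 * M + j)) (\<lambda>j. m3 (4 * M + j)) 0 (2 * n2) = [T2]"
        using fo_arr_0[OF A1] fo_arr_0[OF A2] by (simp_all add: n1_def n2_def)
      have lam: "X.lam 0 (2 * n1) 0 (2 * n2) = 2 * dl [T1] [T2]"
        unfolding X.lam_def fo by (simp add: n1_def n2_def)
      \<comment> \<open>Both full intervals start at 0, so their displacement is the difference of
        the lengths and at most \<open>lam\<close>, which is twice the distance; this is the origin
        of the factor 4 in the budget.\<close>
      have "shift 0 (2 * n1) 0 (2 * n2) \<le> X.lam 0 (2 * n1) 0 (2 * n2)"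
        using X.lam_len[of 0 "2 * n1" 0 "2 * n2"] by (simp add: shift_def)
      moreover have "dl [T1] [T2] \<le> \<kappa>" using k dl_le_sz[of "[T1]" "[T2]"] by (simp add: \<kappa>_def n1_def n2_def)
      ultimately have K: "shift 0 (2 * n1) 0 (2 * n2) + X.lam 0 (2 * n1) 0 (2 * n2) \<le> 4 * \<kappa>"
        using lam by linarith
      have n2: "1 < 2 * n2" unfolding n2_def by (cases T2) simp
      have z: "m3 x = 0" if "64 * M \<le> x" for x
        using fr3[of x] fr1[of x] m(6)[of x] that by simp
      show ?case
      proof (rule X.wp_mainc[where J = J], goal_cases)
        case 1 show ?case by (simp add: X.regs_def S3 R2_def R1_def)
      next
        case 2 show ?case by (simp add: X.arrays_def)
      next
        case (3 x) then show ?case by (rule z)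
      next
        case 4 show ?case by (rule n2)
      next
        case 5 show ?case by (rule J)
      next
        case 6 show ?case by (rule K)
      next
        case h7: (7 t' R' m')
        have "t' \<le> total_time n1 n2 (4 * \<kappa>) J"
          using h7(1) h(1) t01
          unfolding X.mtime_def X.btime_def total_time_def n1_def[symmetric] n2_def[symmetric] by simp
        \<comment> \<open>\<open>Suc (2 * d) div 2 = d\<close>: the division undoes the doubling and
          drops the successor of the encoding.\<close>
        moreover have "R' ''out'' = dl [T1] [T2]" using h7(2) lam by simp
        ultimately show ?case by (simp add: result_def)
      qed
    qed
  next
    case 8
    then show ?case using k0 k by simp
  qed
qed

section \<open>The time bound\<close>

lemma double_sum_le: "a \<le> x \<Longrightarrow> b \<le> x \<Longrightarrow> 1 \<le> x \<Longrightarrow> (a + b) * 120 + 400 \<le> 640 * (x::nat)"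
  by (rule order_trans[of _ "120 * a + 120 * b + 400 * x"]) simp_all

lemma total_time_le:
  assumes n: "n1 \<le> n" "n2 \<le> n" "1 \<le> n" and K: "K = 4 * \<kappa>" "1 \<le> \<kappa>"
  shows "total_time n1 n2 K J \<le> 210000 * (n * (\<kappa> * \<kappa>) * (J + 1))"
proof -
  define q where "q = \<kappa> * \<kappa>"
  define B where "B = (2 * K + 1) * ((2 * K + 1) * 620 + 60)"
  have q: "1 \<le> q" "\<kappa> \<le> q" using K by (auto simp: q_def)
  have "B \<le> (9 * \<kappa>) * ((9 * \<kappa>) * 620 + 60 * \<kappa>)"
    unfolding B_def using K by (intro mult_mono add_mono) auto
  also have "\<dots> = 50760 * q" by (simp add: q_def algebra_simps)
  finally have B: "B \<le> 50760 * q" .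
  have X: "n \<le> n * q" "1 \<le> n * q" using n(3) q(1) by auto
  have "(2 * n2 + 1) * (B + 180) \<le> (3 * n) * (50940 * q)"
    using n B q by (intro mult_mono) auto
  then have 1: "(2 * n2 + 1) * (B + 180) \<le> 152820 * (n * q)" by simp
  have "4 * n2 * (B + 250) \<le> (4 * n) * (51010 * q)"
    using n B q by (intro mult_mono) auto
  then have "4 * n2 * (B + 250) + 30 \<le> 204070 * (n * q)" using X by linarith
  then have 2: "J * (4 * n2 * (B + 250) + 30) \<le> J * (204070 * (n * q))" by (rule mult_le_mono2)
  have "total_time n1 n2 K J = (n1 + n2) * 120 + 400 + (2 * n2 + 1) * (B + 180) + J * (4 * n2 * (B + 250) + 30)"
    by (simp add: total_time_def B_def)
  also have "\<dots> \<le> 640 * (n * q) + 152820 * (n * q) + J * (204070 * (n * q))"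
  proof (intro add_mono 1 2)
    show "(n1 + n2) * 120 + 400 \<le> 640 * (n * q)"
      using n X by (intro double_sum_le) (auto intro: le_trans)
  qed
  \<comment> \<open>Both \<open>640 + 152820\<close> and \<open>204070\<close> are below
    210000.\<close>
  also have "\<dots> \<le> 210000 * (n * q * (J + 1))" by (simp add: algebra_simps)
  finally show ?thesis by (simp add: q_def)
qed

lemma log_exponent:
  assumes "1 \<le> n"
  obtains j :: nat where "n \<le> 2 ^ j" "real j \<le> log 2 (real n) + 1"
proof
  have l: "0 \<le> log 2 (real n)" using assms by simp
  let ?j = "nat \<lceil>log 2 (real n)\<rceil>"
  have "real n = 2 powr log 2 (real n)" using assms by simp
  also have "\<dots> \<le> 2 powr real ?j" by (intro powr_mono) linarith+
  also have "\<dots> = real (2 ^ ?j)" by (simp add: powr_realpow)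
  finally show "n \<le> 2 ^ ?j" by (simp only: of_nat_le_iff)
  show "real ?j \<le> log 2 (real n) + 1" using l by linarith
qed

text \<open>For \<open>n = 1\<close> the logarithm vanishes and only the \<open>+ 1\<close> remains,
  so the time must be constant: \<open>\<kappa> \<le> 4\<close> and \<open>j \<le> 1\<close> give
  \<open>210000 * 48\<close>, which fixes the size of 12000000. For \<open>n \<ge> 2\<close>,
  \<open>j + 2\<close> is at most \<open>4 * log 2 (real n)\<close>.\<close>

lemma time_bound_real:
  fixes n j \<kappa> k t :: nat
  assumes t: "t \<le> 210000 * (n * (\<kappa> * \<kappa>) * (j + 2))" and j: "real j \<le> log 2 (real n) + 1"
    and \<kappa>: "\<kappa> \<le> k" "\<kappa> \<le> 4 * n" and n: "1 \<le> n"
  shows "real t \<le> 12000000 * (real n * (real k)\<^sup>2 * log 2 (real n) + 1)"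
proof (cases "n = 1")
  case True
  then have "j \<le> 1" using j by simp
  have "\<kappa> * \<kappa> \<le> 4 * 4" using \<kappa>(2) True by (intro mult_mono) auto
  then have "n * (\<kappa> * \<kappa>) * (j + 2) \<le> 16 * 3" using True \<open>j \<le> 1\<close> by (intro mult_mono) auto
  then have "real t \<le> 210000 * 48" using t by linarith
  then show ?thesis
    using True by simp
next
  case False
  then have "log 2 2 \<le> log 2 (real n)" using n by (subst log_le_cancel_iff) auto
  then have l: "1 \<le> log 2 (real n)" by simp
  have "real t \<le> real (210000 * (n * (\<kappa> * \<kappa>) * (j + 2)))" using t by (simp only: of_nat_le_iff)
  also have "\<dots> = 210000 * (real n * (real \<kappa> * real \<kappa>) * (real j + 2))"
    by (simp add: algebra_simps)
  also have "\<dots> \<le> 210000 * (real n * (real k * real k) * (4 * log 2 (real n)))"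
    using \<kappa> j l by (intro mult_left_mono mult_mono) auto
  also have "\<dots> = 840000 * (real n * (real k)\<^sup>2 * log 2 (real n))" by (simp add: power2_eq_square)
  also have "\<dots> \<le> 12000000 * (real n * (real k)\<^sup>2 * log 2 (real n) + 1)"
    using l by (simp add: field_simps)
  finally show ?thesis .
qed

text \<open>The constant is 13 = 9 + 4: \<open>2 * M ^ 4 \<le> 2 ^ 9 * (n + 1) ^ 4\<close>, and
  \<open>2 \<le> n + 1\<close>.\<close>

lemma word_size:
  assumes w: "real w \<ge> real 13 * log 2 (real n + 1)" and n: "1 \<le> n" and M: "M \<le> 4 * (n + 1)"
  shows "2 * M ^ 4 \<le> (2::nat) ^ w"
proof -
  have "(real n + 1) ^ 13 = 2 powr (13 * log 2 (real n + 1))"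
    by (simp add: mult.commute[of 13] powr_realpow flip: powr_powr)
  also have "\<dots> \<le> 2 powr real w" using w by (intro powr_mono) auto
  also have "\<dots> = 2 ^ w" by (simp add: powr_realpow)
  finally have "real ((n + 1) ^ 13) \<le> real (2 ^ w)" by (simp add: add.commute)
  then have *: "(n + 1) ^ 13 \<le> 2 ^ w" by (simp only: of_nat_le_iff)
  have "2 * M ^ 4 \<le> 2 * (4 * (n + 1)) ^ 4" using M by (intro mult_left_mono power_mono) auto
  also have "\<dots> = 2 ^ 9 * (n + 1) ^ 4" by (simp only: power_mult_distrib) simp
  also have "\<dots> \<le> (n + 1) ^ 9 * (n + 1) ^ 4" using n by (intro mult_right_mono power_mono) auto
  also have "\<dots> = (n + 1) ^ 13" by (simp flip: power_add)
  finally show ?thesis using * by simp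
qed

theorem theorem1:
  "\<exists>(P :: com) (C :: real) (c :: nat).
     \<forall>(n :: nat) (k :: nat) (\<Sigma> :: nat set) (T1 :: nat tree) (T2 :: nat tree) (w :: nat).
       nodes T1 \<le> n \<longrightarrow> nodes T2 \<le> n \<longrightarrow>
       set_tree T1 \<subseteq> \<Sigma> \<longrightarrow> set_tree T2 \<subseteq> \<Sigma> \<longrightarrow>
       ed \<Sigma> [T1] [T2] \<le> k \<longrightarrow>
       real w \<ge> real c * log 2 (real n + 1) \<longrightarrow>
       k < 2 ^ w \<longrightarrow> set_tree T1 \<union> set_tree T2 \<subseteq> {..<2 ^ w} \<longrightarrow>
       (\<exists>t s. exec w P (start (input k T1 T2)) t s \<and>
              result s = ed \<Sigma> [T1] [T2] \<and>
              real t \<le> C * (real n * (real k)\<^sup>2 * log 2 (real n) + 1))"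
proof (rule exI[of _ program], rule exI[of _ 12000000], rule exI[of _ 13], intro allI impI)
  fix n k :: nat and \<Sigma> :: "nat set" and T1 T2 :: "nat tree" and w :: nat
  assume n: "nodes T1 \<le> n" "nodes T2 \<le> n" and lab: "set_tree T1 \<subseteq> \<Sigma>" "set_tree T2 \<subseteq> \<Sigma>"
    and ed: "ed \<Sigma> [T1] [T2] \<le> k" and w: "real w \<ge> real 13 * log 2 (real n + 1)"
  have dl: "ed \<Sigma> [T1] [T2] = dl [T1] [T2]" using lab by (intro ed_eq_dl) simp
  have n: "sz [T1] \<le> n" "sz [T2] \<le> n" using n by (simp_all add: nodes_eq_sz)
  have n1: "1 \<le> n" using n(1) by (cases T1) simp
  have "2 * (2 * sz [T1] + 2 * sz [T2] + 4) ^ 4 \<le> 2 ^ w" using n by (intro word_size[OF w n1]) simp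
  note W = this
  show "\<exists>t s. exec w program (start (input k T1 T2)) t s \<and> result s = ed \<Sigma> [T1] [T2] \<and>
      real t \<le> 12000000 * (real n * (real k)\<^sup>2 * log 2 (real n) + 1)"
  proof (cases "k = 0")
    case True
    have "wp w program (\<lambda>t s. t \<le> 10 \<and> result s = 0) 0 (start (input k T1 T2))"
      unfolding program_def
      by (rule wp_If) (use True in \<open>auto simp: start_def input_def result_def intro!: wp_Skip\<close>)
    then obtain t s where "exec w program (start (input k T1 T2)) t s" "t \<le> 10" "result s = 0"
      by (auto simp: wp_def)
    moreover have "real t \<le> 12000000 * (real n * (real k)\<^sup>2 * log 2 (real n) + 1)"
      using True \<open>t \<le> 10\<close> by simp
    ultimately show ?thesis using ed True by (intro exI[of _ t] exI[of _ s]) simp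
  next
    case False
    obtain j where j: "n \<le> 2 ^ j" "real j \<le> log 2 (real n) + 1" using log_exponent[OF n1] .
    define \<kappa> where "\<kappa> = min k (2 * sz [T1] + 2 * sz [T2])"
    have "1 \<le> sz [T1]" by (cases T1) simp
    then have \<kappa>: "1 \<le> \<kappa>" "\<kappa> \<le> k" "\<kappa> \<le> 4 * n" using False n by (auto simp: \<kappa>_def)
    \<comment> \<open>The second string has two brackets per node, hence one phase more than the
      exponent for \<open>n\<close>.\<close>
    have "2 * sz [T2] \<le> 2 ^ (j + 1)" using j(1) n by simp
    from wp_program[OF W _ _ this, of k] obtain t s
      where ts: "exec w program (start (input k T1 T2)) t s" "result s = dl [T1] [T2]"
        "t \<le> total_time (sz [T1]) (sz [T2]) (4 * \<kappa>) (j + 1)"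
      using False ed dl by (auto simp: wp_def \<kappa>_def)
    have "t \<le> 210000 * (n * (\<kappa> * \<kappa>) * (j + 1 + 1))"
      using ts(3) total_time_le[OF n n1 refl \<kappa>(1)] by (rule order_trans)
    then have "real t \<le> 12000000 * (real n * (real k)\<^sup>2 * log 2 (real n) + 1)"
      using j(2) \<kappa>(2,3) n1 by (intro time_bound_real[where j = j and \<kappa> = \<kappa>]) simp_all
    then show ?thesis using ts(1,2) dl by (intro exI[of _ t] exI[of _ s]) simp
  qed
qed

end
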